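(* Let $\ell\ge1$ be an integer, $a\in\mathbb C^*$, and assume that $n\ge2$ is such that $$(n\text{ is even and }\ell\le n+1)\quad\text{or}\quad\Big(n\text{ is odd and }\ell\le\frac{n+1}2\Big).$$ Then $\phi_n\big(\chi_q(V(Y_{\ell,a}Y_{0,aq^\ell}^{-1}))\big)$ is the $q$-character of an actual representation of the quantum toroidal algebra $\mathcal U_q(sl_{n+1}^{tor})$.
   Context: Fix $t\in\mathbb C$ such that $q=e^{t}$ is not a root of unity, and put $q^{r}=e^{tr}$ for $r\in\mathbb Q$; $\psi(z)=\frac{q-q^{-1}z}{1-z}$. Algebras. Let $I$ be either $\mathbb Z$ (giving $\mathcal U_q(\hat{sl}_\infty)$) or $I_n=\mathbb Z/(n+1)\mathbb Z$ with $n\ge2$ (giving $\mathcal U_q(sl_{n+1}^{tor})$), with Cartan matrix $C_{ii}=2$, $C_{i,i\pm1}=-1$, $C_{ij}=0$ otherwise. Let $\mathfrak h=\bigoplus_{i\in I}\mathbb Qh_i$ and $\alpha_j\in\mathfrak h^*$, $\alpha_j(h_i)=C_{ij}$. The algebra is generated over $\mathbb C$ by $x_{i,r}^{\pm}$ ($i\in I,r\in\mathbb Z$), $k_h$ ($h\in\mathfrak h$), $h_{i,m}$ ($i\in I$, $m\in\mathbb Z\setminus\{0\}$). With $x_i^\pm(z)=\sum_{r}x_{i,r}^\pm z^r$, $\phi_i^\pm(z)=\sum_{m\ge0}\phi^\pm_{i,\pm m}z^{\pm m}=k_{\pm h_i}\exp(\pm(q-q^{-1})\sum_{m\ge1}h_{i,\pm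 m}z^{\pm m})$, $\delta(z)=\sum_{s\in\mathbb Z}z^s$, the relations are: $k_hk_{h'}=k_{h+h'}$, $k_0=1$; all $k_h$ and all coefficients of the $\phi_i^\pm(z)$ commute; $k_hx_j^\pm(z)k_{-h}=q^{\pm\alpha_j(h)}x_j^\pm(z)$; for $\epsilon\in\{+,-\}$, $(w-q^{\pm C_{ij}}z)\phi_i^{\epsilon}(z)x_j^\pm(w)=(q^{\pm C_{ij}}w-z)x_j^\pm(w)\phi_i^{\epsilon}(z)$; $[x_i^+(z),x_j^-(w)]=\frac{\delta_{ij}}{q-q^{-1}}\big(\delta(w/z)\phi_i^+(w)-\delta(z/w)\phi_i^-(z)\big)$; $(w-q^{\pm C_{ij}}z)x_i^\pm(z)x_j^\pm(w)=(q^{\pm C_{ij}}w-z)x_j^\pm(w)x_i^\pm(z)$; for $j=i\pm1$, $x_i^\pm(z_1)x_i^\pm(z_2)x_j^\pm(w)-(q+q^{-1})x_i^\pm(z_1)x_j^\pm(w)x_i^\pm(z_2)+x_j^\pm(w)x_i^\pm(z_1)x_i^\pm(z_2)+(z_1\leftrightarrow z_2)=0$; and $[x_i^\pm(z),x_j^\pm(w)]=0$ for $j\neq i,i\pm1$. $q$-characters. A module $V$ is integrable if it is the direct sum of its weight spaces $V_\nu=\{v:k_{h_i}v=q^{\nu(h_i)}v\ \forall i\}$ ($\nu$ integral weights) and all $x_{i,0}^\pm$ are locally nilpotent. For a monomial $m=\prod Y_{i,b}^{u_{i,b}}$ (finite product, $i\in I$, $b\in\mathbb C^*$, $u_{i,b}\in\mathbb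 Z$), $V_m$ is the simultaneous generalized eigenspace on which $\phi_i^\pm(z)$ has generalized eigenvalue the expansion in $z^{\pm1}$ of $\prod_b\psi(bqz)^{u_{i,b}}$ for every $i\in I$. For an integrable $V$ with finite-dimensional $\ell$-weight spaces $V_m$, its $q$-character is the formal sum $\sum_m\dim(V_m)\,m$. The module $V(Y_{\ell,a}Y_{0,aq^\ell}^{-1})$. Let $\mathcal T_{[1,\ell]}$ be the set of integer sequences $T=(i_1<\cdots<i_\ell)$. $\tilde e_iT$ is obtained by replacing the entry $i+1$ by $i$ ($0$ if $i+1\notin T$ or $i\in T$), $\tilde f_iT$ by replacing $i$ by $i+1$ ($0$ if $i\notin T$ or $i+1\in T$). The extremal fundamental loop weight module $V(Y_{\ell,a}Y_{0,aq^\ell}^{-1})$ is the $\mathcal U_q(\hat{sl}_\infty)$-module with basis $\{T_a\}_{T\in\mathcal T_{[1,\ell]}}$ and action: $x_i^+(z)T_a=\sum_{p}\delta_{\{i_p=i+1\}}\delta(aq^{i+\ell+1-2p}z)(\tilde e_iT)_a$; $x_i^-(z)T_a=\sum_{p}\delta_{\{i_p=i\}}\delta(aq^{i+\ell+1-2p}z)(\tilde f_iT)_a$; $\phi_i^\pm(z)T_a=\psi(aq^{i+\ell+3-2p}z)^{-1}T_a$ if $i_p=i+1$ for some $p$ and $i\notin T$; $=\psi(aq^{i+\ell+1-2p}z)T_a$ if $i_p=i$ for some $p$ and $i+1\notin T$; $=T_a$ otherwise. Its $q$-character is $\chi_q(V(Y_{\ell,a}Y_{0,aq^\ell}^{-1}))=\sum_{T\in\mathcal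 T_{[1,\ell]}}m_T$ with $m_T=\prod_{1\le j\le\ell}\boxed{i_j}_{aq^{\ell+1-2j}}$, where $\boxed{j}_b=Y_{j-1,bq^j}^{-1}Y_{j,bq^{j-1}}$. The map $\phi_n$ is induced by $Y_{i,b}^{\pm1}\mapsto Y_{\overline i,b}^{\pm1}$, $\overline i$ the class of $i\in\mathbb Z$ modulo $n+1$, applied term by term; so $\phi_n(\chi_q(V(Y_{\ell,a}Y_{0,aq^\ell}^{-1})))=\sum_{T\in\mathcal T_{[1,\ell]}}\phi_n(m_T)$. *)

theory Defs
  imports
    Complex_Main
    "HOL-Library.Poly_Mapping"
    "HOL-Computational_Algebra.Formal_Power_Series"
begin

unbundle fps_syntax

text \<open>
  Complex vector spaces are realised as subspaces of spaces \<open>'b \<Rightarrow>\<^sub>0 complex\<close> of finitely supported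
  functions; every complex vector space is isomorphic to one of these.
\<close>

type_synonym 'b vec = "'b \<Rightarrow>\<^sub>0 complex"

definition cscale :: "complex \<Rightarrow> 'b vec \<Rightarrow> 'b vec" where
  "cscale c v = Poly_Mapping.map ((*) c) v"

lemma lookup_cscale [simp]: "Poly_Mapping.lookup (cscale c v) b = c * Poly_Mapping.lookup v b"
  by (simp add: cscale_def Poly_Mapping.map.rep_eq when_def)

global_interpretation vec: vector_space cscale
  by unfold_locales (auto intro!: poly_mapping_eqI simp: lookup_add algebra_simps)

definition linear_ext :: "('b \<Rightarrow> 'b vec) \<Rightarrow> 'b vec \<Rightarrow> 'b vec" where
  "linear_ext g v = (\<Sum>b\<in>Poly_Mapping.keys v. cscale (Poly_Mapping.lookup v b) (g b))"

definition linear_endo :: "'b vec set \<Rightarrow> ('b vec \<Rightarrow> 'b vec) \<Rightarrow> bool" where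
  "linear_endo V f \<longleftrightarrow> (\<forall>v\<in>V. f v \<in> V) \<and> (\<forall>v\<in>V. \<forall>w\<in>V. f (v + w) = f v + f w) \<and>
     (\<forall>c. \<forall>v\<in>V. f (cscale c v) = cscale c (f v))"


subsection \<open>The index set, the Cartan matrix and the Cartan subalgebra\<close>

text \<open>
  \<open>\<int>/N\<int>\<close> is represented by \<open>idx N\<close>, with \<open>N = n + 1\<close> for \<open>I\<^sub>n\<close>.  Since \<open>i mod 0 = i\<close>, \<open>N = 0\<close> gives
  \<open>\<int>\<close> itself, so that \<open>N = 0\<close> is the case of the quantum affinization of \<open>sl\<^sub>\<infinity>\<close>.
\<close>

definition idx :: "nat \<Rightarrow> int set" where
  "idx N = {i. i mod int N = i}"

definition cartan :: "nat \<Rightarrow> int \<Rightarrow> int \<Rightarrow> int" where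
  "cartan N i j =
    (if j mod int N = i mod int N then 2
     else if j mod int N = (i + 1) mod int N \<or> j mod int N = (i - 1) mod int N then -1
     else 0)"

text \<open>An element \<open>\<Sum>\<^sub>i c\<^sub>i h\<^sub>i\<close> of the Cartan subalgebra is the finitely supported function \<open>i \<mapsto> c\<^sub>i\<close>.\<close>

definition cartan_alg :: "nat \<Rightarrow> (int \<Rightarrow>\<^sub>0 rat) set" where
  "cartan_alg N = {h. Poly_Mapping.keys h \<subseteq> idx N}"

definition coroot :: "int \<Rightarrow> int \<Rightarrow>\<^sub>0 rat" where
  "coroot i = Poly_Mapping.single i 1"

definition simple_root :: "nat \<Rightarrow> int \<Rightarrow> (int \<Rightarrow>\<^sub>0 rat) \<Rightarrow> rat" where
  "simple_root N j h = (\<Sum>i\<in>Poly_Mapping.keys h. Poly_Mapping.lookup h i * of_int (cartan N i j))"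


subsection \<open>Representations\<close>

datatype sign = Plus | Minus

fun sg :: "sign \<Rightarrow> int" where
  "sg Plus = 1"
| "sg Minus = -1"

text \<open>
  The operators by which the generators \<open>x\<^sub>i\<^sub>,\<^sub>r\<^sup>\<plusminus>\<close>, \<open>k\<^sub>h\<close> and \<open>h\<^sub>i\<^sub>,\<^sub>m\<close> act. Only the values at
  \<open>i \<in> idx N\<close>, \<open>h \<in> cartan_alg N\<close>, \<open>m \<noteq> 0\<close> and at vectors of \<open>vspace\<close> are meaningful.
\<close>

record 'b loop_module =
  vspace :: "'b vec set"
  xgen :: "sign \<Rightarrow> int \<Rightarrow> int \<Rightarrow> 'b vec \<Rightarrow> 'b vec"
  kgen :: "(int \<Rightarrow>\<^sub>0 rat) \<Rightarrow> 'b vec \<Rightarrow> 'b vec"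
  hgen :: "int \<Rightarrow> int \<Rightarrow> 'b vec \<Rightarrow> 'b vec"

text \<open>
  The coefficient of \<open>z\<^sup>m\<close> in \<open>exp (\<Sum>\<^sub>k\<^sub>\<ge>\<^sub>1 A\<^sub>k z\<^sup>k) = \<Sum>\<^sub>p (\<Sum>\<^sub>k\<^sub>\<ge>\<^sub>1 A\<^sub>k z\<^sup>k)\<^sup>p / p!\<close>, where the \<open>p\<close>-th power
  is expanded over the lists of \<open>p\<close> positive integers.
\<close>

definition compositions :: "nat \<Rightarrow> nat list set" where
  "compositions m = {ms. 0 \<notin> set ms \<and> sum_list ms = m}"

definition exp_coeff :: "(nat \<Rightarrow> 'b vec \<Rightarrow> 'b vec) \<Rightarrow> nat \<Rightarrow> 'b vec \<Rightarrow> 'b vec" where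
  "exp_coeff A m v = (\<Sum>ms\<in>compositions m. cscale (1 / fact (length ms)) (foldr A ms v))"

text \<open>
  \<open>phi t M \<epsilon> i m\<close> is the coefficient of \<open>z\<^sup>m\<close> in \<open>\<phi>\<^sub>i\<^sup>\<epsilon>(z)\<close>, for any integer \<open>m\<close>; here \<open>q = exp t\<close>.
\<close>

definition phi :: "complex \<Rightarrow> 'b loop_module \<Rightarrow> sign \<Rightarrow> int \<Rightarrow> int \<Rightarrow> 'b vec \<Rightarrow> 'b vec" where
  "phi t M \<epsilon> i m v =
    (if sg \<epsilon> * m < 0 then 0
     else kgen M (Poly_Mapping.single i (of_int (sg \<epsilon>)))
       (exp_coeff (\<lambda>k u. cscale (of_int (sg \<epsilon>) * (exp t - 1 / exp t)) (hgen M i (sg \<epsilon> * int k) u))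
          (nat \<bar>m\<bar>) v))"

text \<open>
  A representation of the algebra given by generators and relations is a vector space with operators
  that satisfy the relations. Relations between formal series are written coefficientwise; for
  instance, the coefficient of \<open>z\<^sup>m w\<^sup>r\<close> in \<open>\<delta>(w/z) \<phi>\<^sub>i\<^sup>+(w)\<close> and in \<open>\<delta>(z/w) \<phi>\<^sub>i\<^sup>+(z)\<close> is the one
  of \<open>\<phi>\<^sub>i\<^sup>+\<close> of index \<open>m + r\<close>.
\<close>

definition serre_term :: "complex \<Rightarrow> 'b loop_module \<Rightarrow> sign \<Rightarrow> int \<Rightarrow> int \<Rightarrow> int \<Rightarrow> int \<Rightarrow> int \<Rightarrow> 'b vec \<Rightarrow> 'b vec" where
  "serre_term t M \<epsilon> i j m\<^sub>1 m\<^sub>2 r v =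
     xgen M \<epsilon> i m\<^sub>1 (xgen M \<epsilon> i m\<^sub>2 (xgen M \<epsilon> j r v))
     - cscale (exp t + 1 / exp t) (xgen M \<epsilon> i m\<^sub>1 (xgen M \<epsilon> j r (xgen M \<epsilon> i m\<^sub>2 v)))
     + xgen M \<epsilon> j r (xgen M \<epsilon> i m\<^sub>1 (xgen M \<epsilon> i m\<^sub>2 v))"

definition loop_representation :: "complex \<Rightarrow> nat \<Rightarrow> 'b loop_module \<Rightarrow> bool" where
  "loop_representation t N M \<longleftrightarrow>
     (let V = vspace M; q = exp t; I = idx N; H = cartan_alg N;
          X = xgen M; K = kgen M; P = phi t M in
      vec.subspace V \<and>
      (\<forall>\<epsilon>. \<forall>i\<in>I. \<forall>r. linear_endo V (X \<epsilon> i r)) \<and>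
      (\<forall>h\<in>H. linear_endo V (K h)) \<and>
      (\<forall>i\<in>I. \<forall>m. m \<noteq> 0 \<longrightarrow> linear_endo V (hgen M i m)) \<and>
      (\<forall>v\<in>V. K 0 v = v) \<and>
      (\<forall>h\<in>H. \<forall>h'\<in>H. \<forall>v\<in>V. K h (K h' v) = K (h + h') v) \<and>
      (\<forall>h\<in>H. \<forall>\<epsilon>. \<forall>i\<in>I. \<forall>m. \<forall>v\<in>V. K h (P \<epsilon> i m v) = P \<epsilon> i m (K h v)) \<and>
      (\<forall>\<epsilon> \<epsilon>'. \<forall>i\<in>I. \<forall>j\<in>I. \<forall>m r. \<forall>v\<in>V.
         P \<epsilon> i m (P \<epsilon>' j r v) = P \<epsilon>' j r (P \<epsilon> i m v)) \<and>
      (\<forall>h\<in>H. \<forall>\<epsilon>. \<forall>j\<in>I. \<forall>r. \<forall>v\<in>V.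
         K h (X \<epsilon> j r (K (- h) v)) =
         cscale (exp (t * of_rat (of_int (sg \<epsilon>) * simple_root N j h))) (X \<epsilon> j r v)) \<and>
      (\<forall>\<epsilon> \<epsilon>'. \<forall>i\<in>I. \<forall>j\<in>I. \<forall>m r. \<forall>v\<in>V.
         let Q = q powi (sg \<epsilon>' * cartan N i j) in
         P \<epsilon> i m (X \<epsilon>' j (r - 1) v) - cscale Q (P \<epsilon> i (m - 1) (X \<epsilon>' j r v)) =
         cscale Q (X \<epsilon>' j (r - 1) (P \<epsilon> i m v)) - X \<epsilon>' j r (P \<epsilon> i (m - 1) v)) \<and>
      (\<forall>i\<in>I. \<forall>j\<in>I. \<forall>m r. \<forall>v\<in>V.
         X Plus i m (X Minus j r v) - X Minus j r (X Plus i m v) =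
         (if i = j then cscale (1 / (q - 1 / q)) (P Plus i (m + r) v - P Minus i (m + r) v) else 0)) \<and>
      (\<forall>\<epsilon>. \<forall>i\<in>I. \<forall>j\<in>I. \<forall>m r. \<forall>v\<in>V.
         let Q = q powi (sg \<epsilon> * cartan N i j) in
         X \<epsilon> i m (X \<epsilon> j (r - 1) v) - cscale Q (X \<epsilon> i (m - 1) (X \<epsilon> j r v)) =
         cscale Q (X \<epsilon> j (r - 1) (X \<epsilon> i m v)) - X \<epsilon> j r (X \<epsilon> i (m - 1) v)) \<and>
      (\<forall>\<epsilon>. \<forall>i\<in>I. \<forall>j\<in>I. cartan N i j = -1 \<longrightarrow> (\<forall>m\<^sub>1 m\<^sub>2 r. \<forall>v\<in>V.
         serre_term t M \<epsilon> i j m\<^sub>1 m\<^sub>2 r v + serre_term t M \<epsilon> i j m\<^sub>2 m\<^sub>1 r v = 0)) \<and>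
      (\<forall>\<epsilon>. \<forall>i\<in>I. \<forall>j\<in>I. cartan N i j = 0 \<longrightarrow> (\<forall>m r. \<forall>v\<in>V.
         X \<epsilon> i m (X \<epsilon> j r v) = X \<epsilon> j r (X \<epsilon> i m v))))"


subsection \<open>Integrability and \<open>q\<close>-characters\<close>

text \<open>An integral weight \<open>\<nu>\<close> is given by its values \<open>\<nu> i\<close> at the \<open>h\<^sub>i\<close>.\<close>

definition integral_weights :: "nat \<Rightarrow> (int \<Rightarrow> int) set" where
  "integral_weights N = {\<nu>. \<forall>i. i \<notin> idx N \<longrightarrow> \<nu> i = 0}"

definition weight_space :: "complex \<Rightarrow> nat \<Rightarrow> 'b loop_module \<Rightarrow> (int \<Rightarrow> int) \<Rightarrow> 'b vec set" where
  "weight_space t N M \<nu> =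
     {v \<in> vspace M. \<forall>i\<in>idx N. kgen M (coroot i) v = cscale (exp t powi \<nu> i) v}"

definition integrable :: "complex \<Rightarrow> nat \<Rightarrow> 'b loop_module \<Rightarrow> bool" where
  "integrable t N M \<longleftrightarrow>
     (\<forall>v\<in>vspace M. \<exists>!f :: (int \<Rightarrow> int) \<Rightarrow>\<^sub>0 'b vec.
        Poly_Mapping.keys f \<subseteq> integral_weights N \<and>
        (\<forall>\<nu>\<in>Poly_Mapping.keys f. Poly_Mapping.lookup f \<nu> \<in> weight_space t N M \<nu>) \<and>
        v = (\<Sum>\<nu>\<in>Poly_Mapping.keys f. Poly_Mapping.lookup f \<nu>)) \<and>
     (\<forall>\<epsilon>. \<forall>i\<in>idx N. \<forall>v\<in>vspace M. \<exists>k. (xgen M \<epsilon> i 0 ^^ k) v = 0)"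

text \<open>
  \<open>psi t \<epsilon> c\<close> is the expansion of \<open>\<psi>(c z) = (q - q\<^sup>-\<^sup>1 c z) / (1 - c z)\<close> as a power series in \<open>z\<close>
  (\<open>\<epsilon> = Plus\<close>), respectively in \<open>w = z\<^sup>-\<^sup>1\<close> (\<open>\<epsilon> = Minus\<close>), where it is \<open>(q w - q\<^sup>-\<^sup>1 c) / (w - c)\<close>.
\<close>

fun psi :: "complex \<Rightarrow> sign \<Rightarrow> complex \<Rightarrow> complex fps" where
  "psi t Plus c =
     (fps_const (exp t) - fps_const (c / exp t) * fps_X) * inverse (1 - fps_const c * fps_X)"
| "psi t Minus c =
     (fps_const (exp t) * fps_X - fps_const (c / exp t)) * inverse (fps_X - fps_const c)"

text \<open>The monomial \<open>\<Prod> Y\<^sub>i\<^sub>,\<^sub>b\<^bsup>u(i,b)\<^esup>\<close> is the finitely supported function \<open>u\<close>.\<close>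

type_synonym monomial = "(int \<times> complex) \<Rightarrow>\<^sub>0 int"

definition monomials :: "nat \<Rightarrow> monomial set" where
  "monomials N = {u. Poly_Mapping.keys u \<subseteq> idx N \<times> (- {0})}"

definition ell_weight :: "complex \<Rightarrow> monomial \<Rightarrow> sign \<Rightarrow> int \<Rightarrow> complex fps" where
  "ell_weight t u \<epsilon> i =
     (\<Prod>b\<in>{b. (i, b) \<in> Poly_Mapping.keys u}. psi t \<epsilon> (b * exp t) powi Poly_Mapping.lookup u (i, b))"

definition ell_weight_space :: "complex \<Rightarrow> nat \<Rightarrow> 'b loop_module \<Rightarrow> monomial \<Rightarrow> 'b vec set" where
  "ell_weight_space t N M u =
     {v \<in> vspace M. \<forall>i\<in>idx N. \<forall>\<epsilon>. \<forall>m::nat. \<exists>p.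
        ((\<lambda>w. phi t M \<epsilon> i (sg \<epsilon> * int m) w - cscale (ell_weight t u \<epsilon> i $ m) w) ^^ p) v = 0}"

definition fin_dim_ell_weight_spaces :: "complex \<Rightarrow> nat \<Rightarrow> 'b loop_module \<Rightarrow> bool" where
  "fin_dim_ell_weight_spaces t N M \<longleftrightarrow>
     (\<forall>u\<in>monomials N. \<exists>B. finite B \<and> ell_weight_space t N M u \<subseteq> vec.span B)"

text \<open>A formal sum of monomials is given by its coefficients.\<close>

definition q_char :: "complex \<Rightarrow> nat \<Rightarrow> 'b loop_module \<Rightarrow> monomial \<Rightarrow> nat" where
  "q_char t N M u = (if u \<in> monomials N then vec.dim (ell_weight_space t N M u) else 0)"


subsection \<open>The extremal fundamental loop weight module\<close>

definition tableaux :: "nat \<Rightarrow> int list set" where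
  "tableaux l = {T. length T = l \<and> sorted_wrt (<) T}"

definition tab_e :: "int \<Rightarrow> int list \<Rightarrow> int list option" where
  "tab_e i T = (if i + 1 \<in> set T \<and> i \<notin> set T
     then Some (map (\<lambda>j. if j = i + 1 then i else j) T) else None)"

definition tab_f :: "int \<Rightarrow> int list \<Rightarrow> int list option" where
  "tab_f i T = (if i \<in> set T \<and> i + 1 \<notin> set T
     then Some (map (\<lambda>j. if j = i then i + 1 else j) T) else None)"

definition basis_vec :: "'b option \<Rightarrow> 'b vec" where
  "basis_vec T = (case T of None \<Rightarrow> 0 | Some T \<Rightarrow> Poly_Mapping.single T 1)"

text \<open>The entry \<open>i\<^sub>p\<close> of \<open>T = (i\<^sub>1 < \<dots> < i\<^sub>l)\<close> is \<open>T ! (p - 1)\<close>.\<close>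

fun fund_x :: "complex \<Rightarrow> nat \<Rightarrow> complex \<Rightarrow> sign \<Rightarrow> int \<Rightarrow> int \<Rightarrow> int list \<Rightarrow> int list vec" where
  "fund_x t l a Plus i r T =
     (\<Sum>p\<in>{p \<in> {1..l}. T ! (p - 1) = i + 1}.
        cscale ((a * exp t powi (i + int l + 1 - 2 * int p)) powi r) (basis_vec (tab_e i T)))"
| "fund_x t l a Minus i r T =
     (\<Sum>p\<in>{p \<in> {1..l}. T ! (p - 1) = i}.
        cscale ((a * exp t powi (i + int l + 1 - 2 * int p)) powi r) (basis_vec (tab_f i T)))"

definition position :: "int \<Rightarrow> int list \<Rightarrow> nat" where
  "position j T = (THE p. p \<in> {1..length T} \<and> T ! (p - 1) = j)"

text \<open>The eigenvalue of \<open>\<phi>\<^sub>i\<^sup>\<epsilon>(z)\<close> on the basis vector of \<open>T\<close>, as a power series in \<open>z\<close> or \<open>z\<^sup>-\<^sup>1\<close>.\<close>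

definition fund_phi :: "complex \<Rightarrow> nat \<Rightarrow> complex \<Rightarrow> sign \<Rightarrow> int \<Rightarrow> int list \<Rightarrow> complex fps" where
  "fund_phi t l a \<epsilon> i T =
     (if i + 1 \<in> set T \<and> i \<notin> set T then
        inverse (psi t \<epsilon> (a * exp t powi (i + int l + 3 - 2 * int (position (i + 1) T))))
      else if i \<in> set T \<and> i + 1 \<notin> set T then
        psi t \<epsilon> (a * exp t powi (i + int l + 1 - 2 * int (position i T)))
      else 1)"

text \<open>
  The action of the \<open>h\<^sub>i\<^sub>,\<^sub>m\<close> is determined by that of the \<open>\<phi>\<^sub>i\<^sup>\<plusminus>(z)\<close>: with \<open>\<Phi>(z)\<close> an eigenvalue of the
  latter, the eigenvalue of \<open>\<plusminus>(q - q\<^sup>-\<^sup>1) \<Sum>\<^sub>m\<^sub>\<ge>\<^sub>1 h\<^sub>i\<^sub>,\<^sub>\<plusminus>\<^sub>m z\<^sup>\<plusminus>\<^sup>m\<close> is the formal logarithm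
  \<open>log (\<Phi> / \<Phi>(0)) = \<integral> \<Phi>' / \<Phi>\<close>. The lemma \<open>phi_fund_module\<close> below confirms that this is the
  right choice.
\<close>

definition fps_log :: "complex fps \<Rightarrow> complex fps" where
  "fps_log f = fps_integral0 (fps_deriv f * inverse f)"

definition fund_h :: "complex \<Rightarrow> nat \<Rightarrow> complex \<Rightarrow> int \<Rightarrow> int \<Rightarrow> int list \<Rightarrow> complex" where
  "fund_h t l a i m T =
     of_int (sgn m) / (exp t - 1 / exp t) *
     (fps_log (fund_phi t l a (if m > 0 then Plus else Minus) i T) $ nat \<bar>m\<bar>)"

definition fund_weight :: "int list \<Rightarrow> (int \<Rightarrow>\<^sub>0 rat) \<Rightarrow> rat" where
  "fund_weight T h =
     (\<Sum>i\<in>Poly_Mapping.keys h. Poly_Mapping.lookup h i * (of_bool (i \<in> set T) - of_bool (i + 1 \<in> set T)))"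

definition fund_module :: "complex \<Rightarrow> nat \<Rightarrow> complex \<Rightarrow> int list loop_module" where
  "fund_module t l a =
    \<lparr> vspace = {v. Poly_Mapping.keys v \<subseteq> tableaux l},
      xgen = (\<lambda>\<epsilon> i r. linear_ext (fund_x t l a \<epsilon> i r)),
      kgen = (\<lambda>h. linear_ext (\<lambda>T. cscale (exp (t * of_rat (fund_weight T h))) (Poly_Mapping.single T 1))),
      hgen = (\<lambda>i m. linear_ext (\<lambda>T. cscale (fund_h t l a i m T) (Poly_Mapping.single T 1))) \<rparr>"


context
begin

private lemma linear_ext_cscale_single:
  "linear_ext g (cscale c (Poly_Mapping.single T 1)) = cscale c (g T)"
proof -
  have "cscale c (Poly_Mapping.single T 1) = Poly_Mapping.single T c"
    by (rule poly_mapping_eqI) (simp add: lookup_single when_def)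
  then show ?thesis
    by (simp add: linear_ext_def)
qed

private lemma exp_coeff_eigenvector:
  assumes A: "\<And>k c. k > 0 \<Longrightarrow> A k (cscale c v) = cscale (c * L $ k) v" and L0: "L $ 0 = 0"
  shows "exp_coeff A m v = cscale ((fps_exp 1 oo L) $ m) v"
proof -
  have foldr: "foldr A ms v = cscale (prod_list (map (($) L) ms)) v" if "0 \<notin> set ms" for ms
    using that by (induction ms) (auto simp: A mult.commute)
  have fin: "finite (natpermute m k)" for k
    by (rule natpermute_finite)
  have nth: "(L ^ k) $ m = (\<Sum>ms\<in>natpermute m k. prod_list (map (($) L) ms))" for k
  proof (cases k)
    case 0
    moreover have "natpermute m 0 = (if m = 0 then {[]} else {})"
      by (auto simp: natpermute_def)
    ultimately show ?thesis by simp
  next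
    case (Suc k')
    have "prod_list (map (($) L) ms) = (\<Prod>j=0..k'. L $ (ms ! j))" if "ms \<in> natpermute m k" for ms
      using that Suc by (auto simp: natpermute_def prod.list_conv_set_nth atLeastLessThanSuc_atLeastAtMost intro!: prod.cong)
    then show ?thesis
      using Suc by (simp add: fps_power_nth del: power_Suc)
  qed
  have un: "compositions m = (\<Union>k\<in>{0..m}. {ms \<in> natpermute m k. 0 \<notin> set ms})"
  proof -
    have "length ms \<le> sum_list ms" if "0 \<notin> set ms" for ms :: "nat list"
      using that by (induction ms) auto
    then show ?thesis
      by (auto simp: compositions_def natpermute_def)
  qed
  have "exp_coeff A m v =
      (\<Sum>ms\<in>compositions m. cscale (1 / fact (length ms) * prod_list (map (($) L) ms)) v)"
    unfolding exp_coeff_def by (intro sum.cong refl) (simp add: foldr compositions_def)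
  also have "\<dots> = cscale (\<Sum>ms\<in>compositions m. 1 / fact (length ms) * prod_list (map (($) L) ms)) v"
    by (simp add: vec.scale_sum_left)
  also have "(\<Sum>ms\<in>compositions m. 1 / fact (length ms) * prod_list (map (($) L) ms)) =
      (\<Sum>k=0..m. \<Sum>ms\<in>{ms \<in> natpermute m k. 0 \<notin> set ms}. 1 / fact (length ms) * prod_list (map (($) L) ms))"
    unfolding un by (rule sum.UNION_disjoint) (use fin in simp, use fin in simp, auto simp: natpermute_def)
  also have "\<dots> = (\<Sum>k=0..m. \<Sum>ms\<in>natpermute m k. 1 / fact k * prod_list (map (($) L) ms))"
  proof (rule sum.cong)
    fix k
    have "prod_list (map (($) L) ms) = 0" if "0 \<in> set ms" for ms
      using that L0 by (metis image_eqI prod_list_zero_iff set_map)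
    then show "(\<Sum>ms\<in>{ms \<in> natpermute m k. 0 \<notin> set ms}. 1 / fact (length ms) * prod_list (map (($) L) ms)) =
        (\<Sum>ms\<in>natpermute m k. 1 / fact k * prod_list (map (($) L) ms))"
      by (intro sum.mono_neutral_cong_left) (use fin in \<open>auto simp: natpermute_def\<close>)
  qed simp
  also have "\<dots> = (fps_exp 1 oo L) $ m"
    by (simp add: fps_compose_nth nth sum_distrib_left)
  finally show ?thesis .
qed

private lemma exp_fps_log:
  assumes "f $ 0 \<noteq> 0"
  shows "fps_const (f $ 0) * (fps_exp 1 oo fps_log f) = f"
proof -
  define g where "g = fps_exp 1 oo fps_log f"
  have inv: "f * inverse f = 1"
    using assms by (simp add: inverse_mult_eq_1')
  have "fps_deriv g = g * (fps_deriv f * inverse f)"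
    by (simp add: g_def fps_compose_deriv fps_log_def fps_deriv_fps_integral)
  then have "fps_deriv (g * inverse f) = 0"
    using assms by (simp add: fps_inverse_deriv power2_eq_square algebra_simps)
  then have "g * inverse f = fps_const ((g * inverse f) $ 0)"
    by (simp only: fps_deriv_eq_0_iff)
  moreover have "(g * inverse f) $ 0 = 1 / f $ 0"
    by (simp add: g_def field_simps)
  ultimately have eq: "g * inverse f = fps_const (1 / f $ 0)"
    by simp
  have "g = (g * inverse f) * f"
    using inv by (simp add: mult.assoc mult.commute)
  also have "\<dots> = fps_const (1 / f $ 0) * f"
    by (simp only: eq)
  finally show ?thesis
    using assms by (simp add: g_def mult.assoc [symmetric])
qed

lemma phi_fund_module:
  assumes "a \<noteq> 0" and "exp t - 1 / exp t \<noteq> 0"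
  shows "phi t (fund_module t l a) \<epsilon> i (sg \<epsilon> * int m) (Poly_Mapping.single T 1) =
    cscale (fund_phi t l a \<epsilon> i T $ m) (Poly_Mapping.single T 1)"
proof -
  define f where "f = fund_phi t l a \<epsilon> i T"
  define A where "A = (\<lambda>k u. cscale (of_int (sg \<epsilon>) * (exp t - 1 / exp t))
    (hgen (fund_module t l a) i (sg \<epsilon> * int k) u))"
  have sg: "sg \<epsilon> = 1 \<and> \<epsilon> = Plus \<or> sg \<epsilon> = -1 \<and> \<epsilon> = Minus"
    by (cases \<epsilon>) auto
  have psi0: "psi t \<epsilon> c $ 0 = (if \<epsilon> = Plus then exp t else inverse (exp t))" if "c \<noteq> 0" for c
    using that by (cases \<epsilon>) (auto simp: field_simps)
  have f0: "f $ 0 = exp (t * of_rat (fund_weight T (Poly_Mapping.single i (of_int (sg \<epsilon>)))))"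
    using assms(1) sg by (auto simp: f_def fund_phi_def psi0 fund_weight_def exp_minus of_rat_minus)
  have "A k (cscale c (Poly_Mapping.single T 1)) =
      cscale (c * fps_log f $ k) (Poly_Mapping.single T 1)" if "k > 0" for k c
    using that sg assms(2)
    by (auto simp: A_def fund_module_def linear_ext_cscale_single fund_h_def f_def)
  moreover have "fps_log f $ 0 = 0"
    by (simp add: fps_log_def)
  ultimately have "exp_coeff A m (Poly_Mapping.single T 1) =
      cscale ((fps_exp 1 oo fps_log f) $ m) (Poly_Mapping.single T 1)"
    by (rule exp_coeff_eigenvector)
  moreover have "phi t (fund_module t l a) \<epsilon> i (sg \<epsilon> * int m) (Poly_Mapping.single T 1) =
      kgen (fund_module t l a) (Poly_Mapping.single i (of_int (sg \<epsilon>)))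
        (exp_coeff A m (Poly_Mapping.single T 1))"
    using sg by (auto simp: phi_def A_def)
  ultimately have "phi t (fund_module t l a) \<epsilon> i (sg \<epsilon> * int m) (Poly_Mapping.single T 1) =
      cscale ((fps_exp 1 oo fps_log f) $ m * f $ 0) (Poly_Mapping.single T 1)"
    by (simp add: fund_module_def linear_ext_cscale_single f0)
  also have "(fps_exp 1 oo fps_log f) $ m * f $ 0 = f $ m"
    using arg_cong [OF exp_fps_log [of f], of "\<lambda>g. g $ m"] f0 by (simp add: mult.commute)
  finally show ?thesis
    by (simp add: f_def)
qed

end


subsection \<open>The map \<open>\<phi>\<^sub>n\<close>\<close>

definition fold_monomial :: "nat \<Rightarrow> monomial \<Rightarrow> monomial" where
  "fold_monomial n u =
     (\<Sum>(i, b)\<in>Poly_Mapping.keys u. Poly_Mapping.single (i mod (int n + 1), b) (Poly_Mapping.lookup u (i, b)))"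

text \<open>
  On formal sums \<open>\<phi>\<^sub>n\<close> is applied term by term, which makes sense if only finitely many terms have any
  given image.
\<close>

definition fold_defined :: "nat \<Rightarrow> (monomial \<Rightarrow> nat) \<Rightarrow> bool" where
  "fold_defined n \<chi> \<longleftrightarrow> (\<forall>u. finite {u'. \<chi> u' \<noteq> 0 \<and> fold_monomial n u' = u})"

definition fold_char :: "nat \<Rightarrow> (monomial \<Rightarrow> nat) \<Rightarrow> monomial \<Rightarrow> nat" where
  "fold_char n \<chi> u = (\<Sum>u'\<in>{u'. \<chi> u' \<noteq> 0 \<and> fold_monomial n u' = u}. \<chi> u')"

end

theory Submission
  imports Defs "HOL-Computational_Algebra.Polynomial"
begin

text \<open>
  The fundamental module is the span of the increasing sequences inside a Drinfeld tensor product of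
  \<open>l\<close> vector representations. Folding the indices modulo \<open>N = n + 1\<close>, every factor becomes a vector
  representation of the toroidal algebra.
  Two factors at positions \<open>k\<close> and \<open>p\<close> can produce a resonance only if \<open>N\<close> divides \<open>2 (k - p)\<close>, which the
  hypothesis on \<open>l\<close> and \<open>n\<close> excludes. So all coefficients of the coproduct are defined, and each defining
  relation reduces to an identity of rational functions in the spectral parameters of at most three
  boxes; for \<open>[x\<^sup>+, x\<^sup>-]\<close> this is the partial fraction expansion of the eigenvalues of \<open>\<phi>\<^sub>i(z)\<close>. The
  increasing sequences still span a submodule, because moving a box onto an adjacent one has a zero
  as coefficient, and \<open>\<phi>\<^sub>i(z)\<close> acts on such a sequence by the folded monomial.
\<close>

section \<open>Linear and diagonal operators\<close>

text \<open>The modulus \<open>N\<close> is a parameter: \<open>N = 0\<close> describes the given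
  module, \<open>N = n + 1\<close> the toroidal one. Both q-characters become counts of tableaux
  with a prescribed monomial \<open>mono\<close>, and \<open>fold_monomial\<close> carries the
  monomials at \<open>0\<close> to those at \<open>n + 1\<close>. The divisibility condition arises
  as follows. A box with entry \<open>c\<close> at position \<open>k\<close> has parameter
  \<open>A q^(c - 2k)\<close>. After folding, boxes with congruent entries \<open>c\<close>,
  \<open>d\<close> at positions \<open>k\<close>, \<open>p\<close> interact, and their parameters
  agree only if \<open>c - d = 2 (k - p)\<close>. The coproduct twists \<open>x\<^sup>+\<close> by
  the boxes on the left of the moved one and \<open>x\<^sup>-\<close> by those on the right. Moving
  a box and then moving it back therefore collects exactly one factor from every other box, which is
  the residue required by the partial fractions. To read off q-characters, the
  \<open>\<phi>\<^sub>i\<close> are made diagonal in the tableaux. As \<open>q\<close> is not a root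
  of unity, logarithmic derivatives of the eigenvalues yield power sums that determine the exponents
  of the monomial. Fibres of \<open>mono\<close> are finite although there are infinitely many
  tableaux.\<close>

definition lin :: "('b vec \<Rightarrow> 'c vec) \<Rightarrow> bool" where
  "lin f \<longleftrightarrow> (\<forall>v w. f (v + w) = f v + f w) \<and> (\<forall>c v. f (cscale c v) = cscale c (f v))"

lemma lin_add: "lin f \<Longrightarrow> f (v + w) = f v + f w"
  and lin_cscale: "lin f \<Longrightarrow> f (cscale c v) = cscale c (f v)"
  by (simp_all add: lin_def)

lemma lin_zero: "lin f \<Longrightarrow> f 0 = 0"
  using lin_cscale[of f 0 0] by simp

lemma lin_sum: "lin f \<Longrightarrow> f (sum g S) = (\<Sum>x\<in>S. f (g x))"
  by (induction S rule: infinite_finite_induct) (simp_all add: lin_zero lin_add)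

lemma lin_compose: "lin f \<Longrightarrow> lin g \<Longrightarrow> lin (\<lambda>v. f (g v))"
  and lin_plus: "lin f \<Longrightarrow> lin g \<Longrightarrow> lin (\<lambda>v. f v + g v)"
  and lin_diff: "lin f \<Longrightarrow> lin g \<Longrightarrow> lin (\<lambda>v. f v - g v)"
  and lin_scale: "lin f \<Longrightarrow> lin (\<lambda>v. cscale c (f v))"
  and lin_0: "lin (\<lambda>v. 0)"
  and lin_id: "lin (\<lambda>v. v)"
  by (simp_all add: lin_def vec.scale_right_distrib vec.scale_right_diff_distrib mult.commute)

lemma vec_expand:
  assumes "finite S" "Poly_Mapping.keys v \<subseteq> S"
  shows "v = (\<Sum>T\<in>S. cscale (Poly_Mapping.lookup v T) (Poly_Mapping.single T 1))"
  by (rule poly_mapping_eqI)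
    (use assms in \<open>auto simp: Poly_Mapping.lookup_sum lookup_single when_def in_keys_iff
       if_distrib[of "(*) _"] sum.delta' cong: if_cong\<close>)

lemma linear_ext_superset:
  assumes "finite S" "Poly_Mapping.keys v \<subseteq> S"
  shows "linear_ext g v = (\<Sum>b\<in>S. cscale (Poly_Mapping.lookup v b) (g b))"
  unfolding linear_ext_def
  by (rule sum.mono_neutral_left) (use assms in \<open>auto simp: in_keys_iff\<close>)

lemma lin_linear_ext: "lin (linear_ext g)"
proof -
  have "linear_ext g (v + w) = linear_ext g v + linear_ext g w" for v w
  proof -
    let ?S = "Poly_Mapping.keys v \<union> Poly_Mapping.keys w"
    have "linear_ext g u = (\<Sum>b\<in>?S. cscale (Poly_Mapping.lookup u b) (g b))"
      if "u \<in> {v, w, v + w}" for u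
      by (rule linear_ext_superset) (use that Poly_Mapping.keys_add[of v w] in auto)
    then show ?thesis
      by (simp add: lookup_add vec.scale_left_distrib sum.distrib)
  qed
  moreover have "linear_ext g (cscale c v) = cscale c (linear_ext g v)" for c v
  proof -
    have "linear_ext g (cscale c v) =
        (\<Sum>b\<in>Poly_Mapping.keys v. cscale (Poly_Mapping.lookup (cscale c v) b) (g b))"
      by (rule linear_ext_superset) (auto simp: in_keys_iff)
    then show ?thesis
      by (simp add: linear_ext_def vec.scale_sum_right)
  qed
  ultimately show ?thesis
    by (simp add: lin_def)
qed

lemma linear_ext_single [simp]: "linear_ext g (Poly_Mapping.single T 1) = g T"
  by (simp add: linear_ext_def)

text \<open>Every relation involving the operators \<open>X\<close> is checked on single tableaux
  through this principle.\<close>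

lemma lin_eqI:
  assumes "lin f" "lin g" "\<And>T. T \<in> S \<Longrightarrow> f (Poly_Mapping.single T 1) = g (Poly_Mapping.single T 1)"
    and "Poly_Mapping.keys v \<subseteq> S"
  shows "f v = g v"
proof -
  have "f v = f (\<Sum>T\<in>Poly_Mapping.keys v. cscale (Poly_Mapping.lookup v T) (Poly_Mapping.single T 1))"
    using vec_expand[of "Poly_Mapping.keys v" v] by simp
  also have "\<dots> = g (\<Sum>T\<in>Poly_Mapping.keys v. cscale (Poly_Mapping.lookup v T) (Poly_Mapping.single T 1))"
    using assms by (auto simp: lin_sum lin_cscale intro!: sum.cong)
  also have "\<dots> = g v"
    using vec_expand[of "Poly_Mapping.keys v" v] by simp
  finally show ?thesis .
qed

definition diag :: "('b \<Rightarrow> complex) \<Rightarrow> 'b vec \<Rightarrow> 'b vec" where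
  "diag f = linear_ext (\<lambda>T. cscale (f T) (Poly_Mapping.single T 1))"

lemma lin_diag: "lin (diag f)"
  by (simp add: diag_def lin_linear_ext)

lemma diag_single: "diag f (Poly_Mapping.single T 1) = cscale (f T) (Poly_Mapping.single T 1)"
  by (simp add: diag_def)

lemma lookup_diag [simp]: "Poly_Mapping.lookup (diag f v) T = f T * Poly_Mapping.lookup v T"
proof -
  have "Poly_Mapping.lookup v b * f b * Poly_Mapping.lookup (Poly_Mapping.single b 1) T =
      (if b = T then f T * Poly_Mapping.lookup v T else 0)" for b
    by (simp add: lookup_single when_def)
  then show ?thesis
    by (simp add: diag_def linear_ext_def Poly_Mapping.lookup_sum sum.delta' in_keys_iff)
qed

lemma diag_mult: "diag f (diag g v) = diag (\<lambda>T. f T * g T) v"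
  by (rule poly_mapping_eqI) simp

lemma cscale_diag: "cscale c (diag f v) = diag (\<lambda>T. c * f T) v"
  by (rule poly_mapping_eqI) simp

lemma diag_minus_cscale: "diag f v - cscale c v = diag (\<lambda>T. f T - c) v"
  by (rule poly_mapping_eqI) (simp add: lookup_minus algebra_simps)

lemma diag_funpow: "(diag f ^^ k) v = diag (\<lambda>T. f T ^ k) v"
proof (induction k)
  case 0
  show ?case by (rule poly_mapping_eqI) simp
next
  case (Suc k)
  then show ?case by (simp add: diag_mult)
qed

lemma keys_diag: "Poly_Mapping.keys (diag f v) \<subseteq> Poly_Mapping.keys v"
  by (metis in_keys_iff lookup_diag mult_zero_right subsetI)

lemma keys_cscale: "Poly_Mapping.keys (cscale c v) \<subseteq> Poly_Mapping.keys v"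
  by (metis in_keys_iff lookup_cscale mult_zero_right subsetI)

lemma keys_linear_ext:
  assumes "\<And>T. T \<in> Poly_Mapping.keys v \<Longrightarrow> Poly_Mapping.keys (g T) \<subseteq> S"
  shows "Poly_Mapping.keys (linear_ext g v) \<subseteq> S"
  unfolding linear_ext_def
  by (rule order.trans[OF keys_sum]) (intro UN_least order.trans[OF keys_cscale] assms)

lemma linear_endo_lin:
  assumes "lin f" "\<And>v. Poly_Mapping.keys v \<subseteq> S \<Longrightarrow> Poly_Mapping.keys (f v) \<subseteq> S"
  shows "linear_endo {v. Poly_Mapping.keys v \<subseteq> S} f"
  using assms by (auto simp: linear_endo_def lin_def)

lemma subspace_keys: "vec.subspace {v. Poly_Mapping.keys v \<subseteq> S}"
proof (rule vec.subspaceI)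
  fix v w :: "'a vec" assume "v \<in> {v. Poly_Mapping.keys v \<subseteq> S}" "w \<in> {v. Poly_Mapping.keys v \<subseteq> S}"
  then show "v + w \<in> {v. Poly_Mapping.keys v \<subseteq> S}"
    using Poly_Mapping.keys_add[of v w] by auto
qed (simp_all add: order.trans[OF keys_cscale])

lemma keys_subspace_eq_span:
  "{v :: 'b vec. Poly_Mapping.keys v \<subseteq> S} = vec.span ((\<lambda>T. Poly_Mapping.single T 1) ` S)"
proof (intro equalityI subsetI)
  fix v :: "'b vec" assume v: "v \<in> {v. Poly_Mapping.keys v \<subseteq> S}"
  have "(\<Sum>T\<in>Poly_Mapping.keys v. cscale (Poly_Mapping.lookup v T) (Poly_Mapping.single T 1))
      \<in> vec.span ((\<lambda>T. Poly_Mapping.single T 1) ` S)"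
    using v by (intro vec.span_sum vec.span_scale vec.span_base) auto
  then show "v \<in> vec.span ((\<lambda>T. Poly_Mapping.single T 1) ` S)"
    using vec_expand[of "Poly_Mapping.keys v" v] by simp
next
  fix v :: "'b vec" assume "v \<in> vec.span ((\<lambda>T. Poly_Mapping.single T 1) ` S)"
  moreover have "vec.span ((\<lambda>T. Poly_Mapping.single T 1) ` S) \<subseteq> {v. Poly_Mapping.keys v \<subseteq> S}"
    by (rule vec.span_minimal) (auto simp: subspace_keys)
  ultimately show "v \<in> {v. Poly_Mapping.keys v \<subseteq> S}" by blast
qed

lemma dim_keys_subspace:
  assumes "finite S"
  shows "vec.dim {v :: 'b vec. Poly_Mapping.keys v \<subseteq> S} = card S"
proof -
  let ?e = "\<lambda>T. Poly_Mapping.single T (1::complex)"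
  have inj: "inj_on ?e S"
    by (auto simp: inj_on_def) (metis lookup_single_eq lookup_single_not_eq zero_neq_one)
  have "vec.independent (?e ` S)"
  proof (rule vec.independent_if_scalars_zero)
    show "finite (?e ` S)" using assms by simp
    fix f x assume 0: "(\<Sum>x\<in>?e ` S. cscale (f x) x) = 0" and x: "x \<in> ?e ` S"
    then obtain T where T: "T \<in> S" "x = ?e T" by auto
    have "(\<Sum>T\<in>S. cscale (f (?e T)) (?e T)) = 0"
      using 0 inj by (simp add: sum.reindex)
    then have "Poly_Mapping.lookup (\<Sum>T\<in>S. cscale (f (?e T)) (?e T)) T = 0" by simp
    moreover have "f (?e b) * Poly_Mapping.lookup (?e b) T = (if b = T then f x else 0)" for b
      using T by (simp add: lookup_single when_def)
    ultimately show "f x = 0"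
      using assms T by (simp add: Poly_Mapping.lookup_sum sum.delta')
  qed
  then show ?thesis
    unfolding keys_subspace_eq_span vec.dim_span
    using inj by (simp add: vec.dim_eq_card_independent card_image)
qed

section \<open>The series \<open>\<phi>\<^sub>i\<^sup>\<plusminus>(z)\<close> for diagonal generators\<close>

text \<open>In each coordinate the operators are scalars. Compositions of length \<open>k\<close>
  are the index lists in the expansion of the \<open>k\<close>-th power of \<open>L T\<close>; lists
  with an entry 0 may be added because \<open>L T\<close> has zero constant coefficient.\<close>

lemma exp_coeff_diag:
  fixes L :: "'b \<Rightarrow> complex fps"
  assumes A: "\<And>k v. k > 0 \<Longrightarrow> A k v = diag (\<lambda>T. L T $ k) v" and L0: "\<And>T. L T $ 0 = 0"
  shows "exp_coeff A m v = diag (\<lambda>T. (fps_exp 1 oo L T) $ m) v"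
proof (rule poly_mapping_eqI)
  fix T
  define M where "M = L T"
  have foldr: "Poly_Mapping.lookup (foldr A ms v) T =
      prod_list (map (($) M) ms) * Poly_Mapping.lookup v T" if "0 \<notin> set ms" for ms
    using that by (induction ms) (auto simp: A M_def)
  have nth: "(M ^ k) $ m = (\<Sum>ms\<in>natpermute m k. prod_list (map (($) M) ms))" for k
  proof (cases k)
    case 0
    moreover have "natpermute m 0 = (if m = 0 then {[]} else {})"
      by (auto simp: natpermute_def)
    ultimately show ?thesis by simp
  next
    case (Suc k')
    have "prod_list (map (($) M) ms) = (\<Prod>j=0..k'. M $ (ms ! j))" if "ms \<in> natpermute m k" for ms
      using that Suc by (auto simp: natpermute_def prod.list_conv_set_nth
          atLeastLessThanSuc_atLeastAtMost intro!: prod.cong)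
    then show ?thesis
      using Suc by (simp add: fps_power_nth del: power_Suc)
  qed
  have len: "length ms \<le> sum_list ms" if "0 \<notin> set ms" for ms :: "nat list"
    using that by (induction ms) auto
  have un: "compositions m = (\<Union>k\<in>{0..m}. {ms \<in> natpermute m k. 0 \<notin> set ms})"
    using len by (auto simp: compositions_def natpermute_def)
  have "Poly_Mapping.lookup (exp_coeff A m v) T =
      (\<Sum>ms\<in>compositions m. 1 / fact (length ms) * prod_list (map (($) M) ms)) * Poly_Mapping.lookup v T"
    by (auto simp: exp_coeff_def Poly_Mapping.lookup_sum foldr compositions_def sum_distrib_right
        intro!: sum.cong)
  also have "(\<Sum>ms\<in>compositions m. 1 / fact (length ms) * prod_list (map (($) M) ms)) =
      (\<Sum>k=0..m. \<Sum>ms\<in>{ms \<in> natpermute m k. 0 \<notin> set ms}. 1 / fact (length ms) * prod_list (map (($) M) ms))"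
    unfolding un
    by (rule sum.UNION_disjoint) (simp_all add: natpermute_finite, auto simp: natpermute_def)
  also have "\<dots> = (\<Sum>k=0..m. \<Sum>ms\<in>natpermute m k. 1 / fact k * prod_list (map (($) M) ms))"
  proof (rule sum.cong)
    fix k
    have "prod_list (map (($) M) ms) = 0" if "0 \<in> set ms" for ms
      using that L0[of T] by (metis M_def image_eqI prod_list_zero_iff set_map)
    then show "(\<Sum>ms\<in>{ms \<in> natpermute m k. 0 \<notin> set ms}. 1 / fact (length ms) * prod_list (map (($) M) ms)) =
        (\<Sum>ms\<in>natpermute m k. 1 / fact k * prod_list (map (($) M) ms))"
      by (intro sum.mono_neutral_cong_left) (use natpermute_finite in \<open>auto simp: natpermute_def\<close>)
  qed simp
  also have "\<dots> = (fps_exp 1 oo M) $ m"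
    by (simp add: fps_compose_nth nth sum_distrib_left)
  finally show "Poly_Mapping.lookup (exp_coeff A m v) T =
      Poly_Mapping.lookup (diag (\<lambda>T. (fps_exp 1 oo L T) $ m) v) T"
    by (simp add: M_def)
qed

text \<open>The quotient of the exponential by \<open>f\<close> has derivative zero, so it is its
  constant coefficient \<open>1 / f $ 0\<close>.\<close>

lemma exp_fps_log:
  fixes f :: "complex fps"
  assumes "f $ 0 \<noteq> 0"
  shows "fps_const (f $ 0) * (fps_exp 1 oo fps_log f) = f"
proof -
  define g where "g = fps_exp 1 oo fps_log f"
  have inv: "f * inverse f = 1"
    using assms by (simp add: inverse_mult_eq_1')
  have "fps_deriv g = g * (fps_deriv f * inverse f)"
    by (simp add: g_def fps_compose_deriv fps_log_def fps_deriv_fps_integral)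
  then have "fps_deriv (g * inverse f) = 0"
    using assms by (simp add: fps_inverse_deriv power2_eq_square algebra_simps)
  then have "g * inverse f = fps_const ((g * inverse f) $ 0)"
    by (simp only: fps_deriv_eq_0_iff)
  also have "(g * inverse f) $ 0 = 1 / f $ 0"
    by (simp add: g_def field_simps)
  finally have "g = fps_const (1 / f $ 0) * f"
    using inv by (metis mult.assoc mult.commute mult.right_neutral)
  then show ?thesis
    using assms by (simp add: g_def mult.assoc [symmetric])
qed

text \<open>If \<open>kgen\<close> gives the constant coefficient of a wished eigenvalue and
  \<open>hgen\<close> its formal logarithm, exponentiation returns that eigenvalue. This serves the
  folded module and the given one.\<close>

lemma phi_diag:
  assumes K: "kgen M (Poly_Mapping.single i (of_int (sg \<epsilon>))) = diag (\<lambda>T. f T $ 0)"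
    and H: "\<And>k. k > 0 \<Longrightarrow> hgen M i (sg \<epsilon> * int k) =
      diag (\<lambda>T. of_int (sg \<epsilon>) / (exp t - 1 / exp t) * fps_log (f T) $ k)"
    and t: "exp t - 1 / exp t \<noteq> 0" and f0: "\<And>T. f T $ 0 \<noteq> 0"
  shows "phi t M \<epsilon> i m =
    diag (\<lambda>T. if sg \<epsilon> * m < 0 then 0 else f T $ nat \<bar>m\<bar>)"
proof
  fix v
  have sg: "of_int (sg \<epsilon>) * (of_int (sg \<epsilon>) :: complex) = 1" by (cases \<epsilon>) auto
  have A: "cscale (of_int (sg \<epsilon>) * (exp t - 1 / exp t)) (hgen M i (sg \<epsilon> * int k) u) =
     diag (\<lambda>T. fps_log (f T) $ k) u" if "k > 0" for k u
  proof -
    have "of_int (sg \<epsilon>) * (exp t - 1 / exp t) * (of_int (sg \<epsilon>) / (exp t - 1 / exp t) * c) =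
      (of_int (sg \<epsilon>) * of_int (sg \<epsilon>)) * c" for c :: complex
      using t by simp
    then show ?thesis
      by (simp only: H[OF that] cscale_diag sg mult_1_left)
  qed
  have "exp_coeff (\<lambda>k u. cscale (of_int (sg \<epsilon>) * (exp t - 1 / exp t)) (hgen M i (sg \<epsilon> * int k) u))
      (nat \<bar>m\<bar>) v = diag (\<lambda>T. (fps_exp 1 oo fps_log (f T)) $ nat \<bar>m\<bar>) v"
    by (rule exp_coeff_diag) (use A in \<open>simp_all add: fps_log_def\<close>)
  moreover have "f T $ 0 * (fps_exp 1 oo fps_log (f T)) $ k = f T $ k" for T k
    using arg_cong [OF exp_fps_log [OF f0[of T]], of "\<lambda>g. g $ k"] by simp
  moreover have "0 = diag (\<lambda>T. 0) v"
    by (rule poly_mapping_eqI) simp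
  ultimately show "phi t M \<epsilon> i m v = diag (\<lambda>T. if sg \<epsilon> * m < 0 then 0 else f T $ nat \<bar>m\<bar>) v"
    by (simp add: phi_def K diag_mult)
qed

text \<open>The case of equal indices in \<open>E_ratio\<close>: after removing a common factor, the
  numerators are the two linear factors of the quadratic relation with exponent
  \<open>2\<close>.\<close>

lemma ratio_same:
  fixes Q w z :: complex
  assumes "Q \<noteq> 0"
  shows "(Q * w - z / Q) / (w - z) = 1 / (Q * (w - z)) * (Q\<^sup>2 * w - z)"
    "(1 / Q * w - Q * z) / (w - z) = 1 / (Q * (w - z)) * (w - Q\<^sup>2 * z)"
proof -
  have "Q * w - z / Q = (Q\<^sup>2 * w - z) / Q" "1 / Q * w - Q * z = (w - Q\<^sup>2 * z) / Q"
    using assms by (simp_all add: field_simps power2_eq_square)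
  then show "(Q * w - z / Q) / (w - z) = 1 / (Q * (w - z)) * (Q\<^sup>2 * w - z)"
    "(1 / Q * w - Q * z) / (w - z) = 1 / (Q * (w - z)) * (w - Q\<^sup>2 * z)"
    by simp_all
qed

section \<open>Boxes and elementary moves\<close>

text \<open>Excluding the moduli 1 and 2 keeps \<open>i - 1\<close>, \<open>i\<close> and
  \<open>i + 1\<close> pairwise incongruent. The modulus 0 is allowed: congruence is then equality
  and \<open>gap\<close> holds trivially.\<close>

locale folding =
  fixes t A :: complex and N l :: nat
  assumes root: "\<And>k::nat. k > 0 \<Longrightarrow> exp t ^ k \<noteq> 1"
    and A: "A \<noteq> 0" and N: "N \<noteq> 1" "N \<noteq> 2"
    and gap: "\<And>d::int. int N dvd 2 * d \<Longrightarrow> \<bar>d\<bar> < int l \<Longrightarrow> d = 0"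
begin

abbreviation q :: complex where "q \<equiv> exp t"

definition eqN :: "int \<Rightarrow> int \<Rightarrow> bool" where
  "eqN i j \<longleftrightarrow> int N dvd i - j"

lemma eqN_mod: "eqN i j \<longleftrightarrow> i mod int N = j mod int N"
  by (simp add: eqN_def mod_eq_dvd_iff)

lemma eqN_refl [simp]: "eqN i i"
  by (simp add: eqN_mod)

lemma eqN_sym: "eqN i j \<longleftrightarrow> eqN j i"
  by (auto simp: eqN_mod)

lemma eqN_cong: "eqN c d \<Longrightarrow> eqN c i \<longleftrightarrow> eqN d i" "eqN c d \<Longrightarrow> eqN i c \<longleftrightarrow> eqN i d"
  by (auto simp: eqN_mod)

lemma eqN_shift: "eqN (i + k) j \<longleftrightarrow> eqN i (j - k)" "eqN (i - k) j \<longleftrightarrow> eqN i (j + k)"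
  by (simp_all add: eqN_def algebra_simps)

lemma N_not_dvd: "\<not> int N dvd 1" "\<not> int N dvd 2" "\<not> int N dvd - 1" "\<not> int N dvd - 2"
proof -
  have "int N dvd 2 \<Longrightarrow> N dvd 2"
    using int_dvd_int_iff[of N 2] by simp
  moreover have "N dvd 2 \<Longrightarrow> False"
    using N dvd_imp_le[of N 2] by (cases "N = 0") auto
  ultimately show 2: "\<not> int N dvd 2" by blast
  then show "\<not> int N dvd 1" using dvd_trans one_dvd by blast
  with 2 show "\<not> int N dvd - 1" "\<not> int N dvd - 2" by (simp_all only: dvd_minus_iff not_False_eq_True)
qed

lemma eqN_distinct:
  "eqN j i \<Longrightarrow> \<not> eqN j (i + 1)" "eqN j i \<Longrightarrow> \<not> eqN j (i - 1)" "eqN j (i + 1) \<Longrightarrow> \<not> eqN j (i - 1)"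
  "\<not> eqN i (i + 1)" "\<not> eqN i (i - 1)" "\<not> eqN (i + 1) i" "\<not> eqN (i - 1) i"
  "\<not> eqN (i + 1) (i - 1)" "\<not> eqN (i - 1) (i + 1)" "\<not> eqN (i + 2) i"  "\<not> eqN i (i + 2)"
proof -
  have "eqN j i \<Longrightarrow> eqN j k \<Longrightarrow> int N dvd i - k" for i j k
    unfolding mod_eq_dvd_iff[symmetric] eqN_mod by simp
  note * = this
  show "eqN j i \<Longrightarrow> \<not> eqN j (i + 1)" "eqN j i \<Longrightarrow> \<not> eqN j (i - 1)" "eqN j (i + 1) \<Longrightarrow> \<not> eqN j (i - 1)"
    using *[of j i "i + 1"] *[of j i "i - 1"] *[of j "i + 1" "i - 1"] N_not_dvd by auto
qed (use N_not_dvd in \<open>simp_all add: eqN_def\<close>)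

lemma cartan_eqN:
  "cartan N i j = (if eqN j i then 2 else if eqN j (i + 1) \<or> eqN j (i - 1) then -1 else 0)"
  by (simp add: cartan_def eqN_mod)

lemma cartan_sym: "cartan N i j = cartan N j i"
proof -
  have "eqN j (i + 1) = eqN i (j - 1)" "eqN j (i - 1) = eqN i (j + 1)"
    using dvd_diff_commute[of "int N" j "i + 1"] dvd_diff_commute[of "int N" j "i - 1"]
    by (simp_all add: eqN_def algebra_simps)
  then show ?thesis
    by (auto simp: cartan_eqN eqN_sym[of i j])
qed

lemma q_powi_inj: "q powi m = q powi n \<longleftrightarrow> m = n"
proof -
  have *: "q powi k \<noteq> 1" if "k > 0" for k
    using root[of "nat k"] that by (simp add: power_int_def)
  have "q powi m \<noteq> q powi n" if "m < n" for m n
    using *[of "n - m"] that by (auto simp: power_int_diff)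
  then show ?thesis by (metis linorder_neqE)
qed

lemma q_sq: "q - 1 / q \<noteq> 0"
  using root[of 2] by (auto simp: field_simps power2_eq_square)

text \<open>The spectral parameter of a box with entry \<open>c\<close> at position \<open>k\<close> (counted from \<open>0\<close>), divided by
  \<open>q\<close>: with \<open>A = a q\<^sup>l\<^sup>-\<^sup>2\<close> and \<open>p = k + 1\<close>, \<open>q y\<close> is \<open>a q\<^sup>c\<^sup>+\<^sup>l\<^sup>+\<^sup>1\<^sup>-\<^sup>2\<^sup>p\<close>.\<close>

definition y :: "nat \<Rightarrow> int \<Rightarrow> complex" where
  "y k c = A * q powi (c - 2 * int k)"

lemma y_nonzero [simp]: "y k c \<noteq> 0"
  using A by (simp add: y_def)

lemma y_shift: "y k (c - 1) = y k c / q" "y k (c + 1) = q * y k c"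
  by (simp_all add: y_def power_int_diff power_int_add field_simps)

text \<open>The one use of \<open>gap\<close> in the construction: equal parameters force
  \<open>c - d = 2 (k - p)\<close>, and \<open>N\<close> divides the left side.\<close>

lemma y_neq:
  assumes "eqN c d" "k < l" "p < l" "k \<noteq> p"
  shows "y k c \<noteq> y p d"
proof
  assume "y k c = y p d"
  then have "c - d = 2 * (int k - int p)"
    using A by (simp add: y_def q_powi_inj)
  then have "int N dvd 2 * (int k - int p)"
    using assms(1) by (simp add: eqN_def)
  then have "int k - int p = 0"
    by (rule gap) (use assms in linarith)
  then show False
    using assms by simp
qed

text \<open>The entries that \<open>x_i\<close> can move: \<open>x_i^+\<close> lowers
  \<open>i + 1\<close> to \<open>i\<close> and \<open>x_i^-\<close> raises \<open>i\<close> to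
  \<open>i + 1\<close>, up to congruence. Hence also the sign in \<open>nx\<close>.\<close>

definition mv :: "sign \<Rightarrow> int \<Rightarrow> int \<Rightarrow> bool" where
  "mv \<epsilon> i c \<longleftrightarrow> eqN c (if \<epsilon> = Plus then i + 1 else i)"

definition nx :: "sign \<Rightarrow> int \<Rightarrow> int" where
  "nx \<epsilon> c = c - sg \<epsilon>"

definition qs :: "sign \<Rightarrow> complex" where
  "qs \<epsilon> = (if \<epsilon> = Plus then q else 1 / q)"

text \<open>The point \<open>w = z\<^sup>-\<^sup>1\<close> at which the delta function of the move
  is supported. Since \<open>y k (i + 1) = q * y k i\<close>, a move and its inverse share this
  point.\<close>

definition ze :: "sign \<Rightarrow> nat \<Rightarrow> int \<Rightarrow> complex" where
  "ze \<epsilon> k c = (if \<epsilon> = Plus then y k c else q * y k c)"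

lemma qs_nonzero [simp]: "qs \<epsilon> \<noteq> 0"
  by (simp add: qs_def)

lemma ze_nonzero [simp]: "ze \<epsilon> k c \<noteq> 0"
  by (simp add: ze_def)

lemma qs_powi: "qs \<epsilon> powi m = q powi (sg \<epsilon> * m)"
  by (cases \<epsilon>) (simp_all add: qs_def power_int_minus power_int_divide_distrib divide_inverse power_int_inverse)

lemma qs_sum: "q + 1 / q = qs \<epsilon> + 1 / qs \<epsilon>"
  by (cases \<epsilon>) (auto simp: qs_def)

lemma qs_powi_cartan: "qs \<epsilon> powi cartan N i j =
  (if eqN j i then (qs \<epsilon>)\<^sup>2 else if eqN j (i + 1) \<or> eqN j (i - 1) then 1 / qs \<epsilon> else 1)"
  by (simp add: cartan_eqN divide_inverse)

lemma ze_nx: "ze \<epsilon> k (nx \<epsilon> c) = ze \<epsilon> k c / qs \<epsilon>"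
  by (cases \<epsilon>) (simp_all add: ze_def nx_def qs_def y_shift)

lemma ze_neq:
  assumes "mv \<epsilon> i c" "mv \<epsilon> i d" "k < l" "p < l" "k \<noteq> p"
  shows "ze \<epsilon> k c \<noteq> ze \<epsilon> p d"
  using assms y_neq[of c d k p] by (cases \<epsilon>) (auto simp: ze_def mv_def eqN_mod)

text \<open>The eigenvalue of \<open>\<phi>\<^sub>i\<close> on a box is \<open>(\<alpha> w - \<beta>) / (w - \<gamma>)\<close> with \<open>w = z\<^sup>-\<^sup>1\<close>; \<open>bx\<close> passes
  \<open>\<alpha>, \<beta>, \<gamma>\<close> to a function \<open>f\<close>, which evaluates this at a point or expands it in a series.\<close>

definition bx :: "int \<Rightarrow> nat \<Rightarrow> int \<Rightarrow> (complex \<Rightarrow> complex \<Rightarrow> complex \<Rightarrow> 'x) \<Rightarrow> 'x \<Rightarrow> 'x" where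
  "bx i k c f d = (if eqN c i then f q (y k c) (q * y k c)
     else if eqN c (i + 1) then f (1 / q) (q * y k c) (y k c) else d)"

text \<open>In terms of \<open>ze\<close> and \<open>qs\<close> the eigenvalues of
  \<open>\<phi>\<^sub>i\<close> on a movable box look the same for both signs, except for the side
  on which the neighbouring index lies. This lets most later arguments treat \<open>Plus\<close> and
  \<open>Minus\<close> at once; \<open>bx_after\<close> does the same for the moved box.\<close>

lemma bx_before:
  assumes "mv \<epsilon> j c"
  shows "bx i k c f d =
    (if eqN j i then f (1 / qs \<epsilon>) (qs \<epsilon> * ze \<epsilon> k c) (ze \<epsilon> k c)
     else if eqN j (i - sg \<epsilon>) then f (qs \<epsilon>) (ze \<epsilon> k c) (qs \<epsilon> * ze \<epsilon> k c) else d)"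
proof (cases \<epsilon>)
  case Plus
  then have "eqN c x = eqN j (x - 1)" for x
    using assms eqN_cong(1)[of c "j + 1" x] by (simp add: mv_def eqN_shift)
  then show ?thesis
    using Plus eqN_distinct(1-3)[of j i] by (simp add: bx_def qs_def ze_def)
next
  case Minus
  then have "eqN c x = eqN j x" for x
    using assms eqN_cong(1)[of c j x] by (simp add: mv_def)
  then show ?thesis
    using Minus eqN_distinct(1-3)[of j i] by (simp add: bx_def qs_def ze_def)
qed

lemma bx_after:
  assumes "mv \<epsilon> j c"
  shows "bx i k (nx \<epsilon> c) f d =
    (if eqN j i then f (qs \<epsilon>) (ze \<epsilon> k c / qs \<epsilon>) (ze \<epsilon> k c)
     else if eqN j (i + sg \<epsilon>) then f (1 / qs \<epsilon>) (ze \<epsilon> k c) (ze \<epsilon> k c / qs \<epsilon>) else d)"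
proof (cases \<epsilon>)
  case Plus
  then have "eqN (c - 1) x = eqN j x" for x
    using assms eqN_cong(1)[of c "j + 1" "x + 1"] by (simp add: mv_def eqN_shift)
  then show ?thesis
    using Plus eqN_distinct(1-3)[of j i] by (simp add: bx_def nx_def qs_def ze_def y_shift)
next
  case Minus
  then have "eqN (c + 1) x = eqN j (x - 1)" for x
    using assms eqN_cong(1)[of c j "x - 1"] by (simp add: mv_def eqN_shift)
  then show ?thesis
    using Minus eqN_distinct(1-3)[of j i] by (simp add: bx_def nx_def qs_def ze_def y_shift mult.commute)
qed

definition E :: "int \<Rightarrow> nat \<Rightarrow> int \<Rightarrow> complex \<Rightarrow> complex" where
  "E i k c w = bx i k c (\<lambda>\<alpha> \<beta> \<gamma>. (\<alpha> * w - \<beta>) / (w - \<gamma>)) 1"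

lemma mv_cong: "eqN j i \<Longrightarrow> mv \<epsilon> j c \<longleftrightarrow> mv \<epsilon> i c"
  using eqN_cong(2)[of j i c] eqN_cong(2)[of "j + 1" "i + 1" c] by (simp add: mv_def eqN_def)

lemma mv_nx: "eqN j (i + sg \<epsilon>) \<Longrightarrow> mv \<epsilon> j c \<Longrightarrow> mv \<epsilon> i (nx \<epsilon> c)"
proof (cases \<epsilon>)
  case Plus
  then show "eqN j (i + sg \<epsilon>) \<Longrightarrow> mv \<epsilon> j c \<Longrightarrow> mv \<epsilon> i (nx \<epsilon> c)"
    using dvd_add[of "int N" "c - j - 1" "j - i - 1"] by (simp add: mv_def nx_def eqN_def algebra_simps)
next
  case Minus
  then show "eqN j (i + sg \<epsilon>) \<Longrightarrow> mv \<epsilon> j c \<Longrightarrow> mv \<epsilon> i (nx \<epsilon> c)"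
    using dvd_add[of "int N" "c - j" "j - i + 1"] by (simp add: mv_def nx_def eqN_def algebra_simps)
qed

text \<open>The move multiplies the eigenvalue by the structure function
  \<open>(Q * w - \<zeta>) / (w - Q * \<zeta>)\<close>. A common factor \<open>\<kappa>\<close>
  replaces the quotient because either value may be zero. The denominators are nonzero by
  \<open>ze_neq\<close>, applied where necessary to a box moved once.\<close>

lemma E_ratio:
  assumes m: "mv \<epsilon> j c" "mv \<epsilon> i d" and C: "cartan N i j \<noteq> 0"
    and p: "k < l" "p < l" "k \<noteq> p"
  defines "Q \<equiv> qs \<epsilon> powi cartan N i j" and "\<zeta> \<equiv> ze \<epsilon> k c" and "w \<equiv> ze \<epsilon> p d"
  shows "\<exists>\<kappa>. E i k (nx \<epsilon> c) w = \<kappa> * (Q * w - \<zeta>) \<and> E i k c w = \<kappa> * (w - Q * \<zeta>)"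
proof -
  let ?q = "qs \<epsilon>"
  consider (1) "eqN j i" | (2) "eqN j (i + sg \<epsilon>)" | (3) "eqN j (i - sg \<epsilon>)"
    | (4) "\<not> eqN j i" "\<not> eqN j (i + sg \<epsilon>)" "\<not> eqN j (i - sg \<epsilon>)" by blast
  then show ?thesis
  proof cases
    case 1
    have "w \<noteq> \<zeta>"
      using m mv_cong[OF 1] ze_neq[of \<epsilon> i c d k p] p by (auto simp: \<zeta>_def w_def)
    then show ?thesis
      using 1 ratio_same[of ?q w \<zeta>]
      unfolding E_def bx_before[OF m(1)] bx_after[OF m(1)] Q_def qs_powi_cartan \<zeta>_def[symmetric]
      by (intro exI[of _ "1 / (?q * (w - \<zeta>))"]) simp
  next
    case 2
    have "w \<noteq> \<zeta> / ?q"
      using ze_neq[OF mv_nx[OF 2 m(1)] m(2) p] by (simp add: ze_nx \<zeta>_def w_def)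
    moreover have "Q = 1 / ?q" "\<not> eqN j i" "\<not> eqN j (i - sg \<epsilon>)"
      using 2 eqN_distinct(1-3)[of j i] by (cases \<epsilon>; auto simp: Q_def qs_powi_cartan)+
    ultimately show ?thesis
      using 2
      unfolding E_def bx_before[OF m(1)] bx_after[OF m(1)] \<zeta>_def[symmetric]
      by (intro exI[of _ "1 / (w - \<zeta> / ?q)"]) simp
  next
    case 3
    \<comment> \<open>Here the box at \<open>p\<close> must be moved once to become movable by
      \<open>x_j\<close>, like the box at \<open>k\<close>; only then does \<open>ze_neq\<close>
      compare the two.\<close>
    have ij: "eqN i (j + sg \<epsilon>)"
      using 3 eqN_sym[of j] by (cases \<epsilon>) (auto simp: eqN_shift)
    have "w \<noteq> ?q * \<zeta>"
      using ze_neq[OF mv_nx[OF ij m(2)] m(1) p(2,1)] p(3) by (auto simp: ze_nx \<zeta>_def w_def)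
    moreover have "Q = 1 / ?q" "\<not> eqN j i" "\<not> eqN j (i + sg \<epsilon>)"
      using 3 eqN_distinct(1-3)[of j i] by (cases \<epsilon>; auto simp: Q_def qs_powi_cartan)+
    moreover have "?q / (w - ?q * \<zeta>) * (1 / ?q * w - \<zeta>) = (w - ?q * \<zeta>) / (w - ?q * \<zeta>)"
      by (simp add: field_simps)
    moreover have "?q / (w - ?q * \<zeta>) * (w - 1 / ?q * \<zeta>) = (?q * w - \<zeta>) / (w - ?q * \<zeta>)"
      by (simp add: right_diff_distrib diff_divide_distrib)
    ultimately show ?thesis
      using 3
      unfolding E_def bx_before[OF m(1)] bx_after[OF m(1)] \<zeta>_def[symmetric]
      by (intro exI[of _ "?q / (w - ?q * \<zeta>)"]) simp
  next
    case 4
    then show ?thesis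
      using C by (cases \<epsilon>) (simp_all add: cartan_eqN)
  qed
qed

lemma E_far:
  assumes "mv \<epsilon> j c" "cartan N i j = 0"
  shows "E i k (nx \<epsilon> c) w = 1 \<and> E i k c w = 1"
  using assms(2) unfolding E_def bx_before[OF assms(1)] bx_after[OF assms(1)]
  by (cases \<epsilon>) (simp_all add: cartan_eqN split: if_splits)


section \<open>The operators \<open>x\<^sub>i\<^sub>,\<^sub>r\<^sup>\<plusminus>\<close>\<close>

definition bef :: "sign \<Rightarrow> nat \<Rightarrow> nat \<Rightarrow> bool" where
  "bef \<epsilon> k p \<longleftrightarrow> (if \<epsilon> = Plus then k < p else p < k)"

lemma bef_irrefl [simp]: "\<not> bef \<epsilon> p p"
  by (simp add: bef_def)

lemma bef_total: "u \<noteq> v \<Longrightarrow> bef \<epsilon> v u \<longleftrightarrow> \<not> bef \<epsilon> u v"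
  by (auto simp: bef_def)

definition step :: "sign \<Rightarrow> nat \<Rightarrow> int list \<Rightarrow> int list" where
  "step \<epsilon> p T = T[p := nx \<epsilon> (T ! p)]"

lemma length_step [simp]: "length (step \<epsilon> p T) = length T"
  by (simp add: step_def)

lemma nth_step: "p < length T \<Longrightarrow> step \<epsilon> p T ! k = (if k = p then nx \<epsilon> (T ! p) else T ! k)"
  by (simp add: step_def nth_list_update)

lemma step_commute: "step \<epsilon> u (step \<epsilon>' v T) = step \<epsilon>' v (step \<epsilon> u T)"
proof (cases "u = v")
  case True
  then show ?thesis
    by (cases "v < length T") (simp_all add: step_def nx_def algebra_simps list_update_beyond)
next
  case False
  then show ?thesis
    by (simp add: step_def list_update_swap)
qed

text \<open>The coefficients of the Drinfeld coproduct: the factors to the left, respectively right, of the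
  one that is moved act by \<open>\<phi>\<^sub>i\<close>, evaluated at the pole of the moved one.\<close>

definition cf :: "sign \<Rightarrow> int \<Rightarrow> int list \<Rightarrow> nat \<Rightarrow> complex" where
  "cf \<epsilon> i T p = (if mv \<epsilon> i (T ! p)
     then \<Prod>k\<in>{k. k < l \<and> bef \<epsilon> k p}. E i k (T ! k) (ze \<epsilon> p (T ! p)) else 0)"

definition cz :: "sign \<Rightarrow> int \<Rightarrow> int \<Rightarrow> int list \<Rightarrow> nat \<Rightarrow> complex" where
  "cz \<epsilon> i r T p = cf \<epsilon> i T p * ze \<epsilon> p (T ! p) powi r"

definition X :: "sign \<Rightarrow> int \<Rightarrow> int \<Rightarrow> int list vec \<Rightarrow> int list vec" where
  "X \<epsilon> i r = linear_ext (\<lambda>T. \<Sum>p<l. cscale (cz \<epsilon> i r T p) (Poly_Mapping.single (step \<epsilon> p T) 1))"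

lemma lin_X: "lin (X \<epsilon> i r)"
  by (simp add: X_def lin_linear_ext)

lemma X_single: "X \<epsilon> i r (Poly_Mapping.single T 1) =
    (\<Sum>p<l. cscale (cz \<epsilon> i r T p) (Poly_Mapping.single (step \<epsilon> p T) 1))"
  by (simp add: X_def)

lemma XX_single: "X \<epsilon> i m (X \<epsilon>' j r (Poly_Mapping.single T 1)) =
    (\<Sum>v<l. \<Sum>u<l. cscale (cz \<epsilon>' j r T v * cz \<epsilon> i m (step \<epsilon>' v T) u)
       (Poly_Mapping.single (step \<epsilon> u (step \<epsilon>' v T)) 1))"
  by (simp add: X_single[of \<epsilon>'] lin_sum[OF lin_X] lin_cscale[OF lin_X] X_single vec.scale_sum_right)

lemma XXX_single: "X \<epsilon> i m (X \<epsilon>' j r (X \<epsilon>'' k s (Poly_Mapping.single T 1))) =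
    (\<Sum>w<l. \<Sum>v<l. \<Sum>u<l.
       cscale (cz \<epsilon>'' k s T w * cz \<epsilon>' j r (step \<epsilon>'' w T) v * cz \<epsilon> i m (step \<epsilon>' v (step \<epsilon>'' w T)) u)
       (Poly_Mapping.single (step \<epsilon> u (step \<epsilon>' v (step \<epsilon>'' w T))) 1))"
  by (simp add: X_single[of \<epsilon>''] lin_sum[OF lin_X] lin_cscale[OF lin_X] XX_single vec.scale_sum_right
      mult.assoc)

definition hh :: "sign \<Rightarrow> int \<Rightarrow> nat \<Rightarrow> complex \<Rightarrow> nat \<Rightarrow> int \<Rightarrow> complex" where
  "hh \<epsilon> i p w k c = (if bef \<epsilon> k p then E i k c w else 1)"

definition rest :: "sign \<Rightarrow> int \<Rightarrow> nat \<Rightarrow> complex \<Rightarrow> nat set \<Rightarrow> int list \<Rightarrow> complex" where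
  "rest \<epsilon> i p w S T = (\<Prod>k\<in>{k. k < l \<and> bef \<epsilon> k p} - S. E i k (T ! k) w)"

lemma rest_step [simp]: "v \<in> S \<Longrightarrow> rest \<epsilon> i p w S (step \<epsilon>' v T) = rest \<epsilon> i p w S T"
proof -
  assume "v \<in> S"
  then have "step \<epsilon>' v T ! k = T ! k" if "k \<notin> S" for k
    using that by (cases "k = v") (auto simp: step_def)
  then show ?thesis
    by (auto simp: rest_def intro!: prod.cong)
qed

lemma rest_step_self [simp]: "rest \<epsilon> i p w S (step \<epsilon>' p T) = rest \<epsilon> i p w S T"
proof -
  have "step \<epsilon>' p T ! k = T ! k" if "bef \<epsilon> k p" for k
    using that by (cases "k = p") (auto simp: step_def)
  then show ?thesis
    by (auto simp: rest_def intro!: prod.cong)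
qed

lemma prod_bef_remove:
  assumes "v < l" "v \<notin> S"
  shows "rest \<epsilon> i p w S T = hh \<epsilon> i p w v (T ! v) * rest \<epsilon> i p w (insert v S) T"
proof (cases "bef \<epsilon> v p")
  case True
  define B where "B = {k. k < l \<and> bef \<epsilon> k p} - insert v S"
  have B: "{k. k < l \<and> bef \<epsilon> k p} - S = insert v B" "finite B" "v \<notin> B"
    using assms True by (auto simp: B_def)
  then have "rest \<epsilon> i p w S T = E i v (T ! v) w * (\<Prod>k\<in>B. E i k (T ! k) w)"
    unfolding rest_def B(1) by (simp only: prod.insert[OF B(2,3)])
  then show ?thesis
    using True by (simp only: hh_def rest_def B_def if_True)
next
  case False
  then have "{k. k < l \<and> bef \<epsilon> k p} - S = {k. k < l \<and> bef \<epsilon> k p} - insert v S"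
    by auto
  then show ?thesis
    using False by (simp only: rest_def hh_def if_False mult_1_left)
qed

lemma cf_rest: "cf \<epsilon> i T p = (if mv \<epsilon> i (T ! p) then rest \<epsilon> i p (ze \<epsilon> p (T ! p)) {} T else 0)"
  by (simp add: cf_def rest_def)

lemma cf_split1:
  assumes "v < l"
  shows "cf \<epsilon> i T p = (if mv \<epsilon> i (T ! p) then
    hh \<epsilon> i p (ze \<epsilon> p (T ! p)) v (T ! v) * rest \<epsilon> i p (ze \<epsilon> p (T ! p)) {v} T else 0)"
  using assms by (simp add: cf_rest prod_bef_remove[of v "{}"])

lemma cf_split2:
  assumes "v < l" "w < l" "v \<noteq> w"
  shows "cf \<epsilon> i T p = (if mv \<epsilon> i (T ! p) then
    hh \<epsilon> i p (ze \<epsilon> p (T ! p)) v (T ! v) * hh \<epsilon> i p (ze \<epsilon> p (T ! p)) w (T ! w) *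
      rest \<epsilon> i p (ze \<epsilon> p (T ! p)) {v, w} T else 0)"
  using assms by (simp add: cf_rest prod_bef_remove[of v "{}"] prod_bef_remove[of w "{v}"] insert_commute)

text \<open>The interaction of two moves at different positions \<open>u\<close> and \<open>v\<close>, that at \<open>u\<close> being made first.\<close>

definition gg :: "sign \<Rightarrow> int list \<Rightarrow> int \<Rightarrow> nat \<Rightarrow> int \<Rightarrow> nat \<Rightarrow> complex" where
  "gg \<epsilon> T i u j v =
     hh \<epsilon> j v (ze \<epsilon> v (T ! v)) u (nx \<epsilon> (T ! u)) * hh \<epsilon> i u (ze \<epsilon> u (T ! u)) v (T ! v)"

text \<open>Of the two boxes exactly one lies on the side that twists the other. So a single factor
  of \<open>gg\<close> is nontrivial, the same one in both orders, and it is seen after the other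
  move in one order and before it in the other. \<open>E_ratio\<close> compares these
  values.\<close>

lemma gg_ratio:
  assumes "mv \<epsilon> i (T ! u)" "mv \<epsilon> j (T ! v)" "cartan N i j \<noteq> 0" "u < l" "v < l" "u \<noteq> v"
  defines "Q \<equiv> qs \<epsilon> powi cartan N i j" and "a \<equiv> ze \<epsilon> u (T ! u)" and "b \<equiv> ze \<epsilon> v (T ! v)"
  shows "\<exists>\<alpha>. gg \<epsilon> T i u j v = \<alpha> * (a - Q * b) \<and> gg \<epsilon> T j v i u = \<alpha> * (Q * a - b)"
proof (cases "bef \<epsilon> u v")
  case True
  obtain \<kappa> where "E j u (nx \<epsilon> (T ! u)) b = \<kappa> * (Q * b - a)" "E j u (T ! u) b = \<kappa> * (b - Q * a)"
    using E_ratio[OF assms(1,2) _ assms(4,5,6)] assms(3) unfolding Q_def a_def b_def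
    by (auto simp: cartan_sym[of j i])
  then show ?thesis
    using True bef_total[OF assms(6), of \<epsilon>]
    by (intro exI[of _ "- \<kappa>"]) (simp add: gg_def hh_def flip: a_def b_def, simp add: algebra_simps)
next
  case False
  obtain \<kappa> where "E i v (nx \<epsilon> (T ! v)) a = \<kappa> * (Q * a - b)" "E i v (T ! v) a = \<kappa> * (a - Q * b)"
    using E_ratio[OF assms(2,1) _ assms(5,4)] assms(3,6) unfolding Q_def a_def b_def
    by auto
  then show ?thesis
    using False bef_total[OF assms(6), of \<epsilon>]
    by (intro exI[of _ "\<kappa>"]) (simp add: gg_def hh_def flip: a_def b_def)
qed

lemma gg_far:
  assumes "mv \<epsilon> i (T ! u)" "mv \<epsilon> j (T ! v)" "cartan N i j = 0"
  shows "gg \<epsilon> T i u j v = 1"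
  using E_far[OF assms(1), of j u] E_far[OF assms(2,3), of v] assms(3)
  by (simp add: gg_def hh_def cartan_sym[of j i])

lemma cf_cf:
  assumes "u < l" "v < l" "u \<noteq> v" "length T = l"
  shows "cf \<epsilon> i T u * cf \<epsilon> j (step \<epsilon> u T) v =
    (if mv \<epsilon> i (T ! u) \<and> mv \<epsilon> j (T ! v) then
       gg \<epsilon> T i u j v * (rest \<epsilon> i u (ze \<epsilon> u (T ! u)) {v} T * rest \<epsilon> j v (ze \<epsilon> v (T ! v)) {u} T) else 0)"
  using assms by (simp add: cf_split1[of v \<epsilon> i T u] cf_split1[of u \<epsilon> j _ v] nth_step gg_def)

text \<open>Three moves interact only in pairs, so the Serre relations on distinct boxes reduce to
  \<open>gg_ratio\<close>.\<close>

lemma cf_cf_cf: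
  assumes "u < l" "v < l" "w < l" "u \<noteq> v" "u \<noteq> w" "v \<noteq> w" "length T = l"
  shows "cf \<epsilon> i T u * cf \<epsilon> j (step \<epsilon> u T) v * cf \<epsilon> k (step \<epsilon> v (step \<epsilon> u T)) w =
    (if mv \<epsilon> i (T ! u) \<and> mv \<epsilon> j (T ! v) \<and> mv \<epsilon> k (T ! w) then
       gg \<epsilon> T i u j v * gg \<epsilon> T i u k w * gg \<epsilon> T j v k w *
         (rest \<epsilon> i u (ze \<epsilon> u (T ! u)) {v, w} T * rest \<epsilon> j v (ze \<epsilon> v (T ! v)) {u, w} T
          * rest \<epsilon> k w (ze \<epsilon> w (T ! w)) {u, v} T) else 0)"
  using assms by (simp add: cf_split2[of v w \<epsilon> i T u] cf_split2[of u w \<epsilon> j _ v] cf_split2[of u v \<epsilon> k _ w]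
      nth_step gg_def)

section \<open>The quadratic relations\<close>

lemma mv_twice:
  assumes "mv \<epsilon> i c" "mv \<epsilon> j (nx \<epsilon> c)"
  shows "eqN i (j + sg \<epsilon>)"
proof (cases \<epsilon>)
  case Plus
  then show ?thesis
    using assms dvd_diff[of "int N" "c - 1 - (j + 1)" "c - (i + 1)"]
    by (simp add: mv_def nx_def eqN_def algebra_simps)
next
  case Minus
  then show ?thesis
    using assms dvd_diff[of "int N" "c + 1 - j" "c - i"]
    by (simp add: mv_def nx_def eqN_def algebra_simps)
qed

lemma cf_cf_same:
  assumes "cf \<epsilon> i T u * cf \<epsilon> j (step \<epsilon> u T) u \<noteq> 0" "u < l" "length T = l"
  shows "eqN i (j + sg \<epsilon>)"
  using assms by (auto simp: cf_def nth_step intro: mv_twice split: if_splits)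

text \<open>The box at \<open>u\<close> is moved by \<open>x_i\<close> and the one at
  \<open>v\<close> by \<open>x_j\<close>, so both orders end at the same tableau and the relation
  can be compared coefficient by coefficient. For distinct boxes the linear factors are those of
  \<open>gg_ratio\<close>.\<close>

lemma quadratic_coeff:
  fixes \<epsilon> i j
  assumes "u < l" "v < l" "length T = l"
  defines "Q \<equiv> qs \<epsilon> powi cartan N i j"
  shows "cz \<epsilon> j (r - 1) T v * cz \<epsilon> i m (step \<epsilon> v T) u - Q * (cz \<epsilon> j r T v * cz \<epsilon> i (m - 1) (step \<epsilon> v T) u) =
    Q * (cz \<epsilon> i m T u * cz \<epsilon> j (r - 1) (step \<epsilon> u T) v) - cz \<epsilon> i (m - 1) T u * cz \<epsilon> j r (step \<epsilon> u T) v"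
proof -
  define a b where "a = ze \<epsilon> u (T ! u)" and "b = ze \<epsilon> v (T ! v)"
  have pw: "x powi m = x * x powi (m - 1)" "x powi r = x * x powi (r - 1)" if "x \<noteq> 0" for x :: complex
    using that power_int_add[of x 1 "m - 1"] power_int_add[of x 1 "r - 1"] by simp_all
  show ?thesis
  proof (cases "u = v")
    case True
    define K1 K2 where "K1 = cf \<epsilon> j T v * cf \<epsilon> i (step \<epsilon> v T) u" and "K2 = cf \<epsilon> i T u * cf \<epsilon> j (step \<epsilon> u T) v"
    have z: "ze \<epsilon> u (step \<epsilon> v T ! u) = b / qs \<epsilon>" "ze \<epsilon> v (step \<epsilon> u T ! v) = b / qs \<epsilon>" "a = b"
      using True assms by (simp_all add: nth_step ze_nx a_def b_def)
    \<comment> \<open>A box that moves twice has its second pole at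
      \<open>b / qs \<epsilon>\<close>. The two indices must then be adjacent, so
      \<open>Q = 1 / qs \<epsilon>\<close> and the linear factor vanishes; each side of the relation
      is zero by itself.\<close>
    have K1: "K1 * (b / qs \<epsilon> - Q * b) = 0"
    proof (cases "K1 = 0")
      case False
      then have "eqN j (i + sg \<epsilon>)"
        using True assms cf_cf_same by (simp add: K1_def)
      then have "Q = 1 / qs \<epsilon>"
        using eqN_distinct(1-3)[of j i] by (cases \<epsilon>) (auto simp: Q_def qs_powi_cartan)
      then show ?thesis by simp
    qed simp
    have K2: "K2 * (Q * b - b / qs \<epsilon>) = 0"
    proof (cases "K2 = 0")
      case False
      then have "eqN i (j + sg \<epsilon>)"
        using True assms cf_cf_same by (simp add: K2_def)
      then have "Q = 1 / qs \<epsilon>"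
        using eqN_distinct(1-3)[of i j] unfolding Q_def cartan_sym[of i j]
        by (cases \<epsilon>) (auto simp: qs_powi_cartan)
      then show ?thesis by simp
    qed simp
    let ?P = "b powi (r - 1) * (b / qs \<epsilon>) powi (m - 1)" and ?P' = "b powi (m - 1) * (b / qs \<epsilon>) powi (r - 1)"
    have "K1 * (b / qs \<epsilon> - Q * b) * ?P = K2 * (Q * b - b / qs \<epsilon>) * ?P'"
      by (simp only: K1 K2 mult_zero_left)
    moreover have nz: "b \<noteq> 0" "b / qs \<epsilon> \<noteq> 0"
      by (simp_all add: b_def)
    ultimately show ?thesis
      unfolding cz_def z a_def[symmetric] b_def[symmetric] pw(1)[OF nz(1)] pw(1)[OF nz(2)]
        pw(2)[OF nz(1)] pw(2)[OF nz(2)] K1_def K2_def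
      by (simp only: algebra_simps)
  next
    case False
    have z: "ze \<epsilon> u (step \<epsilon> v T ! u) = a" "ze \<epsilon> v (step \<epsilon> u T ! v) = b"
      using False assms by (simp_all add: nth_step a_def b_def)
    have eq: "cf \<epsilon> j T v * cf \<epsilon> i (step \<epsilon> v T) u * (a - Q * b) =
        cf \<epsilon> i T u * cf \<epsilon> j (step \<epsilon> u T) v * (Q * a - b)"
    proof (cases "mv \<epsilon> i (T ! u) \<and> mv \<epsilon> j (T ! v)")
      case mv: True
      have "gg \<epsilon> T j v i u * (a - Q * b) = gg \<epsilon> T i u j v * (Q * a - b)"
      proof (cases "cartan N i j = 0")
        case True
        then show ?thesis
          using mv by (simp add: gg_far cartan_sym[of j i] Q_def)
      next
        case C: False
        then show ?thesis
          using gg_ratio[of \<epsilon> i T u j v] mv False assms(1,2) by (auto simp: Q_def a_def b_def)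
      qed
      moreover define R where
        "R = rest \<epsilon> i u (ze \<epsilon> u (T ! u)) {v} T * rest \<epsilon> j v (ze \<epsilon> v (T ! v)) {u} T"
      moreover have "cf \<epsilon> j T v * cf \<epsilon> i (step \<epsilon> v T) u = gg \<epsilon> T j v i u * R"
        "cf \<epsilon> i T u * cf \<epsilon> j (step \<epsilon> u T) v = gg \<epsilon> T i u j v * R"
        using False assms mv by (simp_all add: cf_cf R_def)
      ultimately show ?thesis
        by algebra
    qed (use False assms in \<open>auto simp: cf_cf\<close>)
    have nz: "a \<noteq> 0" "b \<noteq> 0"
      by (simp_all add: a_def b_def)
    have "(cf \<epsilon> j T v * cf \<epsilon> i (step \<epsilon> v T) u * (a - Q * b)) * (a powi (m - 1) * b powi (r - 1)) =
        (cf \<epsilon> i T u * cf \<epsilon> j (step \<epsilon> u T) v * (Q * a - b)) * (a powi (m - 1) * b powi (r - 1))"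
      by (simp only: eq)
    then show ?thesis
      unfolding cz_def z a_def[symmetric] b_def[symmetric] pw(1)[OF nz(1)] pw(2)[OF nz(2)]
      by (simp add: algebra_simps)
  qed
qed

lemma quadratic:
  fixes \<epsilon> i j
  assumes "length T = l"
  defines "Q \<equiv> qs \<epsilon> powi cartan N i j" and "v \<equiv> Poly_Mapping.single T 1"
  shows "X \<epsilon> i m (X \<epsilon> j (r - 1) v) - cscale Q (X \<epsilon> i (m - 1) (X \<epsilon> j r v)) =
         cscale Q (X \<epsilon> j (r - 1) (X \<epsilon> i m v)) - X \<epsilon> j r (X \<epsilon> i (m - 1) v)"
proof -
  have *: "X \<epsilon> j s (X \<epsilon> i n (Poly_Mapping.single T 1)) =
    (\<Sum>v<l. \<Sum>u<l. cscale (cz \<epsilon> i n T u * cz \<epsilon> j s (step \<epsilon> u T) v)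
       (Poly_Mapping.single (step \<epsilon> u (step \<epsilon> v T)) 1))" for n s
    unfolding XX_single by (subst sum.swap) (simp add: step_commute)
  show ?thesis
    unfolding v_def XX_single[of \<epsilon> i _ \<epsilon> j] * vec.scale_sum_right vec.scale_scale
      sum_subtractf[symmetric] vec.scale_left_diff_distrib[symmetric]
    by (auto intro!: sum.cong simp: quadratic_coeff[OF _ _ assms(1), of _ _ \<epsilon> j r i m, folded Q_def])
qed

lemma X_commute:
  assumes "length T = l" "cartan N i j = 0"
  shows "X \<epsilon> i m (X \<epsilon> j r (Poly_Mapping.single T 1)) = X \<epsilon> j r (X \<epsilon> i m (Poly_Mapping.single T 1))"
proof -
  have "cz \<epsilon> j r T v * cz \<epsilon> i m (step \<epsilon> v T) u = cz \<epsilon> i m T u * cz \<epsilon> j r (step \<epsilon> u T) v"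
    if "u < l" "v < l" for u v
  proof (cases "u = v")
    case True
    have "\<not> eqN i (j + sg \<epsilon>)" "\<not> eqN j (i + sg \<epsilon>)"
      using assms(2) cartan_sym[of i j] by (cases \<epsilon>; auto simp: cartan_eqN split: if_splits)+
    then have "cf \<epsilon> j T v * cf \<epsilon> i (step \<epsilon> v T) v = 0" "cf \<epsilon> i T v * cf \<epsilon> j (step \<epsilon> v T) v = 0"
      using cf_cf_same assms(1) that by blast+
    then show ?thesis
      using True by (auto simp: cz_def)
  next
    case False
    then have "cf \<epsilon> j T v * cf \<epsilon> i (step \<epsilon> v T) u = cf \<epsilon> i T u * cf \<epsilon> j (step \<epsilon> u T) v"
      using that assms by (simp add: cf_cf gg_far cartan_sym[of j i])
    then show ?thesis
      using False that assms(1) by (simp add: cz_def nth_step algebra_simps)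
  qed
  moreover have "X \<epsilon> j r (X \<epsilon> i m (Poly_Mapping.single T 1)) =
    (\<Sum>v<l. \<Sum>u<l. cscale (cz \<epsilon> i m T u * cz \<epsilon> j r (step \<epsilon> u T) v)
       (Poly_Mapping.single (step \<epsilon> u (step \<epsilon> v T)) 1))"
    unfolding XX_single by (subst sum.swap) (simp add: step_commute)
  ultimately show ?thesis
    by (simp add: XX_single)
qed

end

section \<open>Rational identities and reindexing for the Serre relations\<close>

lemma double_identities:
  fixes Q a b :: complex
  assumes "Q \<noteq> 0" "b \<noteq> a"
  shows "(1 / Q * b - Q * a) / (b - a) + (Q * b - a / Q) / (b - a) = Q + 1 / Q"
    and "(Q * (Q * b) - a) / (Q * b - Q * a) = (Q * b - a / Q) / (b - a)"
    and "(1 / Q * (b / Q) - a) / (b / Q - a / Q) = (1 / Q * b - Q * a) / (b - a)"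
proof -
  have "b - a \<noteq> 0" using assms by simp
  then show "(1 / Q * b - Q * a) / (b - a) + (Q * b - a / Q) / (b - a) = Q + 1 / Q"
    using assms(1) by (simp add: add_divide_distrib[symmetric] divide_eq_eq) (simp add: field_simps)
  have "Q * (Q * b) - a = Q * (Q * b - a / Q)" "Q * b - Q * a = Q * (b - a)"
    using assms(1) by (simp_all add: algebra_simps)
  then show "(Q * (Q * b) - a) / (Q * b - Q * a) = (Q * b - a / Q) / (b - a)"
    using assms(1) by simp
  have "1 / Q * (b / Q) - a = (1 / Q * b - Q * a) / Q" "b / Q - a / Q = (b - a) / Q"
    using assms(1) by (simp_all add: field_simps)
  then show "(1 / Q * (b / Q) - a) / (b / Q - a / Q) = (1 / Q * b - Q * a) / (b - a)"
    using assms(1) by simp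
qed

text \<open>Here \<open>a\<close> and \<open>b\<close> are the poles of the two boxes moved by
  \<open>x_i\<close>, and \<open>e\<close> is a rescaled pole of the box moved by
  \<open>x_j\<close>. The pairs \<open>g\<close>, \<open>g'\<close> and \<open>h\<close>,
  \<open>h'\<close> and \<open>k\<close>, \<open>k'\<close> are the interactions of two boxes in the
  two possible orders, as \<open>gg_ratio\<close> provides them.\<close>

lemma serre_polynomial:
  fixes Q P a b e \<alpha> \<beta> \<gamma> :: complex
  assumes "Q * P = 1"
  defines "s \<equiv> Q\<^sup>2"
  defines "g \<equiv> \<alpha> * (a - s * b)" and "g' \<equiv> \<alpha> * (s * a - b)"
    and "h \<equiv> \<beta> * (a - e)" and "h' \<equiv> \<beta> * (P * (a - s * e))"
    and "k \<equiv> \<gamma> * (b - e)" and "k' \<equiv> \<gamma> * (P * (b - s * e))"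
  shows "k' * h' * g' + h' * k' * g - (Q + P) * (k * g' * h' + h * g * k') + (g' * k * h + g * h * k) = 0"
proof -
  have P: "s * P\<^sup>2 = 1" "(Q + P) * P = (1 + s) * P\<^sup>2" 
    using assms(1) unfolding s_def by algebra+
  \<comment> \<open>Both sides change sign when \<open>a\<close> and \<open>b\<close> are exchanged.
    Substituting this identity cancels the terms with \<open>(b - s * e) * (a - s * e)\<close>, and
    the remainder contains the factor \<open>1 - s * P\<^sup>2\<close>, which is zero.\<close>
  have id: "(a - b) * ((b - s * e) * (a - s * e) + s * ((b - e) * (a - e))) =
      (b - e) * (s * a - b) * (a - s * e) + (a - e) * (a - s * b) * (b - s * e)"
    by algebra
  have "k' * h' * g' + h' * k' * g - (Q + P) * (k * g' * h' + h * g * k') + (g' * k * h + g * h * k)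
    = \<alpha> * \<beta> * \<gamma> * (P\<^sup>2 * (1 + s) * (a - b) * ((b - s * e) * (a - s * e))
       - ((Q + P) * P) * ((b - e) * (s * a - b) * (a - s * e) + (a - e) * (a - s * b) * (b - s * e))
       + (1 + s) * (a - b) * ((b - e) * (a - e)))"
    unfolding g_def g'_def h_def h'_def k_def k'_def by algebra
  also have "\<dots> = \<alpha> * \<beta> * \<gamma> * ((1 + s) * (a - b) * ((b - e) * (a - e)) * (1 - s * P\<^sup>2))"
    unfolding P(2) id[symmetric] by algebra
  finally show ?thesis
    by (simp add: P(1))
qed

lemma sum3_perms:
  fixes f :: "nat \<Rightarrow> nat \<Rightarrow> nat \<Rightarrow> 'x::comm_monoid_add"
  shows "(\<Sum>a\<in>S. \<Sum>b\<in>S. \<Sum>c\<in>S. f a c b) = (\<Sum>a\<in>S. \<Sum>b\<in>S. \<Sum>c\<in>S. f a b c)"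
    and "(\<Sum>a\<in>S. \<Sum>b\<in>S. \<Sum>c\<in>S. f b a c) = (\<Sum>a\<in>S. \<Sum>b\<in>S. \<Sum>c\<in>S. f a b c)"
    and "(\<Sum>a\<in>S. \<Sum>b\<in>S. \<Sum>c\<in>S. f b c a) = (\<Sum>a\<in>S. \<Sum>b\<in>S. \<Sum>c\<in>S. f a b c)"
    and "(\<Sum>a\<in>S. \<Sum>b\<in>S. \<Sum>c\<in>S. f c a b) = (\<Sum>a\<in>S. \<Sum>b\<in>S. \<Sum>c\<in>S. f a b c)"
    and "(\<Sum>a\<in>S. \<Sum>b\<in>S. \<Sum>c\<in>S. f c b a) = (\<Sum>a\<in>S. \<Sum>b\<in>S. \<Sum>c\<in>S. f a b c)"
proof -
  have 1: "(\<Sum>a\<in>S. \<Sum>b\<in>S. \<Sum>c\<in>S. f a c b) = (\<Sum>a\<in>S. \<Sum>b\<in>S. \<Sum>c\<in>S. f a b c)" for f :: "nat \<Rightarrow> nat \<Rightarrow> nat \<Rightarrow> 'x"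
    by (rule sum.cong[OF refl]) (rule sum.swap)
  have 2: "(\<Sum>a\<in>S. \<Sum>b\<in>S. \<Sum>c\<in>S. f b a c) = (\<Sum>a\<in>S. \<Sum>b\<in>S. \<Sum>c\<in>S. f a b c)" for f :: "nat \<Rightarrow> nat \<Rightarrow> nat \<Rightarrow> 'x"
    by (rule sum.swap)
  show "(\<Sum>a\<in>S. \<Sum>b\<in>S. \<Sum>c\<in>S. f a c b) = (\<Sum>a\<in>S. \<Sum>b\<in>S. \<Sum>c\<in>S. f a b c)"
    "(\<Sum>a\<in>S. \<Sum>b\<in>S. \<Sum>c\<in>S. f b a c) = (\<Sum>a\<in>S. \<Sum>b\<in>S. \<Sum>c\<in>S. f a b c)"
    by (rule 1 2)+
  show "(\<Sum>a\<in>S. \<Sum>b\<in>S. \<Sum>c\<in>S. f b c a) = (\<Sum>a\<in>S. \<Sum>b\<in>S. \<Sum>c\<in>S. f a b c)"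
    using 1[of "\<lambda>a b c. f c b a"] 2[of "\<lambda>a b c. f b c a"] 1[of f] 2[of f] 1[of "\<lambda>a b c. f b a c"] by simp
  show "(\<Sum>a\<in>S. \<Sum>b\<in>S. \<Sum>c\<in>S. f c a b) = (\<Sum>a\<in>S. \<Sum>b\<in>S. \<Sum>c\<in>S. f a b c)"
    using 1[of "\<lambda>a b c. f b a c"] 2[of f] by simp
  show "(\<Sum>a\<in>S. \<Sum>b\<in>S. \<Sum>c\<in>S. f c b a) = (\<Sum>a\<in>S. \<Sum>b\<in>S. \<Sum>c\<in>S. f a b c)"
    using 2[of "\<lambda>a b c. f c b a"] 1[of "\<lambda>a b c. f b a c"] 2[of f] by simp
qed

context folding
begin

section \<open>The Serre relations\<close>

text \<open>The arguments are listed in the order in which the moves are made, which is the reverse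
  of the order in which operators are written.\<close>

definition t3 :: "sign \<Rightarrow> int list \<Rightarrow> int \<Rightarrow> int \<Rightarrow> nat \<Rightarrow> int \<Rightarrow> int \<Rightarrow> nat \<Rightarrow> int \<Rightarrow> int \<Rightarrow> nat \<Rightarrow> complex" where
  "t3 \<epsilon> T i m u j r v k s w =
     cz \<epsilon> i m T u * cz \<epsilon> j r (step \<epsilon> u T) v * cz \<epsilon> k s (step \<epsilon> v (step \<epsilon> u T)) w"

lemma t3_distinct:
  assumes "u < l" "v < l" "w < l" "u \<noteq> v" "u \<noteq> w" "v \<noteq> w" "length T = l"
  shows "t3 \<epsilon> T i m u j r v k s w =
    (if mv \<epsilon> i (T ! u) \<and> mv \<epsilon> j (T ! v) \<and> mv \<epsilon> k (T ! w) then
       gg \<epsilon> T i u j v * gg \<epsilon> T i u k w * gg \<epsilon> T j v k w *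
         (rest \<epsilon> i u (ze \<epsilon> u (T ! u)) {v, w} T * rest \<epsilon> j v (ze \<epsilon> v (T ! v)) {u, w} T
          * rest \<epsilon> k w (ze \<epsilon> w (T ! w)) {u, v} T *
          (ze \<epsilon> u (T ! u) powi m * ze \<epsilon> v (T ! v) powi r * ze \<epsilon> w (T ! w) powi s)) else 0)"
proof -
  have "t3 \<epsilon> T i m u j r v k s w =
    (cf \<epsilon> i T u * cf \<epsilon> j (step \<epsilon> u T) v * cf \<epsilon> k (step \<epsilon> v (step \<epsilon> u T)) w) *
      (ze \<epsilon> u (T ! u) powi m * ze \<epsilon> v (T ! v) powi r * ze \<epsilon> w (T ! w) powi s)"
    using assms by (simp add: t3_def cz_def nth_step mult_ac)
  then show ?thesis
    unfolding cf_cf_cf[OF assms] by simp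
qed

lemma t3_distinct_zero:
  assumes "u < l" "v < l" "w < l" "u \<noteq> v" "u \<noteq> w" "v \<noteq> w" "length T = l"
    and "\<not> (mv \<epsilon> i (T ! u) \<and> mv \<epsilon> j (T ! v) \<and> mv \<epsilon> k (T ! w))"
  shows "t3 \<epsilon> T i m u j r v k s w = 0"
  using t3_distinct[OF assms(1-7)] assms(8) by (simp only: if_False)

lemma serre_distinct:
  assumes "u < l" "v < l" "w < l" "u \<noteq> v" "u \<noteq> w" "v \<noteq> w" "length T = l" "cartan N i j = -1"
  shows "t3 \<epsilon> T j r w i m' v i m u + t3 \<epsilon> T j r w i m u i m' v
    - (q + 1 / q) * (t3 \<epsilon> T i m' v j r w i m u + t3 \<epsilon> T i m u j r w i m' v)
    + (t3 \<epsilon> T i m' v i m u j r w + t3 \<epsilon> T i m u i m' v j r w) = 0"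
proof (cases "mv \<epsilon> i (T ! u) \<and> mv \<epsilon> i (T ! v) \<and> mv \<epsilon> j (T ! w)")
  case mv: True
  define Q P where "Q = qs \<epsilon>" and "P = 1 / qs \<epsilon>"
  have QP: "Q * P = 1" by (simp add: Q_def P_def)
  define a b c where "a = ze \<epsilon> u (T ! u)" "b = ze \<epsilon> v (T ! v)" "c = ze \<epsilon> w (T ! w)"
  \<comment> \<open>The factors of all other boxes and the powers of the poles are the same in all
    six orders; only the pairwise interactions differ.\<close>
  define R where "R = rest \<epsilon> i u a {v, w} T * rest \<epsilon> i v b {u, w} T * rest \<epsilon> j w c {u, v} T *
    (a powi m * b powi m' * c powi r)"
  have C: "qs \<epsilon> powi cartan N i i = Q\<^sup>2" "qs \<epsilon> powi cartan N i j = P"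
    using assms(8) by (simp_all add: cartan_eqN Q_def P_def divide_inverse)
  have mv': "mv \<epsilon> i (T ! u)" "mv \<epsilon> i (T ! v)" "mv \<epsilon> j (T ! w)" and C0: "cartan N i i \<noteq> 0" "cartan N i j \<noteq> 0"
    using mv assms(8) by (simp_all add: cartan_eqN)
  obtain \<alpha> where 1: "gg \<epsilon> T i u i v = \<alpha> * (a - Q\<^sup>2 * b)" "gg \<epsilon> T i v i u = \<alpha> * (Q\<^sup>2 * a - b)"
    using gg_ratio[OF mv'(1,2) C0(1) assms(1,2,4), unfolded C, folded a_b_c_def] by blast
  \<comment> \<open>With this scaling the interactions with the box at \<open>w\<close> become
    multiples of \<open>a - e\<close> and \<open>a - Q\<^sup>2 * e\<close>, the form used in
    \<open>serre_polynomial\<close>.\<close>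
  define e where "e = P * c"
  have e: "P * x - c = P * (x - Q\<^sup>2 * e)" for x
    using QP unfolding e_def by algebra
  obtain \<beta> where "gg \<epsilon> T i u j w = \<beta> * (a - P * c)" "gg \<epsilon> T j w i u = \<beta> * (P * a - c)"
    using gg_ratio[OF mv'(1,3) C0(2) assms(1,3,5), unfolded C, folded a_b_c_def] by blast
  note 2 = this[unfolded e, folded e_def]
  obtain \<gamma> where "gg \<epsilon> T i v j w = \<gamma> * (b - P * c)" "gg \<epsilon> T j w i v = \<gamma> * (P * b - c)"
    using gg_ratio[OF mv'(2,3) C0(2) assms(2,3,6), unfolded C, folded a_b_c_def] by blast
  note 3 = this[unfolded e, folded e_def]
  have "t3 \<epsilon> T j r w i m' v i m u = gg \<epsilon> T j w i v * gg \<epsilon> T j w i u * gg \<epsilon> T i v i u * R"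
    "t3 \<epsilon> T j r w i m u i m' v = gg \<epsilon> T j w i u * gg \<epsilon> T j w i v * gg \<epsilon> T i u i v * R"
    "t3 \<epsilon> T i m' v j r w i m u = gg \<epsilon> T i v j w * gg \<epsilon> T i v i u * gg \<epsilon> T j w i u * R"
    "t3 \<epsilon> T i m u j r w i m' v = gg \<epsilon> T i u j w * gg \<epsilon> T i u i v * gg \<epsilon> T j w i v * R"
    "t3 \<epsilon> T i m' v i m u j r w = gg \<epsilon> T i v i u * gg \<epsilon> T i v j w * gg \<epsilon> T i u j w * R"
    "t3 \<epsilon> T i m u i m' v j r w = gg \<epsilon> T i u i v * gg \<epsilon> T i u j w * gg \<epsilon> T i v j w * R"
    using assms mv by (simp_all add: t3_distinct R_def a_b_c_def insert_commute mult_ac)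
  note t3 = this
  have "q + 1 / q = Q + P"
    by (simp add: Q_def P_def qs_sum)
  moreover have "gg \<epsilon> T j w i v * gg \<epsilon> T j w i u * gg \<epsilon> T i v i u + gg \<epsilon> T j w i u * gg \<epsilon> T j w i v * gg \<epsilon> T i u i v
      - (Q + P) * (gg \<epsilon> T i v j w * gg \<epsilon> T i v i u * gg \<epsilon> T j w i u + gg \<epsilon> T i u j w * gg \<epsilon> T i u i v * gg \<epsilon> T j w i v)
      + (gg \<epsilon> T i v i u * gg \<epsilon> T i v j w * gg \<epsilon> T i u j w + gg \<epsilon> T i u i v * gg \<epsilon> T i u j w * gg \<epsilon> T i v j w) = 0"
    unfolding 1 2 3 by (rule serre_polynomial[OF QP])
  moreover have "x * R + x' * R - s * (y * R + y' * R) + (z * R + z' * R) = (x + x' - s * (y + y') + (z + z')) * R"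
    for x x' y y' z z' s
    by algebra
  ultimately show ?thesis
    by (simp only: t3 mult_zero_left)
next
  case False
  then have "t3 \<epsilon> T j r w i m' v i m u = 0" "t3 \<epsilon> T j r w i m u i m' v = 0"
    "t3 \<epsilon> T i m' v j r w i m u = 0" "t3 \<epsilon> T i m u j r w i m' v = 0"
    "t3 \<epsilon> T i m' v i m u j r w = 0" "t3 \<epsilon> T i m u i m' v j r w = 0"
    using assms(1-7) by (intro t3_distinct_zero; blast)+
  then show ?thesis by simp
qed

text \<open>The box at \<open>p\<close> moves twice, the second time with pole
  \<open>z / qs \<epsilon>\<close>, while the box at \<open>v\<close> moves after, between or before
  these moves. The boxes other than these two contribute equally in the three cases, which gives one
  \<open>R\<close>.\<close>

lemma double_moves:
  assumes "p < l" "v < l" "p \<noteq> v" "length T = l"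
    and mv: "mv \<epsilon> k (T ! p)" "mv \<epsilon> k' (nx \<epsilon> (T ! p))" "mv \<epsilon> i (T ! v)"
  defines "c \<equiv> T ! p" and "d \<equiv> T ! v" and "z \<equiv> ze \<epsilon> p (T ! p)" and "a \<equiv> ze \<epsilon> v (T ! v)"
  shows "\<exists>R. t3 \<epsilon> T k s p k' s' p i m v =
        hh \<epsilon> k p z v d * hh \<epsilon> k' p (z / qs \<epsilon>) v d * hh \<epsilon> i v a p (nx \<epsilon> (nx \<epsilon> c)) * R \<and>
      t3 \<epsilon> T k s p i m v k' s' p =
        hh \<epsilon> k p z v d * hh \<epsilon> i v a p (nx \<epsilon> c) * hh \<epsilon> k' p (z / qs \<epsilon>) v (nx \<epsilon> d) * R \<and>
      t3 \<epsilon> T i m v k s p k' s' p =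
        hh \<epsilon> i v a p c * hh \<epsilon> k p z v (nx \<epsilon> d) * hh \<epsilon> k' p (z / qs \<epsilon>) v (nx \<epsilon> d) * R"
  by (rule exI[of _ "rest \<epsilon> k p z {v} T * rest \<epsilon> k' p (z / qs \<epsilon>) {v} T * rest \<epsilon> i v a {p} T
        * (z powi s * (z / qs \<epsilon>) powi s' * a powi m)"])
    (use assms in \<open>simp add: t3_def cz_def nth_step cf_split1[of p \<epsilon> i _ v]
      cf_split1[of v \<epsilon> k _ p] cf_split1[of v \<epsilon> k' _ p] ze_nx mult_ac\<close>)

lemma t3_zero:
  assumes "length T = l" "p < l" "v < l" "v \<noteq> p" "\<not> eqN k (k' + sg \<epsilon>)"
  shows "t3 \<epsilon> T k s p k' s' p i m v = 0" "t3 \<epsilon> T k s p i m v k' s' p = 0" "t3 \<epsilon> T i m v k s p k' s' p = 0"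
  using assms mv_twice[of \<epsilon> k "T ! p" k'] by (auto simp: t3_def cz_def cf_def nth_step)

lemma E_before:
  assumes "mv \<epsilon> j c"
  shows "E i k c w = (if eqN j i then (1 / qs \<epsilon> * w - qs \<epsilon> * ze \<epsilon> k c) / (w - ze \<epsilon> k c)
     else if eqN j (i - sg \<epsilon>) then (qs \<epsilon> * w - ze \<epsilon> k c) / (w - qs \<epsilon> * ze \<epsilon> k c) else 1)"
  by (simp only: E_def bx_before[OF assms])

lemma E_after:
  assumes "mv \<epsilon> j c"
  shows "E i k (nx \<epsilon> c) w = (if eqN j i then (qs \<epsilon> * w - ze \<epsilon> k c / qs \<epsilon>) / (w - ze \<epsilon> k c)
     else if eqN j (i + sg \<epsilon>) then (1 / qs \<epsilon> * w - ze \<epsilon> k c) / (w - ze \<epsilon> k c / qs \<epsilon>) else 1)"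
  by (simp only: E_def bx_after[OF assms])

lemma eqN_flip: "eqN i (j + sg \<epsilon>) \<longleftrightarrow> eqN j (i - sg \<epsilon>)"
  using eqN_sym[of j] by (simp add: eqN_shift)

lemma eqN_adjacent:
  assumes "eqN j (i + sg \<epsilon>)"
  shows "\<not> eqN j i" "\<not> eqN i j" "\<not> eqN j (i - sg \<epsilon>)" "\<not> eqN i (j + sg \<epsilon>)" "eqN i (j - sg \<epsilon>)"
proof -
  show ji: "\<not> eqN j i" and ji': "\<not> eqN j (i - sg \<epsilon>)"
    using assms eqN_distinct(1-3)[of j i] by (cases \<epsilon>; auto)+
  show "\<not> eqN i j" using ji eqN_sym by blast
  show "\<not> eqN i (j + sg \<epsilon>)" using ji' eqN_flip by blast
  show "eqN i (j - sg \<epsilon>)" using assms eqN_flip by blast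
qed

text \<open>One box is moved by \<open>x_j\<close> and later by \<open>x_i\<close>; the opposite
  order is impossible for it, so three of the six terms survive. On whichever side the two boxes
  interact, the relation says that the values of \<open>\<phi>\<^sub>i\<close> on a box before and
  after a move by \<open>x_i\<close>, taken at one point, add up to
  \<open>q + 1 / q\<close>.\<close>

lemma serre_double1:
  assumes "p < l" "v < l" "v \<noteq> p" "length T = l" "eqN j (i + sg \<epsilon>)"
  shows "t3 \<epsilon> T j r p i m p i m' v + t3 \<epsilon> T j r p i m' v i m p =
    (q + 1 / q) * t3 \<epsilon> T i m' v j r p i m p"
proof (cases "mv \<epsilon> j (T ! p) \<and> mv \<epsilon> i (T ! v)")
  case mv: True
  let ?Q = "qs \<epsilon>"
  define z a where "z = ze \<epsilon> p (T ! p)" "a = ze \<epsilon> v (T ! v)"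
  define b where "b = z / ?Q"
  have m: "mv \<epsilon> i (nx \<epsilon> (T ! p))"
    using mv_nx[OF assms(5)] mv by blast
  have z: "z = ?Q * b" by (simp add: b_def)
  note j = eqN_adjacent[OF assms(5)]
  have b: "ze \<epsilon> p (nx \<epsilon> (T ! p)) = b"
    by (simp add: ze_nx b_def z_a_def)
  have ba: "b \<noteq> a"
    using ze_neq[OF m conjunct2[OF mv] assms(1,2)] assms(3) by (simp add: b z_a_def)
  obtain R where R: "t3 \<epsilon> T j r p i m p i m' v = hh \<epsilon> j p z v (T ! v) * hh \<epsilon> i p b v (T ! v) * hh \<epsilon> i v a p (nx \<epsilon> (nx \<epsilon> (T ! p))) * R"
      "t3 \<epsilon> T j r p i m' v i m p = hh \<epsilon> j p z v (T ! v) * hh \<epsilon> i v a p (nx \<epsilon> (T ! p)) * hh \<epsilon> i p b v (nx \<epsilon> (T ! v)) * R"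
      "t3 \<epsilon> T i m' v j r p i m p = hh \<epsilon> i v a p (T ! p) * hh \<epsilon> j p z v (nx \<epsilon> (T ! v)) * hh \<epsilon> i p b v (nx \<epsilon> (T ! v)) * R"
    using double_moves[OF assms(1,2) assms(3)[symmetric] assms(4) conjunct1[OF mv] m conjunct2[OF mv], of r m m']
    unfolding z_a_def[symmetric] b_def[symmetric] by blast
  define s where "s = ?Q + 1 / ?Q"
  have "hh \<epsilon> j p z v (T ! v) * hh \<epsilon> i p b v (T ! v) * hh \<epsilon> i v a p (nx \<epsilon> (nx \<epsilon> (T ! p)))
    + hh \<epsilon> j p z v (T ! v) * hh \<epsilon> i v a p (nx \<epsilon> (T ! p)) * hh \<epsilon> i p b v (nx \<epsilon> (T ! v))
    = s * (hh \<epsilon> i v a p (T ! p) * hh \<epsilon> j p z v (nx \<epsilon> (T ! v)) * hh \<epsilon> i p b v (nx \<epsilon> (T ! v)))"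
  proof (cases "bef \<epsilon> v p")
    case True
    have 1: "E j v (T ! v) z = (?Q * b - a / ?Q) / (b - a)" "E j v (nx \<epsilon> (T ! v)) z = 1"
      using mv j double_identities(2)[OF _ ba, of ?Q] E_before[of \<epsilon> i "T ! v" j v] E_after[of \<epsilon> i "T ! v" j v]
      by (simp_all add: z flip: z_a_def)
    have 2: "E i v (T ! v) b = (1 / ?Q * b - ?Q * a) / (b - a)"
       "E i v (nx \<epsilon> (T ! v)) b = (?Q * b - a / ?Q) / (b - a)"
      using mv E_before[of \<epsilon> i "T ! v" i v] E_after[of \<epsilon> i "T ! v" i v]
      by (simp_all add: flip: z_a_def)
    have 3: "E i v (T ! v) b + E i v (nx \<epsilon> (T ! v)) b = s"
      using double_identities(1)[OF _ ba, of ?Q] by (simp only: 2 s_def qs_nonzero not_False_eq_True)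
    have 4: "E j v (T ! v) z = E i v (nx \<epsilon> (T ! v)) b"
      by (simp only: 1 2)
    show ?thesis
      using True bef_total[OF assms(3), of \<epsilon>] 
      by (simp add: hh_def 1(2) 4 flip: 3) (simp add: algebra_simps)
  next
    case False
    have ab: "a \<noteq> b" using ba by simp
    have "E i p (T ! p) a = 1"
      using mv j E_before[of \<epsilon> j "T ! p" i p] by simp
    moreover have "E i p (nx \<epsilon> (T ! p)) a = (1 / ?Q * a - ?Q * b) / (a - b)"
      using m E_before[of \<epsilon> i "nx \<epsilon> (T ! p)" i p] by (simp add: b)
    moreover have "E i p (nx \<epsilon> (nx \<epsilon> (T ! p))) a = (?Q * a - b / ?Q) / (a - b)"
      using m E_after[of \<epsilon> i "nx \<epsilon> (T ! p)" i p] by (simp add: b)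
    ultimately show ?thesis
      using False bef_total[OF assms(3), of \<epsilon>] double_identities(1)[OF _ ab, of ?Q]
      by (simp add: hh_def s_def add.commute)
  qed
  then show ?thesis
    unfolding R qs_sum[of \<epsilon>] s_def by algebra
next
  case False
  then show ?thesis
    using assms by (cases "mv \<epsilon> j (T ! p)") (simp_all add: t3_def cz_def cf_def nth_step)
qed

text \<open>The mirror case, where the doubly moved box is moved by \<open>x_i\<close> first. When
  the twist comes from the other box, \<open>\<phi>\<^sub>j\<close> on that box after its move, at
  the second pole, agrees with \<open>\<phi>\<^sub>i\<close> before its move at the first pole, and
  the sum rule of \<open>serre_double1\<close> applies again.\<close>

lemma serre_double2:
  assumes "p < l" "v < l" "v \<noteq> p" "length T = l" "eqN i (j + sg \<epsilon>)"
  shows "t3 \<epsilon> T i m p i m' v j r p + t3 \<epsilon> T i m' v i m p j r p =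
    (q + 1 / q) * t3 \<epsilon> T i m p j r p i m' v"
proof (cases "mv \<epsilon> i (T ! p) \<and> mv \<epsilon> i (T ! v)")
  case mv: True
  let ?Q = "qs \<epsilon>"
  define b a where "b = ze \<epsilon> p (T ! p)" "a = ze \<epsilon> v (T ! v)"
  have m: "mv \<epsilon> j (nx \<epsilon> (T ! p))"
    using mv_nx[OF assms(5)] mv by blast
  note j = eqN_adjacent[OF assms(5)]
  have ba: "b \<noteq> a"
    using ze_neq[of \<epsilon> i "T ! p" "T ! v" p v] mv assms(1,2,3) by (simp add: b_a_def)
  obtain R where R: "t3 \<epsilon> T i m p j r p i m' v = hh \<epsilon> i p b v (T ! v) * hh \<epsilon> j p (b / ?Q) v (T ! v) * hh \<epsilon> i v a p (nx \<epsilon> (nx \<epsilon> (T ! p))) * R"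
      "t3 \<epsilon> T i m p i m' v j r p = hh \<epsilon> i p b v (T ! v) * hh \<epsilon> i v a p (nx \<epsilon> (T ! p)) * hh \<epsilon> j p (b / ?Q) v (nx \<epsilon> (T ! v)) * R"
      "t3 \<epsilon> T i m' v i m p j r p = hh \<epsilon> i v a p (T ! p) * hh \<epsilon> i p b v (nx \<epsilon> (T ! v)) * hh \<epsilon> j p (b / ?Q) v (nx \<epsilon> (T ! v)) * R"
    using double_moves[OF assms(1,2) assms(3)[symmetric] assms(4) conjunct1[OF mv] m conjunct2[OF mv], of m r m']
    unfolding b_a_def[symmetric] by blast
  define s where "s = ?Q + 1 / ?Q"
  have "hh \<epsilon> i p b v (T ! v) * hh \<epsilon> i v a p (nx \<epsilon> (T ! p)) * hh \<epsilon> j p (b / ?Q) v (nx \<epsilon> (T ! v))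
    + hh \<epsilon> i v a p (T ! p) * hh \<epsilon> i p b v (nx \<epsilon> (T ! v)) * hh \<epsilon> j p (b / ?Q) v (nx \<epsilon> (T ! v))
    = s * (hh \<epsilon> i p b v (T ! v) * hh \<epsilon> j p (b / ?Q) v (T ! v) * hh \<epsilon> i v a p (nx \<epsilon> (nx \<epsilon> (T ! p))))"
  proof (cases "bef \<epsilon> v p")
    case True
    have 1: "E j v (nx \<epsilon> (T ! v)) (b / ?Q) = (1 / ?Q * b - ?Q * a) / (b - a)" "E j v (T ! v) (b / ?Q) = 1"
      using mv j assms(5) double_identities(3)[OF _ ba, of ?Q] E_before[of \<epsilon> i "T ! v" j v] E_after[of \<epsilon> i "T ! v" j v]
      by (simp_all add: flip: b_a_def)
    have 2: "E i v (T ! v) b = (1 / ?Q * b - ?Q * a) / (b - a)"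
       "E i v (nx \<epsilon> (T ! v)) b = (?Q * b - a / ?Q) / (b - a)"
      using mv E_before[of \<epsilon> i "T ! v" i v] E_after[of \<epsilon> i "T ! v" i v]
      by (simp_all add: flip: b_a_def)
    have 3: "E i v (T ! v) b + E i v (nx \<epsilon> (T ! v)) b = s"
      using double_identities(1)[OF _ ba, of ?Q] by (simp only: 2 s_def qs_nonzero not_False_eq_True)
    have 4: "E j v (nx \<epsilon> (T ! v)) (b / ?Q) = E i v (T ! v) b"
      by (simp only: 1 2)
    show ?thesis
      using True bef_total[OF assms(3), of \<epsilon>] 
      by (simp add: hh_def 1(2) 4 flip: 3) (simp add: algebra_simps)
  next
    case False
    have ab: "a \<noteq> b" using ba by simp
    have "E i p (T ! p) a = (1 / ?Q * a - ?Q * b) / (a - b)"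
      using mv E_before[of \<epsilon> i "T ! p" i p] by (simp add: flip: b_a_def)
    moreover have "E i p (nx \<epsilon> (T ! p)) a = (?Q * a - b / ?Q) / (a - b)"
      using mv E_after[of \<epsilon> i "T ! p" i p] by (simp add: flip: b_a_def)
    moreover have "E i p (nx \<epsilon> (nx \<epsilon> (T ! p))) a = 1"
      using m j E_after[of \<epsilon> j "nx \<epsilon> (T ! p)" i p] by simp
    ultimately show ?thesis
      using False bef_total[OF assms(3), of \<epsilon>] double_identities(1)[OF _ ab, of ?Q]
      by (simp add: hh_def s_def add.commute)
  qed
  then show ?thesis
    unfolding R qs_sum[of \<epsilon>] s_def by algebra
next
  case False
  then show ?thesis
    using assms by (cases "mv \<epsilon> i (T ! p)") (simp_all add: t3_def cz_def cf_def nth_step)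
qed

text \<open>\<open>N\<close> divides neither 1 nor 2. Hence \<open>x_i\<close> cannot act twice on
  one box, even if \<open>x_j\<close> moves that box in between.\<close>

lemma not_mv_again:
  assumes "mv \<epsilon> i c"
  shows "\<not> mv \<epsilon> i (nx \<epsilon> c)" "\<not> mv \<epsilon> i (nx \<epsilon> (nx \<epsilon> c))"
proof -
  show "\<not> mv \<epsilon> i (nx \<epsilon> c)"
    using mv_twice[OF assms, of i] eqN_distinct(4,5) by (cases \<epsilon>) auto
  have "\<not> eqN (c - 2) x" "\<not> eqN (c + 2) x" if "eqN c x" for x
    using that eqN_cong(1)[OF that, of "x + 2"] eqN_cong(1)[OF that, of "x - 2"] N_not_dvd(2,4)
    by (simp_all add: eqN_shift) (simp_all add: eqN_def)
  then show "\<not> mv \<epsilon> i (nx \<epsilon> (nx \<epsilon> c))"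
    using assms by (cases \<epsilon>) (simp_all add: mv_def nx_def add.commute)
qed

lemma t3_same:
  assumes "length T = l" "p < l" "w < l"
  shows "t3 \<epsilon> T j r w i m p i m' p = 0" "t3 \<epsilon> T i m p j r w i m' p = 0" "t3 \<epsilon> T i m p i m' p j r w = 0"
  using assms not_mv_again[of \<epsilon> i "T ! p"] not_mv_again[of \<epsilon> i "nx \<epsilon> (T ! p)"]
  by (auto simp: t3_def cz_def cf_def nth_step simp del: prod_eq_1_iff)

text \<open>The positions \<open>u\<close> and \<open>v\<close> belong to the two factors
  \<open>x_i\<close>, with modes \<open>m\<close> and \<open>m'\<close>, and \<open>w\<close> to
  \<open>x_j\<close>. The identity holds for each such assignment separately; the cases are the
  possible coincidences of the three positions.\<close>

lemma serre_coeff: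
  assumes "u < l" "v < l" "w < l" "length T = l" "cartan N i j = -1"
  shows "t3 \<epsilon> T j r w i m' v i m u + t3 \<epsilon> T j r w i m u i m' v
    - (q + 1 / q) * (t3 \<epsilon> T i m' v j r w i m u + t3 \<epsilon> T i m u j r w i m' v)
    + (t3 \<epsilon> T i m' v i m u j r w + t3 \<epsilon> T i m u i m' v j r w) = 0"
proof -
  have j: "eqN j (i + sg \<epsilon>) \<and> \<not> eqN i (j + sg \<epsilon>) \<or> eqN i (j + sg \<epsilon>) \<and> \<not> eqN j (i + sg \<epsilon>)"
    using assms(5) eqN_adjacent(4)[of j i \<epsilon>] eqN_adjacent(4)[of i j \<epsilon>] eqN_flip[of i j \<epsilon>]
    by (cases \<epsilon>) (auto simp: cartan_eqN split: if_splits)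
  have one: "t3 \<epsilon> T j r p i n' v i n p + t3 \<epsilon> T j r p i n p i n' v
    - (q + 1 / q) * (t3 \<epsilon> T i n' v j r p i n p + t3 \<epsilon> T i n p j r p i n' v)
    + (t3 \<epsilon> T i n' v i n p j r p + t3 \<epsilon> T i n p i n' v j r p) = 0" if "v \<noteq> p" "p < l" "v < l" for p v n n'
    using j
  proof
    assume "eqN j (i + sg \<epsilon>) \<and> \<not> eqN i (j + sg \<epsilon>)"
    then show ?thesis
      using serre_double1[of p v T j i \<epsilon> r n n'] t3_zero[of T p v i j \<epsilon>] that assms(4)
      by (simp add: add.commute)
  next
    assume "eqN i (j + sg \<epsilon>) \<and> \<not> eqN j (i + sg \<epsilon>)"
    then show ?thesis
      using serre_double2[of p v T i j \<epsilon> n n' r] t3_zero[of T p v j i \<epsilon>] that assms(4)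
      by (simp add: add.commute)
  qed
  consider "u = v" | "u \<noteq> v" "w = u" | "u \<noteq> v" "w = v" | "u \<noteq> v" "u \<noteq> w" "v \<noteq> w" by blast
  then show ?thesis
  proof cases
    case 1
    then show ?thesis using assms by (simp add: t3_same)
  next
    case 2
    then show ?thesis using one[of v u m' m] assms by simp
  next
    case 3
    then show ?thesis using one[of u v m m'] assms by (simp add: algebra_simps)
  next
    case 4
    then show ?thesis using serre_distinct assms by blast
  qed
qed

lemma serre:
  assumes "length T = l" "cartan N i j = -1"
  defines "v \<equiv> Poly_Mapping.single T 1"
  shows "(X \<epsilon> i m (X \<epsilon> i m' (X \<epsilon> j r v)) - cscale (q + 1 / q) (X \<epsilon> i m (X \<epsilon> j r (X \<epsilon> i m' v)))
     + X \<epsilon> j r (X \<epsilon> i m (X \<epsilon> i m' v))) +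
    (X \<epsilon> i m' (X \<epsilon> i m (X \<epsilon> j r v)) - cscale (q + 1 / q) (X \<epsilon> i m' (X \<epsilon> j r (X \<epsilon> i m v)))
     + X \<epsilon> j r (X \<epsilon> i m' (X \<epsilon> i m v))) = 0"
proof -
  let ?V = "\<lambda>a b c. Poly_Mapping.single (step \<epsilon> a (step \<epsilon> b (step \<epsilon> c T))) (1::complex)"
  have e: "X \<epsilon> i1 m1 (X \<epsilon> i2 m2 (X \<epsilon> i3 m3 v)) =
     (\<Sum>a<l. \<Sum>b<l. \<Sum>c<l. cscale (t3 \<epsilon> T i3 m3 a i2 m2 b i1 m1 c) (?V c b a))" for i1 m1 i2 m2 i3 m3
    by (simp add: v_def XXX_single t3_def)
  \<comment> \<open>The six products are reindexed so that \<open>a\<close> and \<open>b\<close> are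
    always the boxes moved with modes \<open>m\<close> and \<open>m'\<close>, and \<open>c\<close>
    the box moved by \<open>x_j\<close>. The resulting basis vectors then agree term by
    term.\<close>
  have 1: "X \<epsilon> i m (X \<epsilon> i m' (X \<epsilon> j r v)) = (\<Sum>a<l. \<Sum>b<l. \<Sum>c<l. cscale (t3 \<epsilon> T j r c i m' b i m a) (?V a b c))"
    unfolding e by (rule trans[OF _ sum3_perms(5)]) (simp only: step_commute)
  have 2: "X \<epsilon> i m (X \<epsilon> j r (X \<epsilon> i m' v)) = (\<Sum>a<l. \<Sum>b<l. \<Sum>c<l. cscale (t3 \<epsilon> T i m' b j r c i m a) (?V a b c))"
    unfolding e by (rule trans[OF _ sum3_perms(4)]) (simp only: step_commute)
  have 3: "X \<epsilon> j r (X \<epsilon> i m (X \<epsilon> i m' v)) = (\<Sum>a<l. \<Sum>b<l. \<Sum>c<l. cscale (t3 \<epsilon> T i m' b i m a j r c) (?V a b c))"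
    unfolding e by (rule trans[OF _ sum3_perms(2)]) (simp only: step_commute)
  have 4: "X \<epsilon> i m' (X \<epsilon> i m (X \<epsilon> j r v)) = (\<Sum>a<l. \<Sum>b<l. \<Sum>c<l. cscale (t3 \<epsilon> T j r c i m a i m' b) (?V a b c))"
    unfolding e by (rule trans[OF _ sum3_perms(3)]) (simp only: step_commute)
  have 5: "X \<epsilon> i m' (X \<epsilon> j r (X \<epsilon> i m v)) = (\<Sum>a<l. \<Sum>b<l. \<Sum>c<l. cscale (t3 \<epsilon> T i m a j r c i m' b) (?V a b c))"
    unfolding e by (rule trans[OF _ sum3_perms(1)]) (simp only: step_commute)
  have 6: "X \<epsilon> j r (X \<epsilon> i m' (X \<epsilon> i m v)) = (\<Sum>a<l. \<Sum>b<l. \<Sum>c<l. cscale (t3 \<epsilon> T i m a i m' b j r c) (?V a b c))"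
    unfolding e by (simp only: step_commute)
  have "cscale x (?V a b c) - cscale s (cscale y (?V a b c)) + cscale z (?V a b c) +
     (cscale x' (?V a b c) - cscale s (cscale y' (?V a b c)) + cscale z' (?V a b c)) =
     cscale (x + x' - s * (y + y') + (z + z')) (?V a b c)" for x y z x' y' z' s a b c
    by (simp add: algebra_simps vec.scale_left_distrib vec.scale_left_diff_distrib)
  then show ?thesis
    unfolding 1 2 3 4 5 6 vec.scale_sum_right sum_subtractf[symmetric] sum.distrib[symmetric]
    by (simp add: serre_coeff[OF _ _ _ assms(1,2)])
qed

end

section \<open>Expansions of rational functions\<close>

definition Pw :: "sign \<Rightarrow> complex fps" where
  "Pw \<epsilon> = (if \<epsilon> = Plus then 1 else fps_X)"

definition Sw :: "sign \<Rightarrow> complex fps" where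
  "Sw \<epsilon> = (if \<epsilon> = Plus then fps_X else 1)"

text \<open>The expansion of \<open>(\<alpha> w - \<beta>) / (w - \<gamma>)\<close> in \<open>z = w\<^sup>-\<^sup>1\<close>, respectively in \<open>w\<close>. With \<open>w = P / S\<close> both
  are written homogeneously.\<close>

definition ser :: "sign \<Rightarrow> complex \<Rightarrow> complex \<Rightarrow> complex \<Rightarrow> complex fps" where
  "ser \<epsilon> \<alpha> \<beta> \<gamma> = (fps_const \<alpha> * Pw \<epsilon> - fps_const \<beta> * Sw \<epsilon>) * inverse (Pw \<epsilon> - fps_const \<gamma> * Sw \<epsilon>)"

lemma ser_unit:
  assumes "\<gamma> \<noteq> 0"
  shows "inverse (Pw \<epsilon> - fps_const \<gamma> * Sw \<epsilon>) * (Pw \<epsilon> - fps_const \<gamma> * Sw \<epsilon>) = 1"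
  by (rule inverse_mult_eq_1) (use assms in \<open>simp add: Pw_def Sw_def\<close>)

lemma psi_ser: "psi t \<epsilon> c = ser \<epsilon> (exp t) (c / exp t) c"
  by (cases \<epsilon>) (simp_all add: ser_def Pw_def Sw_def)

lemma ser_swap:
  assumes "\<alpha> * \<gamma> \<noteq> 0" "\<beta> \<noteq> 0"
  shows "ser \<epsilon> \<alpha> \<beta> \<gamma> * ser \<epsilon> (1 / \<alpha>) (\<gamma> / \<alpha>) (\<beta> / \<alpha>) = 1"
proof -
  have a: "\<alpha> \<noteq> 0" "\<gamma> \<noteq> 0" "\<beta> / \<alpha> \<noteq> 0" using assms by auto
  have "fps_const \<alpha> * Pw \<epsilon> - fps_const \<beta> * Sw \<epsilon> = fps_const \<alpha> * (Pw \<epsilon> - fps_const (\<beta> / \<alpha>) * Sw \<epsilon>)"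
    "fps_const (1 / \<alpha>) * Pw \<epsilon> - fps_const (\<gamma> / \<alpha>) * Sw \<epsilon> = fps_const (1 / \<alpha>) * (Pw \<epsilon> - fps_const \<gamma> * Sw \<epsilon>)"
    using a by (simp_all add: right_diff_distrib mult.assoc[symmetric])
  then have "ser \<epsilon> \<alpha> \<beta> \<gamma> * ser \<epsilon> (1 / \<alpha>) (\<gamma> / \<alpha>) (\<beta> / \<alpha>) = fps_const \<alpha> * fps_const (1 / \<alpha>) *
     (inverse (Pw \<epsilon> - fps_const \<gamma> * Sw \<epsilon>) * (Pw \<epsilon> - fps_const \<gamma> * Sw \<epsilon>)) *
     (inverse (Pw \<epsilon> - fps_const (\<beta> / \<alpha>) * Sw \<epsilon>) * (Pw \<epsilon> - fps_const (\<beta> / \<alpha>) * Sw \<epsilon>))"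
    unfolding ser_def by (simp only: mult_ac)
  then show ?thesis
    unfolding ser_unit[OF a(2)] ser_unit[OF a(3)] using a by simp
qed

lemma ser_nth_0: "\<gamma> \<noteq> 0 \<Longrightarrow> ser \<epsilon> \<alpha> \<beta> \<gamma> $ 0 = (if \<epsilon> = Plus then \<alpha> else \<beta> / \<gamma>)"
  by (simp add: ser_def Pw_def Sw_def field_simps)

text \<open>The coefficient of \<open>z\<^sup>m\<close> for a series in \<open>z\<^sup>\<plusminus>\<^sup>1\<close>.\<close>

definition co :: "sign \<Rightarrow> complex fps \<Rightarrow> int \<Rightarrow> complex" where
  "co \<epsilon> f m = (if sg \<epsilon> * m < 0 then 0 else f $ nat \<bar>m\<bar>)"

lemma co_add: "co \<epsilon> (f + g) m = co \<epsilon> f m + co \<epsilon> g m"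
  and co_const: "co \<epsilon> (fps_const c * f) m = c * co \<epsilon> f m"
  by (simp_all add: co_def)

lemma co_sum: "co \<epsilon> (sum g S) m = (\<Sum>x\<in>S. co \<epsilon> (g x) m)"
  by (simp add: co_def fps_sum_nth)

text \<open>For \<open>Plus\<close> the homogeneous factor is \<open>a - b z\<close>, and the index
  stays \<open>m\<close>. For \<open>Minus\<close> it is \<open>a w - b\<close>, which has an
  additional factor \<open>w\<close>; this accounts for the index \<open>1 - m\<close>.\<close>

lemma co_linear_factor:
  "a * co \<epsilon> f m - b * co \<epsilon> f (m - 1) =
    (let g = (fps_const a * Pw \<epsilon> - fps_const b * Sw \<epsilon>) * f; n = (if \<epsilon> = Plus then m else 1 - m)
     in if n < 0 then 0 else g $ nat n)"
proof (cases \<epsilon>)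
  case Plus
  then show ?thesis
    by (auto simp: co_def Pw_def Sw_def Let_def left_diff_distrib mult.assoc nat_diff_distrib)
next
  case Minus
  have "nat (1 - m) - 1 = nat (- m)" "m \<le> 1 \<Longrightarrow> nat \<bar>m - 1\<bar> = nat (1 - m)"
    "m \<le> 0 \<Longrightarrow> nat \<bar>m\<bar> = nat (- m)" "nat (1 - m) = 0 \<longleftrightarrow> m \<ge> 1"
    by auto
  with Minus show ?thesis
    by (auto simp: co_def Pw_def Sw_def Let_def left_diff_distrib mult.assoc)
qed

lemma co_transfer:
  assumes "(fps_const a * Pw \<epsilon> - fps_const b * Sw \<epsilon>) * f = (fps_const a' * Pw \<epsilon> - fps_const b' * Sw \<epsilon>) * f'"
  shows "a * co \<epsilon> f m - b * co \<epsilon> f (m - 1) = a' * co \<epsilon> f' m - b' * co \<epsilon> f' (m - 1)"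
  unfolding co_linear_factor assms ..

lemma fps_inverse_geometric:
  "inverse (1 - fps_const \<gamma> * fps_X) = Abs_fps (\<lambda>n. \<gamma> ^ n)" for \<gamma> :: complex
proof -
  have "Abs_fps (\<lambda>n. \<gamma> ^ n) * (1 - fps_const \<gamma> * fps_X) = 1"
    by (rule fps_ext) (auto simp: right_diff_distrib mult.left_commute[of _ "fps_const \<gamma>"] simp flip: power_Suc)
  then show ?thesis
    by (metis fps_inverse_unique mult.commute)
qed

text \<open>The expansions of \<open>1 / (w - \<gamma>)\<close> at infinity and at zero differ by a
  delta function supported at \<open>w = \<gamma>\<close>. These are the delta functions in the
  relation for \<open>[x\<^sup>+, x\<^sup>-]\<close>.\<close>

lemma co_pole:
  assumes "\<gamma> \<noteq> 0"
  shows "co Plus (Sw Plus * inverse (Pw Plus - fps_const \<gamma> * Sw Plus)) m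
    - co Minus (Sw Minus * inverse (Pw Minus - fps_const \<gamma> * Sw Minus)) m = \<gamma> powi (m - 1)"
proof -
  note 1 = fps_inverse_geometric[of \<gamma>]
  have "Abs_fps (\<lambda>n. - 1 / \<gamma> ^ Suc n) * (fps_X - fps_const \<gamma>) = 1"
  proof (rule fps_ext)
    fix n
    show "(Abs_fps (\<lambda>n. - 1 / \<gamma> ^ Suc n) * (fps_X - fps_const \<gamma>)) $ n = 1 $ n"
      using assms by (cases n) (auto simp: right_diff_distrib)
  qed
  then have 2: "inverse (fps_X - fps_const \<gamma>) = Abs_fps (\<lambda>n. - 1 / \<gamma> ^ Suc n)"
    by (metis fps_inverse_unique mult.commute)
  show ?thesis
  proof (cases "m \<ge> 1")
    case True
    then show ?thesis
      by (simp add: co_def Pw_def Sw_def 1 power_int_def nat_diff_distrib)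
  next
    case False
    then have "nat (1 - m) = Suc (nat (- m))" by simp
    then show ?thesis
      using False by (simp add: co_def Pw_def Sw_def 1 2 power_int_def divide_inverse power_inverse)
  qed
qed

lemma fps_const_prod: "fps_const (prod f K) = (\<Prod>k\<in>K. fps_const (f k))"
  by (induction K rule: infinite_finite_induct) (simp_all flip: fps_const_mult)

lemma fps_const_sum: "fps_const (sum f K) = (\<Sum>k\<in>K. fps_const (f k))"
  by (induction K rule: infinite_finite_induct) (simp_all flip: fps_const_add)

text \<open>\<open>P\<close> and \<open>S\<close> are left arbitrary because one set of residues has
  to serve both expansions, and because the induction step also substitutes constants for
  them.\<close>

lemma partial_fractions:
  fixes P S :: "complex fps" and \<alpha> \<beta> \<gamma> :: "'k \<Rightarrow> complex"
  assumes "finite K" "inj_on \<gamma> K" "\<And>k. k \<in> K \<Longrightarrow> u k * (P - fps_const (\<gamma> k) * S) = 1"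
  shows "(\<Prod>k\<in>K. (fps_const (\<alpha> k) * P - fps_const (\<beta> k) * S) * u k) =
    fps_const (\<Prod>k\<in>K. \<alpha> k) + (\<Sum>k\<in>K. fps_const ((\<alpha> k * \<gamma> k - \<beta> k) *
      (\<Prod>k'\<in>K - {k}. (\<alpha> k' * \<gamma> k - \<beta> k') / (\<gamma> k - \<gamma> k'))) * (S * u k))"
  using assms
proof (induction K arbitrary: P S u rule: finite_induct)
  case empty
  then show ?case by simp
next
  case (insert x K)
  define R where "R k = (\<alpha> k * \<gamma> k - \<beta> k) * (\<Prod>k'\<in>K - {k}. (\<alpha> k' * \<gamma> k - \<beta> k') / (\<gamma> k - \<gamma> k'))" for k
  define C where "C = (\<Prod>k\<in>K. \<alpha> k)"
  define e where "e = \<alpha> x * \<gamma> x - \<beta> x"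
  have ne: "\<gamma> k \<noteq> \<gamma> x" if "k \<in> K" for k
    using insert.prems(1) insert.hyps(2) that by (auto simp: inj_on_def)
  have IH: "(\<Prod>k\<in>K. (fps_const (\<alpha> k) * P - fps_const (\<beta> k) * S) * u k) =
      fps_const C + (\<Sum>k\<in>K. fps_const (R k) * (S * u k))"
    using insert.IH[of u P S] insert.prems by (simp add: R_def C_def)
  text \<open>The induction hypothesis at the constant series \<open>w = \<gamma> x\<close> gives the residue at the new pole.\<close>
  have val: "(\<Prod>k\<in>K. (\<alpha> k * \<gamma> x - \<beta> k) / (\<gamma> x - \<gamma> k)) = C + (\<Sum>k\<in>K. R k / (\<gamma> x - \<gamma> k))"
  proof -
    have "(\<Prod>k\<in>K. (fps_const (\<alpha> k) * fps_const (\<gamma> x) - fps_const (\<beta> k) * 1) * fps_const (1 / (\<gamma> x - \<gamma> k))) =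
      fps_const C + (\<Sum>k\<in>K. fps_const (R k) * (1 * fps_const (1 / (\<gamma> x - \<gamma> k))))"
      unfolding R_def C_def
    proof (rule insert.IH)
      show "inj_on \<gamma> K" using insert.prems(1) by (simp add: inj_on_insert)
      show "fps_const (1 / (\<gamma> x - \<gamma> k)) * (fps_const (\<gamma> x) - fps_const (\<gamma> k) * 1) = 1" if "k \<in> K" for k
        using not_sym[OF ne[OF that]] by simp
    qed
    then have "fps_const (\<Prod>k\<in>K. (\<alpha> k * \<gamma> x - \<beta> k) * (1 / (\<gamma> x - \<gamma> k))) $ 0 =
        fps_const (C + (\<Sum>k\<in>K. R k * (1 / (\<gamma> x - \<gamma> k)))) $ 0"
      by (simp only: fps_const_mult fps_const_sub mult_1_left mult_1_right fps_const_1_eq_1[symmetric]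
          fps_const_prod[symmetric] fps_const_sum[symmetric] fps_const_add)
    then show ?thesis by simp
  qed
  have ux: "u x * (P - fps_const (\<gamma> x) * S) = 1" using insert.prems by simp
  have fac: "(fps_const (\<alpha> x) * P - fps_const (\<beta> x) * S) * u x = fps_const (\<alpha> x) + fps_const e * (S * u x)"
  proof -
    have "fps_const (\<alpha> x) * P - fps_const (\<beta> x) * S =
        fps_const (\<alpha> x) * (P - fps_const (\<gamma> x) * S) + fps_const e * S"
      by (simp add: e_def algebra_simps flip: fps_const_mult fps_const_sub)
    then show ?thesis using ux by algebra
  qed
  have pole: "fps_const (R k) * (S * u k) * (fps_const (\<alpha> x) + fps_const e * (S * u x)) =
     fps_const (R k * ((\<alpha> x * \<gamma> k - \<beta> x) / (\<gamma> k - \<gamma> x))) * (S * u k)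
     + fps_const (e * (R k / (\<gamma> x - \<gamma> k))) * (S * u x)" if k: "k \<in> K" for k
  proof -
    define d where "d = 1 / (\<gamma> k - \<gamma> x)"
    have d: "(\<gamma> k - \<gamma> x) * d = 1" using ne[OF k] by (simp add: d_def)
    have "(\<alpha> x * \<gamma> k - \<beta> x) / (\<gamma> k - \<gamma> x) = \<alpha> x + e * d" 
      using ne[OF k] by (simp add: d_def e_def field_simps)
    moreover have "R k / (\<gamma> x - \<gamma> k) = - (R k * d)"
      using ne[OF k] by (simp add: d_def divide_simps) (simp add: algebra_simps)
    moreover have "fps_const (R k) * (S * u k) * (fps_const (\<alpha> x) + fps_const e * (S * u x)) =
      fps_const (R k * (\<alpha> x + e * d)) * (S * u k) + fps_const (e * - (R k * d)) * (S * u x)"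
    proof -
      have uk: "u k * (P - fps_const (\<gamma> k) * S) = 1" using insert.prems k by simp
      \<comment> \<open>The equations defining \<open>u k\<close> and \<open>u x\<close> are
        combined in order to split the product of two simple poles into a difference.\<close>
      have "u k * u x * ((fps_const (\<gamma> k) - fps_const (\<gamma> x)) * S) = u k - u x"
        using ux uk by algebra
      moreover have "(fps_const (\<gamma> k) - fps_const (\<gamma> x)) * fps_const d = 1"
        using d by simp
      ultimately have "(S * u k) * (S * u x) = fps_const d * (S * u k) - fps_const d * (S * u x)"
        by algebra
      moreover have "fps_const (R k * (\<alpha> x + e * d)) = fps_const (R k) * (fps_const (\<alpha> x) + fps_const e * fps_const d)"
        "fps_const (e * - (R k * d)) = - (fps_const e * (fps_const (R k) * fps_const d))"
        by simp_all
      ultimately show ?thesis by algebra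
    qed
    ultimately show ?thesis by (simp only:)
  qed
  have "(\<Prod>k\<in>insert x K. (fps_const (\<alpha> k) * P - fps_const (\<beta> k) * S) * u k) =
     (fps_const C + (\<Sum>k\<in>K. fps_const (R k) * (S * u k))) * (fps_const (\<alpha> x) + fps_const e * (S * u x))"
    unfolding prod.insert[OF insert.hyps] IH fac by (rule mult.commute)
  also have "\<dots> = fps_const (C * \<alpha> x) + fps_const (e * C) * (S * u x)
     + (\<Sum>k\<in>K. fps_const (R k) * (S * u k) * (fps_const (\<alpha> x) + fps_const e * (S * u x)))"
    unfolding sum_distrib_right[symmetric] fps_const_mult[symmetric] by algebra
  also have "\<dots> = fps_const (C * \<alpha> x) + fps_const (e * C) * (S * u x)
     + (\<Sum>k\<in>K. fps_const (R k * ((\<alpha> x * \<gamma> k - \<beta> x) / (\<gamma> k - \<gamma> x))) * (S * u k)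
         + fps_const (e * (R k / (\<gamma> x - \<gamma> k))) * (S * u x))"
    using pole by (intro arg_cong2[where f = plus] sum.cong refl)
  also have "\<dots> = fps_const (C * \<alpha> x) + fps_const (e * (C + (\<Sum>k\<in>K. R k / (\<gamma> x - \<gamma> k)))) * (S * u x)
     + (\<Sum>k\<in>K. fps_const (R k * ((\<alpha> x * \<gamma> k - \<beta> x) / (\<gamma> k - \<gamma> x))) * (S * u k))"
    unfolding sum.distrib sum_distrib_right[symmetric] fps_const_sum[symmetric] sum_distrib_left[symmetric]
      distrib_left fps_const_add[symmetric] by algebra
  finally have eq: "(\<Prod>k\<in>insert x K. (fps_const (\<alpha> k) * P - fps_const (\<beta> k) * S) * u k) = \<dots>" .
  have "R k * ((\<alpha> x * \<gamma> k - \<beta> x) / (\<gamma> k - \<gamma> x)) = (\<alpha> k * \<gamma> k - \<beta> k) *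
      (\<Prod>k'\<in>insert x K - {k}. (\<alpha> k' * \<gamma> k - \<beta> k') / (\<gamma> k - \<gamma> k'))" if "k \<in> K" for k
  proof -
    have "insert x K - {k} = insert x (K - {k})" using that insert.hyps by auto
    then show ?thesis using insert.hyps by (simp add: R_def)
  qed
  moreover have "insert x K - {x} = K" using insert.hyps by auto
  ultimately show ?case
    unfolding eq val[symmetric] e_def using insert.hyps by (simp add: C_def mult.commute)
qed

context folding
begin

section \<open>The relations with \<open>\<phi>\<^sub>i\<^sup>\<plusminus>(z)\<close>\<close>

definition Phi :: "sign \<Rightarrow> int \<Rightarrow> int list \<Rightarrow> complex fps" where
  "Phi \<epsilon> i T = (\<Prod>k<l. bx i k (T ! k) (ser \<epsilon>) 1)"

text \<open>The structure function again, now for series and cross-multiplied so that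
  \<open>co_transfer\<close> turns it into a relation between modes. For equal indices both sides
  have the same denominator; in the adjacent cases a linear factor cancels against the denominator
  by \<open>ser_unit\<close>.\<close>

lemma bx_ratio:
  fixes i j and k :: nat
  assumes "mv \<epsilon>' j c"
  defines "Q \<equiv> qs \<epsilon>' powi cartan N i j" and "z \<equiv> ze \<epsilon>' k c"
  shows "(fps_const 1 * Pw \<epsilon> - fps_const (Q * z) * Sw \<epsilon>) * bx i k (nx \<epsilon>' c) (ser \<epsilon>) 1 =
    (fps_const Q * Pw \<epsilon> - fps_const z * Sw \<epsilon>) * bx i k c (ser \<epsilon>) 1"
proof -
  let ?q = "qs \<epsilon>'"
  consider (1) "eqN j i" | (2) "eqN j (i + sg \<epsilon>')" | (3) "eqN j (i - sg \<epsilon>')"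
    | (4) "\<not> eqN j i" "\<not> eqN j (i + sg \<epsilon>')" "\<not> eqN j (i - sg \<epsilon>')" by blast
  then show ?thesis
  proof cases
    case 1
    then have Q: "Q = ?q * ?q" by (simp add: Q_def qs_powi_cartan power2_eq_square)
    define p where "p = fps_const (1 / ?q)"
    have "fps_const ?q * Pw \<epsilon> - fps_const (z / ?q) * Sw \<epsilon> = p * (fps_const Q * Pw \<epsilon> - fps_const z * Sw \<epsilon>)"
      "fps_const (1 / ?q) * Pw \<epsilon> - fps_const (?q * z) * Sw \<epsilon> = p * (fps_const 1 * Pw \<epsilon> - fps_const (Q * z) * Sw \<epsilon>)"
      by (simp_all add: Q p_def right_diff_distrib mult.assoc[symmetric])
    then show ?thesis
      using 1 unfolding bx_before[OF assms(1)] bx_after[OF assms(1)] z_def[symmetric] ser_def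
      by (simp add: mult_ac)
  next
    case 2
    then have Q: "Q = 1 / ?q" "\<not> eqN j i" "\<not> eqN j (i - sg \<epsilon>')"
      using eqN_adjacent[OF 2] by (cases \<epsilon>'; simp add: Q_def qs_powi_cartan)+
    have nz: "z / ?q \<noteq> 0" by (simp add: z_def)
    show ?thesis
      using 2 Q(2,3) ser_unit[OF nz, of \<epsilon>]
      unfolding bx_before[OF assms(1)] bx_after[OF assms(1)] z_def[symmetric] ser_def Q(1)
      by (simp add: mult_ac)
  next
    case 3
    then have Q: "Q = 1 / ?q" "\<not> eqN j i" "\<not> eqN j (i + sg \<epsilon>')"
      using eqN_distinct(1-3)[of j i] by (cases \<epsilon>'; auto simp: Q_def qs_powi_cartan)+
    have nz: "?q * z \<noteq> 0" by (simp add: z_def)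
    define p where "p = fps_const (1 / ?q)"
    have *: "fps_const (1 / ?q) * Pw \<epsilon> - fps_const z * Sw \<epsilon> = p * (Pw \<epsilon> - fps_const (?q * z) * Sw \<epsilon>)"
      "fps_const 1 * Pw \<epsilon> - fps_const (1 / ?q * z) * Sw \<epsilon> = p * (fps_const ?q * Pw \<epsilon> - fps_const z * Sw \<epsilon>)"
      by (simp_all add: p_def right_diff_distrib mult.assoc[symmetric])
    show ?thesis
      using 3 Q(2,3) ser_unit[OF nz, of \<epsilon>]
      unfolding bx_before[OF assms(1)] bx_after[OF assms(1)] z_def[symmetric] ser_def Q(1) *
      by (simp add: mult_ac)
  next
    case 4
    then have "Q = 1"
      by (cases \<epsilon>') (auto simp: Q_def qs_powi_cartan)
    with 4 show ?thesis
      by (simp add: bx_before[OF assms(1)] bx_after[OF assms(1)])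
  qed
qed

lemma Phi_step:
  fixes i j
  assumes "mv \<epsilon>' j (T ! p)" "p < l" "length T = l"
  defines "Q \<equiv> qs \<epsilon>' powi cartan N i j" and "z \<equiv> ze \<epsilon>' p (T ! p)"
  shows "1 * co \<epsilon> (Phi \<epsilon> i (step \<epsilon>' p T)) m - (Q * z) * co \<epsilon> (Phi \<epsilon> i (step \<epsilon>' p T)) (m - 1) =
    Q * co \<epsilon> (Phi \<epsilon> i T) m - z * co \<epsilon> (Phi \<epsilon> i T) (m - 1)"
proof (rule co_transfer)
  define R where "R = (\<Prod>k\<in>{..<l} - {p}. bx i k (T ! k) (ser \<epsilon>) 1)"
  have 1: "Phi \<epsilon> i T = bx i p (T ! p) (ser \<epsilon>) 1 * R"
    unfolding Phi_def R_def by (rule prod.remove) (use assms in auto)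
  have "Phi \<epsilon> i (step \<epsilon>' p T) = bx i p (step \<epsilon>' p T ! p) (ser \<epsilon>) 1 *
      (\<Prod>k\<in>{..<l} - {p}. bx i k (step \<epsilon>' p T ! k) (ser \<epsilon>) 1)"
    unfolding Phi_def by (rule prod.remove) (use assms in auto)
  also have "\<dots> = bx i p (nx \<epsilon>' (T ! p)) (ser \<epsilon>) 1 * R"
    unfolding R_def using assms(2,3) by (simp add: nth_step)
  finally have 2: "Phi \<epsilon> i (step \<epsilon>' p T) = bx i p (nx \<epsilon>' (T ! p)) (ser \<epsilon>) 1 * R" .
  show "(fps_const 1 * Pw \<epsilon> - fps_const (Q * z) * Sw \<epsilon>) * Phi \<epsilon> i (step \<epsilon>' p T) =
      (fps_const Q * Pw \<epsilon> - fps_const z * Sw \<epsilon>) * Phi \<epsilon> i T"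
    unfolding 1 2 Q_def z_def mult.assoc[symmetric]
      bx_ratio[OF assms(1), where i = i and k = p and \<epsilon> = \<epsilon>] ..
qed

lemma Phi_X:
  fixes \<epsilon> i
  assumes "length T = l"
  defines "v \<equiv> Poly_Mapping.single T 1" and "D \<equiv> \<lambda>m. diag (\<lambda>T. co \<epsilon> (Phi \<epsilon> i T) m)"
  shows "D m (X \<epsilon>' j (r - 1) v) - cscale (qs \<epsilon>' powi cartan N i j) (D (m - 1) (X \<epsilon>' j r v)) =
    cscale (qs \<epsilon>' powi cartan N i j) (X \<epsilon>' j (r - 1) (D m v)) - X \<epsilon>' j r (D (m - 1) v)"
proof -
  let ?Q = "qs \<epsilon>' powi cartan N i j"
  let ?f = "\<lambda>T m. co \<epsilon> (Phi \<epsilon> i T) m"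
  let ?s = "\<lambda>p. Poly_Mapping.single (step \<epsilon>' p T) (1::complex)"
  have 1: "D m (X \<epsilon>' j s v) = (\<Sum>p<l. cscale (cz \<epsilon>' j s T p * ?f (step \<epsilon>' p T) m) (?s p))" for m s
    unfolding D_def v_def X_single by (simp add: lin_sum[OF lin_diag] lin_cscale[OF lin_diag] diag_single)
  have 2: "X \<epsilon>' j s (D m v) = (\<Sum>p<l. cscale (cz \<epsilon>' j s T p * ?f T m) (?s p))" for m s
    unfolding D_def v_def diag_single by (simp add: lin_cscale[OF lin_X] X_single vec.scale_sum_right mult.commute)
  have "cz \<epsilon>' j (r - 1) T p * ?f (step \<epsilon>' p T) m - ?Q * (cz \<epsilon>' j r T p * ?f (step \<epsilon>' p T) (m - 1)) =
     ?Q * (cz \<epsilon>' j (r - 1) T p * ?f T m) - cz \<epsilon>' j r T p * ?f T (m - 1)" if "p < l" for p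
  proof (cases "mv \<epsilon>' j (T ! p)")
    case True
    define z where "z = ze \<epsilon>' p (T ! p)"
    have "z \<noteq> 0" by (simp add: z_def)
    then have r: "z powi r = z * z powi (r - 1)"
      using power_int_add[of z 1 "r - 1"] by simp
    show ?thesis
      using arg_cong[OF Phi_step[OF True that assms(1), of \<epsilon> i m], of "\<lambda>x. cf \<epsilon>' j T p * z powi (r - 1) * x"]
      unfolding cz_def z_def[symmetric] r by (simp add: algebra_simps)
  next
    case False
    then show ?thesis by (simp add: cz_def cf_def)
  qed
  then show ?thesis
    unfolding 1 2 vec.scale_sum_right vec.scale_scale
      sum_subtractf[symmetric] vec.scale_left_diff_distrib[symmetric]
    by (intro sum.cong refl) simp
qed

text \<open>Because the two signs are twisted from opposite sides, each of the boxes affects the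
  move of the other if \<open>v < u\<close>, and neither does otherwise. In the first case the
  changes of the two eigenvalues compensate each other.\<close>

lemma mixed_coeff:
  assumes "u < l" "v < l" "u \<noteq> v" "length T = l"
  shows "cz Minus j r T v * cz Plus i m (step Minus v T) u = cz Plus i m T u * cz Minus j r (step Plus u T) v"
proof (cases "mv Plus i (T ! u) \<and> mv Minus j (T ! v)")
  case True
  define y1 y2 where "y1 = y u (T ! u)" "y2 = y v (T ! v)"
  have u: "mv Plus i (T ! u)" and v: "mv Minus j (T ! v)" using True by auto
  have "E j u (T ! u) (q * y2) * E i v (nx Minus (T ! v)) y1 = E i v (T ! v) y1 * E j u (nx Plus (T ! u)) (q * y2)"
  proof -
    consider (1) "eqN i j" | (2) "eqN i (j + 1)" | (3) "eqN i (j - 1)"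
      | (4) "\<not> eqN i j" "\<not> eqN i (j + 1)" "\<not> eqN i (j - 1)" by blast
    then show ?thesis
    proof cases
      case 1
      then have "eqN j i" using eqN_sym by blast
      have a: "(1 / q * (q * y2) - q * y1) / (q * y2 - y1) * ((1 / q * y1 - q * y2 * q) / (y1 - q * y2)) =
        (q * y1 - y2) / (y1 - q * y2) * ((q * (q * y2) - y1 / q) / (q * y2 - y1))"
        by (simp add: algebra_simps)
      show ?thesis
        using 1 \<open>eqN j i\<close> a
        by (simp add: E_before[OF u] E_before[OF v] E_after[OF u] E_after[OF v] qs_def ze_def mult_ac flip: y1_y2_def)
    next
      case 2
      have "eqN j (i - 1)" using 2 eqN_flip[of i j Plus] by simp
      \<comment> \<open>Numerator and denominator are scaled by one nonzero constant. Under
        \<open>x / 0 = 0\<close> this is valid for a zero denominator as well.\<close>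
      have a: "(q * y1 - q * y2) / (y1 - q * (q * y2)) = (y2 - y1) / (q * y2 - y1 / q)"
      proof -
        have "y2 - y1 = - (1 / q) * (q * y1 - q * y2)" "q * y2 - y1 / q = - (1 / q) * (y1 - q * (q * y2))"
          by (simp_all add: field_simps)
        then show ?thesis by (simp only: mult_divide_mult_cancel_left_if) simp
      qed
      show ?thesis
        using 2 \<open>eqN j (i - 1)\<close> a eqN_adjacent[of i j Plus]
        by (simp add: E_before[OF u] E_before[OF v] E_after[OF u] E_after[OF v] qs_def ze_def mult_ac flip: y1_y2_def)
    next
      case 3
      have "eqN j (i + 1)" using 3 eqN_flip[of j i Plus] by simp
      have a: "(q * (q * y2) - y1) / (q * y2 - q * y1) = (1 / q * y1 - q * y2) / (y1 - y2)"
      proof -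
        have "q * (q * y2) - y1 = - q * (1 / q * y1 - q * y2)" "q * y2 - q * y1 = - q * (y1 - y2)"
          by (simp_all add: field_simps)
        then show ?thesis by (simp only: mult_divide_mult_cancel_left_if) simp
      qed
      show ?thesis
        using 3 \<open>eqN j (i + 1)\<close> a eqN_adjacent[of j i Plus]
        by (simp add: E_before[OF u] E_before[OF v] E_after[OF u] E_after[OF v] qs_def ze_def mult_ac flip: y1_y2_def)
    next
      case 4
      then have "\<not> eqN j i" "\<not> eqN j (i + 1)" "\<not> eqN j (i - 1)"
        using eqN_sym[of i j] eqN_flip[of j i Plus] eqN_flip[of i j Plus] by simp_all
      then show ?thesis
        using 4 by (simp add: E_before[OF u] E_before[OF v] E_after[OF u] E_after[OF v])
    qed
  qed
  then have "cf Minus j T v * cf Plus i (step Minus v T) u = cf Plus i T u * cf Minus j (step Plus u T) v"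
    using assms True
    by (simp add: cf_split1[of u Minus j _ v] cf_split1[of v Plus i _ u] nth_step)
      (simp add: hh_def bef_def ze_def flip: y1_y2_def)
  then show ?thesis
    using assms by (simp add: cz_def nth_step)
next
  case False
  then show ?thesis
    using assms by (cases "mv Plus i (T ! u)") (simp_all add: cz_def cf_def nth_step)
qed

text \<open>By partial fractions both expansions have the same constant and the same residues, so
  their difference is a sum of delta functions by \<open>co_pole\<close>. The residue at the pole of
  a box is \<open>q - 1 / q\<close> up to sign, times that pole, times the values of
  \<open>\<phi>\<^sub>i\<close> on all other boxes, which \<open>W\<close> collects.\<close>

lemma Phi_difference:
  fixes i
  assumes "length T = l"
  defines "W \<equiv> \<lambda>p w. \<Prod>k\<in>{..<l} - {p}. E i k (T ! k) w"
  shows "co Plus (Phi Plus i T) M - co Minus (Phi Minus i T) M = (q - 1 / q) *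
    (\<Sum>p<l. of_bool (eqN (T ! p) i) * (W p (q * y p (T ! p)) * (q * y p (T ! p)) powi M)
       - of_bool (eqN (T ! p) (i + 1)) * (W p (y p (T ! p)) * y p (T ! p) powi M))"
proof -
  define K where "K = {k. k < l \<and> (eqN (T ! k) i \<or> eqN (T ! k) (i + 1))}"
  define \<alpha> where "\<alpha> k = (if eqN (T ! k) i then q else 1 / q)" for k
  define \<beta> where "\<beta> k = (if eqN (T ! k) i then y k (T ! k) else q * y k (T ! k))" for k
  define \<gamma> where "\<gamma> k = (if eqN (T ! k) i then q * y k (T ! k) else y k (T ! k))" for k
  have fin: "finite K" and sub: "K \<subseteq> {..<l}" by (auto simp: K_def)
  have \<gamma>0: "\<gamma> k \<noteq> 0" for k by (simp add: \<gamma>_def)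
  have inj: "inj_on \<gamma> K"
  proof (rule inj_onI, rule ccontr)
    fix k p assume k: "k \<in> K" and p: "p \<in> K" and eq: "\<gamma> k = \<gamma> p" and ne: "k \<noteq> p"
    \<comment> \<open>A box with entry congruent to \<open>i\<close> has the pole \<open>y k\<close>
      of the entry raised by one. So all poles come from entries in a single residue class, to which
      \<open>y_neq\<close> applies.\<close>
    have "\<exists>c. eqN c (i + 1) \<and> \<gamma> k = y k c" if "k \<in> K" for k
      using that
      by (intro exI[of _ "if eqN (T ! k) i then T ! k + 1 else T ! k"])
        (auto simp: K_def \<gamma>_def y_shift(2) eqN_shift)
    then obtain c d where "eqN c (i + 1)" "\<gamma> k = y k c" "eqN d (i + 1)" "\<gamma> p = y p d"
      using k p by blast
    moreover from this have "eqN c d" by (simp add: eqN_mod)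
    ultimately show False
      using y_neq[of c d k p] eq ne k p by (simp add: K_def)
  qed
  have bx: "bx i k (T ! k) f d = f (\<alpha> k) (\<beta> k) (\<gamma> k)" if "k \<in> K" for k and f :: "complex \<Rightarrow> complex \<Rightarrow> complex \<Rightarrow> 'x" and d
    using that by (auto simp: bx_def K_def \<alpha>_def \<beta>_def \<gamma>_def)
  have bx1: "bx i k (T ! k) f d = d" if "k \<in> {..<l} - K" for k and f :: "complex \<Rightarrow> complex \<Rightarrow> complex \<Rightarrow> 'x" and d
    using that by (simp add: bx_def K_def)
  have E1: "E i k (T ! k) w = 1" if "k \<in> {..<l} - K" for k w
    using that by (simp add: E_def bx_def K_def)
  define u where "u \<epsilon> k = inverse (Pw \<epsilon> - fps_const (\<gamma> k) * Sw \<epsilon>)" for \<epsilon> k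
  define R where "R k = (\<alpha> k * \<gamma> k - \<beta> k) * (\<Prod>k'\<in>K - {k}. (\<alpha> k' * \<gamma> k - \<beta> k') / (\<gamma> k - \<gamma> k'))" for k
  have Phi: "Phi \<epsilon> i T = fps_const (\<Prod>k\<in>K. \<alpha> k) * 1 + (\<Sum>k\<in>K. fps_const (R k) * (Sw \<epsilon> * u \<epsilon> k))" for \<epsilon>
  proof -
    have "Phi \<epsilon> i T = (\<Prod>k\<in>K. bx i k (T ! k) (ser \<epsilon>) 1)"
      unfolding Phi_def by (rule prod.mono_neutral_right) (use sub in \<open>simp_all add: bx1\<close>)
    also have "\<dots> = (\<Prod>k\<in>K. (fps_const (\<alpha> k) * Pw \<epsilon> - fps_const (\<beta> k) * Sw \<epsilon>) * u \<epsilon> k)"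
      by (rule prod.cong) (simp_all add: bx ser_def u_def)
    also have "\<dots> = fps_const (\<Prod>k\<in>K. \<alpha> k) + (\<Sum>k\<in>K. fps_const (R k) * (Sw \<epsilon> * u \<epsilon> k))"
      unfolding R_def by (rule partial_fractions[OF fin inj]) (simp add: u_def ser_unit[OF \<gamma>0])
    finally show ?thesis by simp
  qed
  have one: "co Plus 1 M = co Minus 1 M"
    by (auto simp: co_def)
  have "co Plus (Phi Plus i T) M - co Minus (Phi Minus i T) M =
      (\<Sum>k\<in>K. R k * (co Plus (Sw Plus * u Plus k) M - co Minus (Sw Minus * u Minus k) M))"
    unfolding Phi co_add co_const co_sum one by (simp add: sum_subtractf right_diff_distrib)
  also have "\<dots> = (\<Sum>k\<in>K. R k * \<gamma> k powi (M - 1))"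
    by (simp add: u_def co_pole[OF \<gamma>0])
  also have "\<dots> = (\<Sum>k\<in>K. (q - 1 / q) *
     (of_bool (eqN (T ! k) i) * (W k (q * y k (T ! k)) * (q * y k (T ! k)) powi M)
       - of_bool (eqN (T ! k) (i + 1)) * (W k (y k (T ! k)) * y k (T ! k) powi M)))"
  proof (rule sum.cong)
    fix k assume k: "k \<in> K"
    have "W k w = (\<Prod>k'\<in>K - {k}. E i k' (T ! k') w)" for w
      unfolding W_def by (rule prod.mono_neutral_right) (use sub E1 in auto)
    then have W: "W k (\<gamma> k) = (\<Prod>k'\<in>K - {k}. (\<alpha> k' * \<gamma> k - \<beta> k') / (\<gamma> k - \<gamma> k'))"
      by (simp add: E_def bx)
    have "\<alpha> k * \<gamma> k - \<beta> k = (if eqN (T ! k) i then q - 1 / q else - (q - 1 / q)) * \<gamma> k"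
      by (simp add: \<alpha>_def \<beta>_def \<gamma>_def algebra_simps)
    moreover have "\<gamma> k powi M = \<gamma> k * \<gamma> k powi (M - 1)"
      using power_int_add[of "\<gamma> k" 1 "M - 1"] \<gamma>0 by simp
    ultimately have "R k * \<gamma> k powi (M - 1) = (if eqN (T ! k) i then q - 1 / q else - (q - 1 / q)) * (W k (\<gamma> k) * \<gamma> k powi M)"
      unfolding R_def W by (simp only: mult_ac)
    then show "R k * \<gamma> k powi (M - 1) = (q - 1 / q) *
     (of_bool (eqN (T ! k) i) * (W k (q * y k (T ! k)) * (q * y k (T ! k)) powi M)
       - of_bool (eqN (T ! k) (i + 1)) * (W k (y k (T ! k)) * y k (T ! k) powi M))"
      using k eqN_distinct(1)[of "T ! k" i] by (cases "eqN (T ! k) i") (simp_all add: \<gamma>_def K_def del: minus_diff_eq)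
  qed simp
  also have "\<dots> = (q - 1 / q) * (\<Sum>k\<in>K. of_bool (eqN (T ! k) i) * (W k (q * y k (T ! k)) * (q * y k (T ! k)) powi M)
       - of_bool (eqN (T ! k) (i + 1)) * (W k (y k (T ! k)) * y k (T ! k) powi M))"
    by (simp only: sum_distrib_left)
  also have "(\<Sum>k\<in>K. of_bool (eqN (T ! k) i) * (W k (q * y k (T ! k)) * (q * y k (T ! k)) powi M)
       - of_bool (eqN (T ! k) (i + 1)) * (W k (y k (T ! k)) * y k (T ! k) powi M)) =
     (\<Sum>k<l. of_bool (eqN (T ! k) i) * (W k (q * y k (T ! k)) * (q * y k (T ! k)) powi M)
       - of_bool (eqN (T ! k) (i + 1)) * (W k (y k (T ! k)) * y k (T ! k) powi M))"
    by (rule sum.mono_neutral_left) (use sub in \<open>auto simp: K_def\<close>)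
  finally show ?thesis .
qed

text \<open>The move and its inverse take place at the same pole; one is twisted by the boxes on the
  left and the other by those on the right, and together these give the full product
  \<open>W\<close>.\<close>

lemma cf_inverse_moves:
  fixes i
  assumes "p < l" "length T = l"
  defines "W \<equiv> \<lambda>w. \<Prod>k\<in>{..<l} - {p}. E i k (T ! k) w"
  shows "cz Minus i r T p * cz Plus i m (step Minus p T) p =
      of_bool (eqN (T ! p) i) * (W (q * y p (T ! p)) * (q * y p (T ! p)) powi (m + r))"
    and "cz Plus i m T p * cz Minus i r (step Plus p T) p =
      of_bool (eqN (T ! p) (i + 1)) * (W (y p (T ! p)) * y p (T ! p) powi (m + r))"
proof -
  have W: "W w = rest Plus i p w {} T * rest Minus i p w {} T" for w
  proof -
    have "{..<l} - {p} = {k. k < l \<and> bef Plus k p} \<union> {k. k < l \<and> bef Minus k p}"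
      by (auto simp: bef_def)
    moreover have "{k. k < l \<and> bef Plus k p} \<inter> {k. k < l \<and> bef Minus k p} = {}"
      by (auto simp: bef_def)
    ultimately show ?thesis
      by (simp add: W_def rest_def prod.union_disjoint)
  qed
  have m: "eqN (T ! p + 1) (i + 1) = eqN (T ! p) i" "eqN (T ! p - 1) i = eqN (T ! p) (i + 1)"
    by (simp_all add: eqN_shift)
  have "y p (T ! p) * q = q * y p (T ! p)" by simp
  show "cz Minus i r T p * cz Plus i m (step Minus p T) p =
      of_bool (eqN (T ! p) i) * (W (q * y p (T ! p)) * (q * y p (T ! p)) powi (m + r))"
    using assms(1,2) m(1)
    by (simp add: cz_def cf_rest nth_step mv_def nx_def ze_def W y_shift power_int_add)
  show "cz Plus i m T p * cz Minus i r (step Plus p T) p =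
      of_bool (eqN (T ! p) (i + 1)) * (W (y p (T ! p)) * y p (T ! p) powi (m + r))"
    using assms(1,2) m(2)
    by (simp add: cz_def cf_rest nth_step mv_def nx_def ze_def W y_shift power_int_add)
qed

text \<open>Pairs of different boxes cancel by \<open>mixed_coeff\<close>. A single box moved back
  and forth restores \<open>T\<close>, and the sum of these terms is what
  \<open>Phi_difference\<close> computes. If \<open>i\<close> and \<open>j\<close> are incongruent,
  a box just moved by one generator cannot be moved by the other.\<close>

lemma mixed:
  assumes "length T = l" "eqN i j \<Longrightarrow> i = j"
  defines "v \<equiv> Poly_Mapping.single T 1"
  shows "X Plus i m (X Minus j r v) - X Minus j r (X Plus i m v) =
    (if i = j then cscale (1 / (q - 1 / q) * (co Plus (Phi Plus i T) (m + r) - co Minus (Phi Minus i T) (m + r))) v else 0)"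
proof -
  have inv: "step Plus p (step Minus p T) = T" if "p < l" for p
    using that assms(1) by (simp add: step_def nx_def)
  define D where "D u w = cz Minus j r T w * cz Plus i m (step Minus w T) u - cz Plus i m T u * cz Minus j r (step Plus u T) w" for u w
  have "X Minus j r (X Plus i m v) = (\<Sum>w<l. \<Sum>u<l. cscale (cz Plus i m T u * cz Minus j r (step Plus u T) w)
     (Poly_Mapping.single (step Plus u (step Minus w T)) 1))"
    unfolding v_def XX_single by (subst sum.swap) (simp add: step_commute[of Minus _ Plus])
  then have "X Plus i m (X Minus j r v) - X Minus j r (X Plus i m v) =
     (\<Sum>w<l. \<Sum>u<l. cscale (D u w) (Poly_Mapping.single (step Plus u (step Minus w T)) 1))"
    by (simp add: v_def XX_single D_def sum_subtractf vec.scale_left_diff_distrib)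
  also have "\<dots> = (\<Sum>w<l. cscale (D w w) v)"
  proof (rule sum.cong)
    fix w assume w: "w \<in> {..<l}"
    have "(\<Sum>u<l. cscale (D u w) (Poly_Mapping.single (step Plus u (step Minus w T)) 1)) =
        (\<Sum>u\<in>{w}. cscale (D u w) (Poly_Mapping.single (step Plus u (step Minus w T)) 1))"
      by (rule sum.mono_neutral_right) (use w mixed_coeff[OF _ _ _ assms(1)] in \<open>simp_all add: D_def\<close>)
    then show "(\<Sum>u<l. cscale (D u w) (Poly_Mapping.single (step Plus u (step Minus w T)) 1)) = cscale (D w w) v"
      using w by (simp add: inv v_def)
  qed simp
  also have "\<dots> = cscale (\<Sum>w<l. D w w) v"
    by (simp add: vec.scale_sum_left)
  finally have eq: "X Plus i m (X Minus j r v) - X Minus j r (X Plus i m v) = cscale (\<Sum>w<l. D w w) v" .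
  show ?thesis
  proof (cases "i = j")
    case True
    have "(\<Sum>w<l. D w w) = 1 / (q - 1 / q) * (co Plus (Phi Plus i T) (m + r) - co Minus (Phi Minus i T) (m + r))"
      unfolding Phi_difference[OF assms(1)] using q_sq assms(1)
      by (simp add: D_def True[symmetric] cf_inverse_moves)
    then show ?thesis
      using eq True by simp
  next
    case False
    then have "\<not> eqN i j" using assms(2) by blast
    moreover have "eqN (c - 1) j = eqN c (j + 1)" "eqN (j + 1) (i + 1) = eqN j i"
      "eqN (c + 1) (i + 1) = eqN c i" for c
      by (simp_all add: eqN_shift)
    ultimately have "\<not> eqN (c + 1) (i + 1) \<or> \<not> eqN c j" "\<not> eqN (c - 1) j \<or> \<not> eqN c (i + 1)" for c
      using eqN_sym[of i j] eqN_cong(1)[of c j i] eqN_cong(1)[of c "j + 1" "i + 1"] by blast+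
    then have "D w w = 0" if "w < l" for w
      using that assms(1) by (simp add: D_def cz_def cf_def nth_step mv_def nx_def)
    then show ?thesis
      using eq False by simp
  qed
qed


section \<open>The folded module\<close>

text \<open>A box with entry \<open>c\<close> has weight
  \<open>\<Lambda>_c - \<Lambda>_(c - 1)\<close>, with fundamental weights indexed modulo
  \<open>N\<close>.\<close>

definition wt :: "int list \<Rightarrow> (int \<Rightarrow>\<^sub>0 rat) \<Rightarrow> rat" where
  "wt T h = (\<Sum>k<l. Poly_Mapping.lookup h ((T ! k) mod int N) - Poly_Mapping.lookup h ((T ! k - 1) mod int N))"

definition folded_module :: "int list loop_module" where
  "folded_module =
    \<lparr> vspace = {v. Poly_Mapping.keys v \<subseteq> tableaux l},
      xgen = X,
      kgen = (\<lambda>h. diag (\<lambda>T. exp (t * of_rat (wt T h)))),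
      hgen = (\<lambda>i m. diag (\<lambda>T. of_int (sgn m) / (q - 1 / q) *
        fps_log (Phi (if m > 0 then Plus else Minus) i T) $ nat \<bar>m\<bar>)) \<rparr>"

lemma wt_zero: "wt T 0 = 0"
  and wt_add: "wt T (h + h') = wt T h + wt T h'"
  and wt_minus: "wt T (- h) = - wt T h"
  by (simp_all add: wt_def lookup_add sum.distrib[symmetric] sum_negf[symmetric] algebra_simps)

lemma idx_eq: "i \<in> idx N \<Longrightarrow> i = c mod int N \<longleftrightarrow> eqN c i"
  "i \<in> idx N \<Longrightarrow> c mod int N = i \<longleftrightarrow> eqN c i"
  by (auto simp: idx_def eqN_mod)

lemma wt_single:
  assumes "i \<in> idx N"
  shows "wt T (Poly_Mapping.single i s) =
    s * of_int (\<Sum>k<l. of_bool (eqN (T ! k) i) - of_bool (eqN (T ! k) (i + 1)))"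
proof -
  have "Poly_Mapping.lookup (Poly_Mapping.single i s) (c mod int N)
      - Poly_Mapping.lookup (Poly_Mapping.single i s) ((c - 1) mod int N) =
     s * (of_bool (eqN c i) - of_bool (eqN c (i + 1)))" for c
    using assms by (simp add: lookup_single when_def idx_eq(1) eqN_shift)
  then show ?thesis
    by (simp add: wt_def sum_distrib_left of_int_sum)
qed

lemma exp_rat_int: "exp (t * of_rat (of_int n)) = q powi n"
  by (simp add: exp_power_int mult.commute)

lemma fps_prod_nth_0: "prod f K $ 0 = (\<Prod>k\<in>K. f k $ (0::nat))"
  for f :: "'k \<Rightarrow> complex fps"
  by (induction K rule: infinite_finite_induct) simp_all

lemma powi_sum: "x \<noteq> 0 \<Longrightarrow> (\<Prod>k\<in>K. x powi f k) = x powi (\<Sum>k\<in>K. f k)"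
  for x :: complex
  by (induction K rule: infinite_finite_induct) (simp_all add: power_int_add)

lemma Phi_nth_0:
  assumes "i \<in> idx N"
  shows "Phi \<epsilon> i T $ 0 = exp (t * of_rat (wt T (Poly_Mapping.single i (of_int (sg \<epsilon>)))))"
proof -
  have "bx i k c (ser \<epsilon>) 1 $ 0 = q powi (sg \<epsilon> * (of_bool (eqN c i) - of_bool (eqN c (i + 1))))" for k c
    using eqN_distinct(1)[of c i] by (cases \<epsilon>) (auto simp: bx_def ser_nth_0 divide_inverse)
  then have "Phi \<epsilon> i T $ 0 = (\<Prod>k<l. q powi (sg \<epsilon> * (of_bool (eqN (T ! k) i) - of_bool (eqN (T ! k) (i + 1)))))"
    by (simp add: Phi_def fps_prod_nth_0)
  also have "\<dots> = q powi (\<Sum>k<l. sg \<epsilon> * (of_bool (eqN (T ! k) i) - of_bool (eqN (T ! k) (i + 1))))"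
    by (simp add: powi_sum)
  finally show ?thesis
    unfolding wt_single[OF assms] of_int_mult[symmetric] exp_rat_int sum_distrib_left .
qed

lemma phi_folded:
  assumes "i \<in> idx N"
  shows "phi t folded_module \<epsilon> i m = diag (\<lambda>T. co \<epsilon> (Phi \<epsilon> i T) m)"
  unfolding co_def
proof (rule phi_diag)
  show "kgen folded_module (Poly_Mapping.single i (of_int (sg \<epsilon>))) = diag (\<lambda>T. Phi \<epsilon> i T $ 0)"
    by (simp add: folded_module_def Phi_nth_0[OF assms])
  show "hgen folded_module i (sg \<epsilon> * int k) =
      diag (\<lambda>T. of_int (sg \<epsilon>) / (q - 1 / q) * fps_log (Phi \<epsilon> i T) $ k)" if "k > 0" for k
    using that by (cases \<epsilon>) (simp_all add: folded_module_def)
  show "q - 1 / q \<noteq> 0" by (rule q_sq)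
  show "Phi \<epsilon> i T $ 0 \<noteq> 0" for T by (simp add: Phi_nth_0[OF assms])
qed

lemma simple_root_eq:
  assumes "h \<in> cartan_alg N"
  shows "simple_root N j h = 2 * Poly_Mapping.lookup h (j mod int N)
    - Poly_Mapping.lookup h ((j + 1) mod int N) - Poly_Mapping.lookup h ((j - 1) mod int N)"
proof -
  let ?h = "Poly_Mapping.lookup h" and ?K = "Poly_Mapping.keys h"
  have *: "(\<Sum>i\<in>?K. ?h i * of_bool (i = x)) = ?h x" for x
    by (cases "x \<in> ?K") (simp_all add: if_distrib[of "(*) _"] of_bool_def sum.delta in_keys_iff cong: if_cong)
  have "?h i * of_int (cartan N i j) = 2 * (?h i * of_bool (i = j mod int N))
      - ?h i * of_bool (i = (j + 1) mod int N) - ?h i * of_bool (i = (j - 1) mod int N)" if "i \<in> ?K" for i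
  proof -
    have i: "i \<in> idx N" using assms that by (auto simp: cartan_alg_def)
    show ?thesis
      using eqN_distinct(1-3)[of j i] unfolding cartan_eqN idx_eq(1)[OF i]
      by (auto simp: eqN_shift)
  qed
  then show ?thesis
    unfolding simple_root_def
    by (simp add: sum_subtractf sum_distrib_left[symmetric] *)
qed

lemma wt_step:
  assumes "h \<in> cartan_alg N" "mv \<epsilon> j (T ! p)" "p < l" "length T = l"
  shows "wt (step \<epsilon> p T) h = wt T h + of_int (sg \<epsilon>) * simple_root N j h"
proof -
  define f where "f c = Poly_Mapping.lookup h (c mod int N) - Poly_Mapping.lookup h ((c - 1) mod int N)" for c
  have "wt T h = f (T ! p) + (\<Sum>k\<in>{..<l} - {p}. f (T ! k))"
    unfolding wt_def f_def[symmetric] by (rule sum.remove) (use assms(3) in simp_all)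
  moreover have "wt (step \<epsilon> p T) h = f (step \<epsilon> p T ! p) + (\<Sum>k\<in>{..<l} - {p}. f (step \<epsilon> p T ! k))"
    unfolding wt_def f_def[symmetric] by (rule sum.remove) (use assms(3) in simp_all)
  moreover have "(\<Sum>k\<in>{..<l} - {p}. f (step \<epsilon> p T ! k)) = (\<Sum>k\<in>{..<l} - {p}. f (T ! k))"
    using assms(3,4) by (simp add: nth_step)
  ultimately have "wt (step \<epsilon> p T) h = wt T h + (f (nx \<epsilon> (T ! p)) - f (T ! p))"
    using assms(3,4) by (simp add: nth_step)
  moreover have "f (nx \<epsilon> c) - f c = of_int (sg \<epsilon>) * simple_root N j h" if "mv \<epsilon> j c" for c
  proof (cases \<epsilon>)
    case Plus
    then have "c mod int N = (j + 1) mod int N" using that by (simp add: mv_def eqN_mod)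
    then have "(c - k) mod int N = (j + 1 - k) mod int N" for k
      by (metis mod_diff_left_eq)
    from this[of 0] this[of 1] this[of 2] show ?thesis
      using Plus by (simp add: f_def nx_def simple_root_eq[OF assms(1)])
  next
    case Minus
    then have "c mod int N = j mod int N" using that by (simp add: mv_def eqN_mod)
    then have "(c + k) mod int N = (j + k) mod int N" for k
      by (metis mod_add_left_eq)
    from this[of 0] this[of 1] this[of "-1"] show ?thesis
      using Minus by (simp add: f_def nx_def simple_root_eq[OF assms(1)])
  qed
  ultimately show ?thesis using assms(2) by simp
qed

text \<open>Only an entry that is an integer neighbour can destroy the strict order, and it stands
  at the next position in the direction of the twist. There the eigenvalue of
  \<open>\<phi>\<^sub>i\<close> has its zero exactly at the pole of the moved box. Entries merely
  congruent to that neighbour do not affect the order.\<close>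

lemma step_tableaux:
  assumes "T \<in> tableaux l" "p < l" "cf \<epsilon> i T p \<noteq> 0"
  shows "step \<epsilon> p T \<in> tableaux l"
proof -
  have len: "length T = l" and lt: "\<And>a b. a < b \<Longrightarrow> b < l \<Longrightarrow> T ! a < T ! b"
    using assms(1) by (auto simp: tableaux_def sorted_wrt_iff_nth_less)
  have mv: "mv \<epsilon> i (T ! p)" and nz: "\<And>k. k < l \<Longrightarrow> bef \<epsilon> k p \<Longrightarrow> E i k (T ! k) (ze \<epsilon> p (T ! p)) \<noteq> 0"
    using assms(3) by (auto simp: cf_def split: if_splits)
  have "sorted_wrt (<) (step \<epsilon> p T)"
  proof (cases \<epsilon>)
    case Plus
    have ne: "T ! a \<noteq> T ! p - 1" if "a < p" for a
    proof
      assume eq: "T ! a = T ! p - 1"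
      have "a = p - 1"
      proof (rule ccontr)
        assume "a \<noteq> p - 1"
        then have "a < p - 1" "p - 1 < l" "p - 1 < p" using that assms(2) by simp_all
        then show False using lt[of a "p - 1"] lt[of "p - 1" p] assms(2) eq by linarith
      qed
      then have "T ! p - 1 - 2 * int a = T ! p + 1 - 2 * int p" using that by simp
      then have "y a (T ! a) = q * y p (T ! p)"
        unfolding eq y_shift(2)[symmetric] by (simp only: y_def)
      moreover have "eqN (T ! a) i" using mv Plus by (simp add: eq mv_def eqN_shift)
      ultimately have "E i a (T ! a) (ze \<epsilon> p (T ! p)) = 0"
        using Plus by (simp add: E_def bx_def ze_def)
      then show False using nz[of a] that assms(2) Plus by (simp add: bef_def)
    qed
    show ?thesis
      unfolding sorted_wrt_iff_nth_less
    proof (intro allI impI)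
      fix a b assume "a < b" "b < length (step \<epsilon> p T)"
      then show "step \<epsilon> p T ! a < step \<epsilon> p T ! b"
        using lt[of a b] ne[of a] Plus assms(2) len by (auto simp: nth_step nx_def)
    qed
  next
    case Minus
    have ne: "T ! a \<noteq> T ! p + 1" if "p < a" "a < l" for a
    proof
      assume eq: "T ! a = T ! p + 1"
      have "a = Suc p"
      proof (rule ccontr)
        assume "a \<noteq> Suc p"
        then have "Suc p < a" "Suc p < l" using that by simp_all
        then show False using lt[of "Suc p" a] lt[of p "Suc p"] that eq by linarith
      qed
      then have "y a (T ! a) = y p (T ! p) / q"
        unfolding eq y_shift(1)[symmetric] by (simp add: y_def algebra_simps)
      moreover have "eqN (T ! a) (i + 1)" using mv Minus by (simp add: eq mv_def eqN_shift)
      ultimately have "E i a (T ! a) (ze \<epsilon> p (T ! p)) = 0"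
        using Minus eqN_distinct(1)[of "T ! a" i] by (auto simp: E_def bx_def ze_def)
      then show False using nz[of a] that Minus by (simp add: bef_def)
    qed
    show ?thesis
      unfolding sorted_wrt_iff_nth_less
    proof (intro allI impI)
      fix a b assume "a < b" "b < length (step \<epsilon> p T)"
      then show "step \<epsilon> p T ! a < step \<epsilon> p T ! b"
        using lt[of a b] ne[of b] Minus assms(2) len by (auto simp: nth_step nx_def)
    qed
  qed
  then show ?thesis
    using len by (simp add: tableaux_def)
qed

lemma keys_X:
  assumes "Poly_Mapping.keys v \<subseteq> tableaux l"
  shows "Poly_Mapping.keys (X \<epsilon> i r v) \<subseteq> tableaux l"
  unfolding X_def
proof (rule keys_linear_ext)
  fix T assume "T \<in> Poly_Mapping.keys v"
  then have T: "T \<in> tableaux l" using assms by blast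
  have "Poly_Mapping.keys (cscale (cz \<epsilon> i r T p) (Poly_Mapping.single (step \<epsilon> p T) 1)) \<subseteq> tableaux l"
    if "p < l" for p
  proof (cases "cf \<epsilon> i T p = 0")
    case True
    then show ?thesis by (simp add: cz_def)
  next
    case False
    then show ?thesis
      using step_tableaux[OF T that False] keys_cscale[of "cz \<epsilon> i r T p" "Poly_Mapping.single (step \<epsilon> p T) 1"]
      by auto
  qed
  then show "Poly_Mapping.keys (\<Sum>p<l. cscale (cz \<epsilon> i r T p) (Poly_Mapping.single (step \<epsilon> p T) 1)) \<subseteq> tableaux l"
    by (intro order.trans[OF keys_sum] UN_least) simp
qed

lemmas lin_X_comp = lin_compose[OF lin_X]
lemmas lin_diag_comp = lin_compose[OF lin_diag]

lemma diag_X: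
  "diag f (X \<epsilon> i r (Poly_Mapping.single T 1)) =
    (\<Sum>p<l. cscale (cz \<epsilon> i r T p * f (step \<epsilon> p T)) (Poly_Mapping.single (step \<epsilon> p T) 1))"
  by (simp add: X_single lin_sum[OF lin_diag] lin_cscale[OF lin_diag] diag_single)

lemma K_X:
  assumes "h \<in> cartan_alg N" "length T = l"
  defines "K \<equiv> \<lambda>h. diag (\<lambda>T. exp (t * of_rat (wt T h)))"
  shows "K h (X \<epsilon> j r (K (- h) (Poly_Mapping.single T 1))) =
    cscale (exp (t * of_rat (of_int (sg \<epsilon>) * simple_root N j h))) (X \<epsilon> j r (Poly_Mapping.single T 1))"
proof -
  have "K h (X \<epsilon> j r (K (- h) (Poly_Mapping.single T 1))) =
    (\<Sum>p<l. cscale (exp (t * of_rat (wt T (- h))) * (cz \<epsilon> j r T p * exp (t * of_rat (wt (step \<epsilon> p T) h))))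
      (Poly_Mapping.single (step \<epsilon> p T) 1))"
    unfolding K_def diag_single lin_cscale[OF lin_X] lin_cscale[OF lin_diag] diag_X vec.scale_sum_right
    by simp
  also have "\<dots> = (\<Sum>p<l. cscale (exp (t * of_rat (of_int (sg \<epsilon>) * simple_root N j h)) * cz \<epsilon> j r T p)
      (Poly_Mapping.single (step \<epsilon> p T) 1))"
  proof (intro sum.cong refl arg_cong2[where f = cscale])
    fix p assume p: "p \<in> {..<l}"
    show "exp (t * of_rat (wt T (- h))) * (cz \<epsilon> j r T p * exp (t * of_rat (wt (step \<epsilon> p T) h))) =
        exp (t * of_rat (of_int (sg \<epsilon>) * simple_root N j h)) * cz \<epsilon> j r T p"
    proof (cases "mv \<epsilon> j (T ! p)")
      case True
      then have "exp (t * of_rat (wt T (- h))) * exp (t * of_rat (wt (step \<epsilon> p T) h)) =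
          exp (t * of_rat (of_int (sg \<epsilon>) * simple_root N j h))"
        using wt_step[OF assms(1) True _ assms(2)] p
        by (simp add: exp_add[symmetric] wt_minus of_rat_add of_rat_minus distrib_left)
      then show ?thesis by (simp add: mult_ac flip: mult.assoc)
    next
      case False
      then show ?thesis by (simp add: cz_def cf_def)
    qed
  qed
  finally show ?thesis
    by (simp add: X_single vec.scale_sum_right)
qed

lemma representation: "loop_representation t N folded_module"
proof -
  define V :: "int list vec set" where "V = {v. Poly_Mapping.keys v \<subseteq> tableaux l}"
  define K where "K h = diag (\<lambda>T. exp (t * of_rat (wt T h)))" for h
  define D where "D \<epsilon> i m = diag (\<lambda>T. co \<epsilon> (Phi \<epsilon> i T) m)" for \<epsilon> i m
  have len: "length T = l" if "T \<in> tableaux l" for T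
    using that by (simp add: tableaux_def)
  have linK: "lin g \<Longrightarrow> lin (\<lambda>v. K h (g v))" and linD: "lin g \<Longrightarrow> lin (\<lambda>v. D \<epsilon> i m (g v))"
    for g :: "int list vec \<Rightarrow> int list vec" and h \<epsilon> i m
    unfolding K_def D_def by (rule lin_diag_comp, assumption)+
  note lin = lin_plus lin_diff lin_scale lin_0 lin_X_comp linK linD lin_id
  have P: "phi t folded_module \<epsilon> i m v = D \<epsilon> i m v" if "i \<in> idx N" for \<epsilon> i m v
    by (simp add: phi_folded[OF that] D_def)
  have gens: "vspace folded_module = V" "xgen folded_module = X" "kgen folded_module = K"
    by (simp_all add: folded_module_def V_def K_def[abs_def])
  have ext: "f v = g v" if "v \<in> V" "lin f" "lin g"
    "\<And>T. T \<in> tableaux l \<Longrightarrow> f (Poly_Mapping.single T 1) = g (Poly_Mapping.single T 1)" for f g :: "_ \<Rightarrow> int list vec" and v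
    by (rule lin_eqI[of f g "tableaux l" v]) (use that in \<open>auto simp: V_def\<close>)
  have endoX: "linear_endo V (X \<epsilon> i r)" for \<epsilon> i r
    unfolding V_def by (rule linear_endo_lin[OF lin_X keys_X])
  have endoD: "linear_endo V (diag f)" for f
    unfolding V_def by (rule linear_endo_lin[OF lin_diag order.trans[OF keys_diag]])
  have endoK: "linear_endo V (K h)" for h
    unfolding K_def by (rule endoD)
  have eqidx: "i = j" if "i \<in> idx N" "j \<in> idx N" "eqN i j" for i j
    using that by (simp add: idx_def eqN_mod)
  have c1: "vec.subspace V"
    unfolding V_def by (rule subspace_keys)
  have c4: "linear_endo V (hgen folded_module i m)" for i m
    by (simp add: folded_module_def endoD)
  have c5: "K 0 v = v" for v
    by (rule poly_mapping_eqI) (simp add: K_def wt_zero)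
  have c6: "K h (K h' v) = K (h + h') v" for h h' v
    by (rule poly_mapping_eqI) (simp add: K_def wt_add of_rat_add distrib_left exp_add)
  have c7: "K h (D \<epsilon> i m v) = D \<epsilon> i m (K h v)" for h \<epsilon> i m v
    by (rule poly_mapping_eqI) (simp add: K_def D_def)
  have c8: "D \<epsilon> i m (D \<epsilon>' j r v) = D \<epsilon>' j r (D \<epsilon> i m v)" for \<epsilon> \<epsilon>' i j m r v
    by (rule poly_mapping_eqI) (simp add: D_def)
  have c9: "K h (X \<epsilon> j r (K (- h) v)) =
      cscale (exp (t * of_rat (of_int (sg \<epsilon>) * simple_root N j h))) (X \<epsilon> j r v)"
    if "h \<in> cartan_alg N" "v \<in> V" for h \<epsilon> j r v
    by (rule ext[OF that(2)]) (intro lin | simp only: K_def K_X[OF that(1)] len)+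
  have c10: "D \<epsilon> i m (X \<epsilon>' j (r - 1) v) - cscale (q powi (sg \<epsilon>' * cartan N i j)) (D \<epsilon> i (m - 1) (X \<epsilon>' j r v)) =
      cscale (q powi (sg \<epsilon>' * cartan N i j)) (X \<epsilon>' j (r - 1) (D \<epsilon> i m v)) - X \<epsilon>' j r (D \<epsilon> i (m - 1) v)"
    if "v \<in> V" for \<epsilon> \<epsilon>' i j m r v
    unfolding qs_powi[symmetric]
    by (rule ext[OF that]) (intro lin | simp only: D_def Phi_X len)+
  have c11: "X Plus i m (X Minus j r v) - X Minus j r (X Plus i m v) =
      (if i = j then cscale (1 / (q - 1 / q)) (D Plus i (m + r) v - D Minus i (m + r) v) else 0)"
    if "v \<in> V" "i \<in> idx N" "j \<in> idx N" for i j m r v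
  proof (rule ext[OF that(1)])
    show "lin (\<lambda>v. if i = j then cscale (1 / (q - 1 / q)) (D Plus i (m + r) v - D Minus i (m + r) v) else 0)"
      by (cases "i = j"; simp only: simp_thms if_True if_False; intro lin)
    fix T assume "T \<in> tableaux l"
    then show "X Plus i m (X Minus j r (Poly_Mapping.single T 1)) - X Minus j r (X Plus i m (Poly_Mapping.single T 1)) =
      (if i = j then cscale (1 / (q - 1 / q)) (D Plus i (m + r) (Poly_Mapping.single T 1) - D Minus i (m + r) (Poly_Mapping.single T 1)) else 0)"
      by (subst mixed[OF len eqidx[OF that(2,3)]])
        (simp_all only: D_def diag_single vec.scale_left_diff_distrib[symmetric] vec.scale_scale)
  qed (intro lin)
  have c12: "X \<epsilon> i m (X \<epsilon> j (r - 1) v) - cscale (q powi (sg \<epsilon> * cartan N i j)) (X \<epsilon> i (m - 1) (X \<epsilon> j r v)) =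
      cscale (q powi (sg \<epsilon> * cartan N i j)) (X \<epsilon> j (r - 1) (X \<epsilon> i m v)) - X \<epsilon> j r (X \<epsilon> i (m - 1) v)"
    if "v \<in> V" for \<epsilon> i j m r v
    unfolding qs_powi[symmetric]
    by (rule ext[OF that]) (intro lin | simp only: quadratic len)+
  have c13: "(X \<epsilon> i m (X \<epsilon> i m' (X \<epsilon> j r v)) - cscale (q + 1 / q) (X \<epsilon> i m (X \<epsilon> j r (X \<epsilon> i m' v)))
     + X \<epsilon> j r (X \<epsilon> i m (X \<epsilon> i m' v))) +
    (X \<epsilon> i m' (X \<epsilon> i m (X \<epsilon> j r v)) - cscale (q + 1 / q) (X \<epsilon> i m' (X \<epsilon> j r (X \<epsilon> i m v)))
     + X \<epsilon> j r (X \<epsilon> i m' (X \<epsilon> i m v))) = 0"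
    if "v \<in> V" "cartan N i j = -1" for \<epsilon> i j m m' r v
    by (rule ext[OF that(1)]) (intro lin | simp only: serre[OF _ that(2)] len)+
  have c14: "X \<epsilon> i m (X \<epsilon> j r v) = X \<epsilon> j r (X \<epsilon> i m v)" if "v \<in> V" "cartan N i j = 0" for \<epsilon> i j m r v
    by (rule ext[OF that(1)]) (intro lin | simp only: X_commute[OF _ that(2)] len)+
  show ?thesis
    unfolding loop_representation_def Let_def serre_term_def gens
    by (intro conjI allI ballI impI; (simp only: P)?;
        (rule c1 endoX endoK c4 c5 c6 c7 c8 c9 c10 c11 c12 c13 c14; assumption))
qed

end

section \<open>Weight spaces\<close>

text \<open>Membership in \<open>W w\<close> means support in the fibre of \<open>\<nu>\<close> over
  \<open>w\<close>. The fibres are disjoint, so each component is the restriction of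
  \<open>v\<close> to its fibre, which gives existence and uniqueness.\<close>

lemma weight_decomposition:
  fixes \<nu> :: "'b \<Rightarrow> 'w" and v :: "'b vec"
  assumes W: "\<And>x w. w \<in> I \<Longrightarrow> x \<in> W w \<longleftrightarrow> Poly_Mapping.keys x \<subseteq> {T \<in> S. \<nu> T = w}"
    and v: "Poly_Mapping.keys v \<subseteq> S" and I: "\<And>T. T \<in> S \<Longrightarrow> \<nu> T \<in> I"
  shows "\<exists>!f. Poly_Mapping.keys f \<subseteq> I \<and> (\<forall>w\<in>Poly_Mapping.keys f. Poly_Mapping.lookup f w \<in> W w) \<and>
    v = (\<Sum>w\<in>Poly_Mapping.keys f. Poly_Mapping.lookup f w)"
proof -
  define pr where "pr w = diag (\<lambda>T. of_bool (\<nu> T = w)) v" for w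
  have keys_pr: "Poly_Mapping.keys (pr w) = {T \<in> Poly_Mapping.keys v. \<nu> T = w}" for w
    unfolding pr_def by (rule set_eqI) (auto simp add: in_keys_iff simp del: lookup_not_eq_zero_eq_in_keys)
  have pr0: "pr w \<noteq> 0 \<longleftrightarrow> w \<in> \<nu> ` Poly_Mapping.keys v" for w
    using keys_eq_empty[of "pr w"] unfolding keys_pr by blast
  have "finite {w. pr w \<noteq> 0}"
    unfolding pr0 by simp
  then have lookup: "Poly_Mapping.lookup (Abs_poly_mapping pr) = pr"
    by (rule Abs_poly_mapping_inverse[OF CollectI])
  have keys: "Poly_Mapping.keys (Abs_poly_mapping pr) = \<nu> ` Poly_Mapping.keys v"
    using pr0 by (simp add: keys.rep_eq lookup del: lookup_not_eq_zero_eq_in_keys)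
  show ?thesis
  proof (rule ex1I[of _ "Abs_poly_mapping pr"])
    have "v = (\<Sum>w\<in>\<nu> ` Poly_Mapping.keys v. pr w)"
    proof (rule poly_mapping_eqI)
      fix T
      show "Poly_Mapping.lookup v T = Poly_Mapping.lookup (\<Sum>w\<in>\<nu> ` Poly_Mapping.keys v. pr w) T"
      proof (cases "T \<in> Poly_Mapping.keys v")
        case True
        then show ?thesis
          by (simp add: Poly_Mapping.lookup_sum pr_def of_bool_def if_distrib[of "\<lambda>x. x * _"] cong: if_cong)
      next
        case False
        then have "Poly_Mapping.lookup v T = 0" by (simp add: in_keys_iff)
        then show ?thesis by (simp add: Poly_Mapping.lookup_sum pr_def)
      qed
    qed
    moreover have "pr w \<in> W w" if "w \<in> \<nu> ` Poly_Mapping.keys v" for w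
    proof -
      have "w \<in> I" using that v I by blast
      then show ?thesis using v by (auto simp: W keys_pr)
    qed
    ultimately show "Poly_Mapping.keys (Abs_poly_mapping pr) \<subseteq> I \<and>
        (\<forall>w\<in>Poly_Mapping.keys (Abs_poly_mapping pr). Poly_Mapping.lookup (Abs_poly_mapping pr) w \<in> W w) \<and>
        v = (\<Sum>w\<in>Poly_Mapping.keys (Abs_poly_mapping pr). Poly_Mapping.lookup (Abs_poly_mapping pr) w)"
      unfolding keys lookup using v I by blast
  next
    fix g
    assume g: "Poly_Mapping.keys g \<subseteq> I \<and> (\<forall>w\<in>Poly_Mapping.keys g. Poly_Mapping.lookup g w \<in> W w) \<and>
        v = (\<Sum>w\<in>Poly_Mapping.keys g. Poly_Mapping.lookup g w)"
    have zero: "Poly_Mapping.lookup (Poly_Mapping.lookup g w) T = 0" if "\<nu> T \<noteq> w" for w T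
    proof (cases "w \<in> Poly_Mapping.keys g")
      case True
      then have "Poly_Mapping.keys (Poly_Mapping.lookup g w) \<subseteq> {T \<in> S. \<nu> T = w}"
        using g W[of w] by blast
      then show ?thesis using that by (metis (mono_tags, lifting) in_keys_iff mem_Collect_eq subsetD)
    next
      case False
      then have "Poly_Mapping.lookup g w = 0" by (metis in_keys_iff)
      then show ?thesis by simp
    qed
    have v': "Poly_Mapping.lookup v T = Poly_Mapping.lookup (Poly_Mapping.lookup g (\<nu> T)) T" for T
    proof -
      have "Poly_Mapping.lookup v T = (\<Sum>w\<in>Poly_Mapping.keys g. Poly_Mapping.lookup (Poly_Mapping.lookup g w) T)"
        using g by (metis (no_types, lifting) Poly_Mapping.lookup_sum sum.cong)
      also have "\<dots> = (\<Sum>w\<in>Poly_Mapping.keys g \<inter> {\<nu> T}. Poly_Mapping.lookup (Poly_Mapping.lookup g w) T)"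
      proof (rule sum.mono_neutral_right)
        show "\<forall>w\<in>Poly_Mapping.keys g - Poly_Mapping.keys g \<inter> {\<nu> T}. Poly_Mapping.lookup (Poly_Mapping.lookup g w) T = 0"
          by (intro ballI zero) blast
      qed simp_all
      also have "\<dots> = Poly_Mapping.lookup (Poly_Mapping.lookup g (\<nu> T)) T"
      proof (cases "\<nu> T \<in> Poly_Mapping.keys g")
        case True
        then have "Poly_Mapping.keys g \<inter> {\<nu> T} = {\<nu> T}" by blast
        then show ?thesis by simp
      next
        case False
        then have "Poly_Mapping.lookup g (\<nu> T) = 0" "Poly_Mapping.keys g \<inter> {\<nu> T} = {}"
          by (metis in_keys_iff) (use False in blast)
        then show ?thesis by simp
      qed
      finally show ?thesis .
    qed
    show "g = Abs_poly_mapping pr"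
    proof (rule poly_mapping_eqI)
      fix w
      show "Poly_Mapping.lookup g w = Poly_Mapping.lookup (Abs_poly_mapping pr) w"
        unfolding lookup
      proof (rule poly_mapping_eqI)
        fix T
        show "Poly_Mapping.lookup (Poly_Mapping.lookup g w) T = Poly_Mapping.lookup (pr w) T"
          using zero[of T w] v'[of T] by (cases "\<nu> T = w") (simp_all add: pr_def)
      qed
    qed
  qed
qed

context folding
begin

definition nu :: "int list \<Rightarrow> int \<Rightarrow> int" where
  "nu T i = (if i \<in> idx N then \<Sum>k<l. of_bool (eqN (T ! k) i) - of_bool (eqN (T ! k) (i + 1)) else 0)"

text \<open>Distinct integers give distinct powers of \<open>q\<close>, so a vector of one weight is
  supported on tableaux of that weight. Integral weights vanish off \<open>idx N\<close>, as
  \<open>nu\<close> does, so agreement on \<open>idx N\<close> is equality.\<close>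

lemma weight_space_folded:
  assumes "w \<in> integral_weights N"
  shows "v \<in> weight_space t N folded_module w \<longleftrightarrow> Poly_Mapping.keys v \<subseteq> {T \<in> tableaux l. nu T = w}"
proof -
  have K: "kgen folded_module (coroot i) = diag (\<lambda>T. q powi nu T i)" if "i \<in> idx N" for i
    using wt_single[OF that, of _ 1] that
    by (simp add: folded_module_def coroot_def nu_def exp_rat_int[symmetric])
  have "diag (\<lambda>T. q powi nu T i) v = cscale (q powi w i) v \<longleftrightarrow> (\<forall>T\<in>Poly_Mapping.keys v. nu T i = w i)" for i
  proof
    assume eq: "diag (\<lambda>T. q powi nu T i) v = cscale (q powi w i) v"
    show "\<forall>T\<in>Poly_Mapping.keys v. nu T i = w i"
    proof
      fix T assume "T \<in> Poly_Mapping.keys v"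
      then have "Poly_Mapping.lookup v T \<noteq> 0" by (metis in_keys_iff)
      then show "nu T i = w i"
        using arg_cong[OF eq, of "\<lambda>x. Poly_Mapping.lookup x T"] q_powi_inj
        by (simp del: lookup_not_eq_zero_eq_in_keys)
    qed
  next
    assume eq: "\<forall>T\<in>Poly_Mapping.keys v. nu T i = w i"
    show "diag (\<lambda>T. q powi nu T i) v = cscale (q powi w i) v"
    proof (rule poly_mapping_eqI)
      fix T
      show "Poly_Mapping.lookup (diag (\<lambda>T. q powi nu T i) v) T = Poly_Mapping.lookup (cscale (q powi w i) v) T"
        using eq by (cases "T \<in> Poly_Mapping.keys v") (simp_all add: in_keys_iff)
    qed
  qed
  moreover have "nu T = w \<longleftrightarrow> (\<forall>i\<in>idx N. nu T i = w i)" for T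
    using assms by (auto simp: integral_weights_def nu_def fun_eq_iff)
  moreover have "vspace folded_module = {v. Poly_Mapping.keys v \<subseteq> tableaux l}"
    by (simp add: folded_module_def)
  ultimately show ?thesis
    by (auto simp: weight_space_def K)
qed

text \<open>A box moved by \<open>x_i\<close> cannot be moved by it again, so each application
  lowers the number of movable boxes, which is at most \<open>l\<close>.\<close>

lemma X_nilpotent:
  assumes "Poly_Mapping.keys v \<subseteq> tableaux l"
  shows "(X \<epsilon> i r ^^ Suc l) v = 0"
proof -
  define S where "S n = {T. length T = l \<and> card {k. k < l \<and> mv \<epsilon> i (T ! k)} < n}" for n
  have step: "Poly_Mapping.keys (X \<epsilon> i r v) \<subseteq> S n" if "Poly_Mapping.keys v \<subseteq> S (Suc n)" for v n
    unfolding X_def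
  proof (rule keys_linear_ext)
    fix T assume "T \<in> Poly_Mapping.keys v"
    then have T: "length T = l" "card {k. k < l \<and> mv \<epsilon> i (T ! k)} < Suc n"
      using that by (auto simp: S_def)
    have "Poly_Mapping.keys (cscale (cz \<epsilon> i r T p) (Poly_Mapping.single (step \<epsilon> p T) 1)) \<subseteq> S n" if p: "p < l" for p
    proof (cases "mv \<epsilon> i (T ! p)")
      case False
      then show ?thesis by (simp add: cz_def cf_def)
    next
      case True
      have "{k. k < l \<and> mv \<epsilon> i (step \<epsilon> p T ! k)} \<subset> {k. k < l \<and> mv \<epsilon> i (T ! k)}"
      proof (rule psubsetI)
        have "p \<notin> {k. k < l \<and> mv \<epsilon> i (step \<epsilon> p T ! k)}" "p \<in> {k. k < l \<and> mv \<epsilon> i (T ! k)}"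
          using p True not_mv_again(1)[OF True] T(1) by (simp_all add: nth_step)
        then show "{k. k < l \<and> mv \<epsilon> i (step \<epsilon> p T ! k)} \<noteq> {k. k < l \<and> mv \<epsilon> i (T ! k)}"
          by blast
        show "{k. k < l \<and> mv \<epsilon> i (step \<epsilon> p T ! k)} \<subseteq> {k. k < l \<and> mv \<epsilon> i (T ! k)}"
        proof
          fix k assume "k \<in> {k. k < l \<and> mv \<epsilon> i (step \<epsilon> p T ! k)}"
          then show "k \<in> {k. k < l \<and> mv \<epsilon> i (T ! k)}"
            using p True T(1) by (cases "k = p") (simp_all add: nth_step)
        qed
      qed
      then have "card {k. k < l \<and> mv \<epsilon> i (step \<epsilon> p T ! k)} < card {k. k < l \<and> mv \<epsilon> i (T ! k)}"
        by (intro psubset_card_mono) simp_all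
      then have "card {k. k < l \<and> mv \<epsilon> i (step \<epsilon> p T ! k)} < n"
        using T(2) by linarith
      then have "step \<epsilon> p T \<in> S n"
        using T(1) by (simp add: S_def)
      then show ?thesis
        using keys_cscale[of "cz \<epsilon> i r T p" "Poly_Mapping.single (step \<epsilon> p T) 1"] by auto
    qed
    then show "Poly_Mapping.keys (\<Sum>p<l. cscale (cz \<epsilon> i r T p) (Poly_Mapping.single (step \<epsilon> p T) 1)) \<subseteq> S n"
      by (intro order.trans[OF keys_sum] UN_least) simp
  qed
  have "Poly_Mapping.keys ((X \<epsilon> i r ^^ j) v) \<subseteq> S (Suc l - j)" if "j \<le> Suc l" for j
    using that
  proof (induction j)
    case 0
    have "card {k. k < l \<and> mv \<epsilon> i (T ! k)} \<le> l" for T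
      using card_mono[of "{..<l}" "{k. k < l \<and> mv \<epsilon> i (T ! k)}"] by auto
    then have "tableaux l \<subseteq> S (Suc l)"
      by (auto simp: S_def tableaux_def less_Suc_eq_le)
    then show ?case using assms by simp
  next
    case (Suc j)
    then show ?case
      using step[of "(X \<epsilon> i r ^^ j) v" "Suc l - Suc j"] by (simp add: Suc_diff_le)
  qed
  from this[of "Suc l"] have "Poly_Mapping.keys ((X \<epsilon> i r ^^ Suc l) v) = {}"
    by (simp add: S_def)
  then show ?thesis by (simp only: keys_eq_empty)
qed

lemma integrable_folded: "integrable t N folded_module"
  unfolding integrable_def
proof (intro conjI ballI allI)
  fix v assume "v \<in> vspace folded_module"
  then have v: "Poly_Mapping.keys v \<subseteq> tableaux l" by (simp add: folded_module_def)
  show "\<exists>!f. Poly_Mapping.keys f \<subseteq> integral_weights N \<and>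
       (\<forall>\<nu>\<in>Poly_Mapping.keys f. Poly_Mapping.lookup f \<nu> \<in> weight_space t N folded_module \<nu>) \<and>
       v = (\<Sum>\<nu>\<in>Poly_Mapping.keys f. Poly_Mapping.lookup f \<nu>)"
    by (rule weight_decomposition[OF weight_space_folded v]) (simp_all add: integral_weights_def nu_def)
  fix \<epsilon> i assume "i \<in> idx N"
  show "\<exists>k. (xgen folded_module \<epsilon> i 0 ^^ k) v = 0"
    using X_nilpotent[OF v, of \<epsilon> i 0] unfolding folded_module_def loop_module.simps by blast
qed

end

section \<open>\<open>\<ell>\<close>-weights\<close>

text \<open>Integer powers of a series obey the usual laws once its constant coefficient is nonzero.
  Writing the exponent as a difference of naturals avoids sign cases in
  \<open>fps_powi_add\<close>.\<close>

lemma fps_powi_diff: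
  fixes f :: "complex fps"
  assumes "f $ 0 \<noteq> 0"
  shows "f powi (int a - int b) = f ^ a * inverse f ^ b"
proof -
  have 1: "f * inverse f = 1" using assms by (simp add: inverse_mult_eq_1')
  then have pw: "f ^ k * inverse f ^ k = 1" for k
    by (simp add: power_mult_distrib[symmetric])
  show ?thesis
  proof (cases "b \<le> a")
    case True
    then obtain d where d: "a = d + b" using le_Suc_ex by (metis add.commute)
    then show ?thesis by (simp add: power_int_def power_add mult.assoc pw)
  next
    case False
    then obtain d where d: "b = a + Suc d" by (metis add_Suc_right less_imp_Suc_add not_le)
    then have "f powi (int a - int b) = inverse f ^ Suc d" by (simp add: power_int_def nat_add_distrib)
    moreover have "f ^ a * inverse f ^ b = (f ^ a * inverse f ^ a) * inverse f ^ Suc d"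
      by (simp only: d power_add mult.assoc)
    ultimately show ?thesis by (simp add: pw)
  qed
qed

lemma fps_powi_add:
  fixes f :: "complex fps"
  assumes "f $ 0 \<noteq> 0"
  shows "f powi (m + n) = f powi m * f powi n"
proof -
  obtain a b where m: "m = int a - int b" by (rule int_diff_cases)
  obtain c d where n: "n = int c - int d" by (rule int_diff_cases)
  have "m + n = int (a + c) - int (b + d)" by (simp add: m n)
  then show ?thesis
    by (simp only: m n fps_powi_diff[OF assms] power_add mult_ac)
qed

lemma psi_nth_0: "c \<noteq> 0 \<Longrightarrow> psi t \<epsilon> c $ 0 \<noteq> 0"
  by (simp add: psi_ser ser_nth_0)

lemma ell_weight_superset:
  assumes "finite B" "\<And>b. (i, b) \<in> Poly_Mapping.keys u \<Longrightarrow> b \<in> B"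
  shows "ell_weight t u \<epsilon> i = (\<Prod>b\<in>B. psi t \<epsilon> (b * exp t) powi Poly_Mapping.lookup u (i, b))"
  unfolding ell_weight_def
  by (rule prod.mono_neutral_left) (use assms in \<open>auto simp: in_keys_iff\<close>)

lemma keys_slice_finite: "finite {b. (i, b) \<in> Poly_Mapping.keys u}"
  by (rule finite_subset[of _ "snd ` Poly_Mapping.keys u"]) force+

lemma ell_weight_add:
  assumes "u \<in> monomials N" "v \<in> monomials N"
  shows "ell_weight t (u + v) \<epsilon> i = ell_weight t u \<epsilon> i * ell_weight t v \<epsilon> i"
proof -
  define B where "B = {b. (i, b) \<in> Poly_Mapping.keys u} \<union> {b. (i, b) \<in> Poly_Mapping.keys v}"
  have fin: "finite B" by (simp add: B_def keys_slice_finite)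
  have nz: "b \<noteq> 0" if "b \<in> B" for b
    using that assms by (auto simp: B_def monomials_def)
  have "ell_weight t w \<epsilon> i = (\<Prod>b\<in>B. psi t \<epsilon> (b * exp t) powi Poly_Mapping.lookup w (i, b))"
    if "w \<in> {u, v, u + v}" for w
    by (rule ell_weight_superset[OF fin]) (use that Poly_Mapping.keys_add[of u v] in \<open>auto simp: B_def\<close>)
  then show ?thesis
    using nz by (simp add: lookup_add prod.distrib[symmetric] fps_powi_add psi_nth_0 cong: prod.cong)
qed

lemma ell_weight_zero: "ell_weight t 0 \<epsilon> i = 1"
  by (simp add: ell_weight_def)

lemma monomials_add: "u \<in> monomials N \<Longrightarrow> v \<in> monomials N \<Longrightarrow> u + v \<in> monomials N"
  using Poly_Mapping.keys_add[of u v] by (auto simp: monomials_def)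

lemma monomials_uminus: "- u \<in> monomials N \<longleftrightarrow> u \<in> monomials N"
  by (simp add: monomials_def)

lemma monomials_sum: "(\<And>k. k \<in> K \<Longrightarrow> f k \<in> monomials N) \<Longrightarrow> sum f K \<in> monomials N"
  by (induction K rule: infinite_finite_induct) (simp_all add: monomials_add, simp_all add: monomials_def)

lemma ell_weight_sum:
  assumes "\<And>k. k \<in> K \<Longrightarrow> f k \<in> monomials N"
  shows "ell_weight t (sum f K) \<epsilon> i = (\<Prod>k\<in>K. ell_weight t (f k) \<epsilon> i)"
  using assms
proof (induction K rule: infinite_finite_induct)
  case (insert k K)
  then show ?case
    using ell_weight_add[of "f k" N "sum f K"] monomials_sum[of K f N] by simp
qed (simp_all add: ell_weight_zero)

lemma ell_weight_single:
  "ell_weight t (Poly_Mapping.single (j, b) c) \<epsilon> i = (if i = j then psi t \<epsilon> (b * exp t) powi c else 1)"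
proof -
  have "ell_weight t (Poly_Mapping.single (j, b) c) \<epsilon> i =
      (\<Prod>b'\<in>{b}. psi t \<epsilon> (b' * exp t) powi Poly_Mapping.lookup (Poly_Mapping.single (j, b) c) (i, b'))"
    by (rule ell_weight_superset) (auto split: if_splits)
  then show ?thesis by (simp add: lookup_single when_def)
qed

section \<open>Recovering a monomial from its \<ell>-weight by logarithmic derivatives\<close>

definition logd :: "complex fps \<Rightarrow> complex fps" where
  "logd f = fps_deriv f * inverse f"

lemma logd_mult:
  assumes "f $ 0 \<noteq> 0" "g $ 0 \<noteq> 0"
  shows "logd (f * g) = logd f + logd g"
proof -
  have "f * inverse f = 1" "g * inverse g = 1" "inverse (f * g) = inverse f * inverse g"
    using assms by (simp_all add: inverse_mult_eq_1' fps_inverse_mult)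
  then show ?thesis
    unfolding logd_def fps_deriv_mult by algebra
qed

lemma logd_one: "logd 1 = 0"
  by (simp add: logd_def)

lemma logd_inverse:
  assumes "f $ 0 \<noteq> 0"
  shows "logd (inverse f) = - logd f"
  using logd_mult[of f "inverse f"] assms
  by (simp add: inverse_mult_eq_1' logd_one eq_neg_iff_add_eq_0 add.commute)

lemma logd_power:
  assumes "f $ 0 \<noteq> 0"
  shows "logd (f ^ n) = of_nat n * logd f"
  using assms by (induction n) (simp_all add: logd_one logd_mult fps_power_zeroth algebra_simps)

lemma logd_powi:
  assumes "f $ 0 \<noteq> 0"
  shows "logd (f powi m) = of_int m * logd f"
  using assms logd_power[of f] logd_power[of "inverse f"]
  by (auto simp: power_int_def logd_inverse)

lemma powi_nth_0: "f $ 0 \<noteq> 0 \<Longrightarrow> (f powi m) $ 0 \<noteq> (0 :: complex)" for f :: "complex fps"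
  by (simp add: power_int_def fps_power_zeroth)

lemma logd_prod:
  assumes "\<And>k. k \<in> K \<Longrightarrow> f k $ 0 \<noteq> 0"
  shows "logd (prod f K) = (\<Sum>k\<in>K. logd (f k)) \<and> prod f K $ 0 \<noteq> 0"
  using assms by (induction K rule: infinite_finite_induct) (auto simp: logd_one logd_mult)

lemma logd_linear:
  assumes "a \<noteq> 0"
  shows "logd (fps_const a - fps_const b * fps_X) $ m = - ((b / a) ^ Suc m)"
proof -
  have eq: "fps_const a - fps_const b * fps_X = fps_const a * (1 - fps_const (b / a) * fps_X)"
    using assms by (simp add: right_diff_distrib mult.assoc[symmetric])
  have "logd (fps_const a - fps_const b * fps_X) = logd (1 - fps_const (b / a) * fps_X)"
    unfolding eq using assms by (subst logd_mult) (simp_all add: logd_def)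
  also have "\<dots> = fps_const (- (b / a)) * Abs_fps (\<lambda>n. (b / a) ^ n)"
    by (simp only: logd_def fps_inverse_geometric) (simp add: fps_deriv_mult)
  finally show ?thesis by simp
qed

text \<open>The parameter \<open>b\<close> enters only through its power \<open>b ^ Suc m\<close>,
  and the other factor is nonzero when \<open>exp t\<close> is not a root of unity. An \<ell>-weight
  thus encodes the power sums of its parameters, weighted by the exponents.\<close>

lemma logd_psi: "logd (psi t Plus (b * exp t)) $ m = b ^ Suc m * (exp t ^ Suc m - 1 / exp t ^ Suc m)"
proof -
  have eq: "logd (psi t Plus (b * exp t)) =
     logd (fps_const (exp t) - fps_const b * fps_X) - logd (fps_const 1 - fps_const (b * exp t) * fps_X)"
    by (simp add: logd_mult logd_inverse)
  show ?thesis
    unfolding eq fps_sub_nth logd_linear[OF exp_not_eq_zero] logd_linear[OF one_neq_zero]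
    by (simp add: power_divide power_mult_distrib right_diff_distrib)
qed

lemma power_sums_independent:
  fixes d :: "complex \<Rightarrow> complex"
  assumes "finite B" "0 \<notin> B" "\<And>m. (\<Sum>b\<in>B. d b * b ^ Suc m) = 0" "x \<in> B"
  shows "d x = 0"
proof -
  \<comment> \<open>A Vandermonde argument: \<open>p\<close> vanishes on \<open>B\<close> except at
    \<open>x\<close>. The factor \<open>[:0, 1:]\<close> removes the constant term, since only power
    sums with positive exponent are known to vanish.\<close>
  define p where "p = [:0, 1:] * (\<Prod>b\<in>B - {x}. [:- b, 1:])"
  have "(\<Sum>b\<in>B. d b * b ^ j) * coeff p j = 0" for j
  proof (cases j)
    case 0
    have "coeff p 0 = 0" by (simp add: p_def)
    then show ?thesis using 0 by simp
  next
    case (Suc m)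
    then show ?thesis using assms(3)[of m] by simp
  qed
  then have "0 = (\<Sum>j\<le>degree p. (\<Sum>b\<in>B. d b * b ^ j) * coeff p j)"
    by (simp only: sum.neutral_const)
  also have "\<dots> = (\<Sum>b\<in>B. d b * poly p b)"
    unfolding poly_altdef sum_distrib_left sum_distrib_right by (subst sum.swap) (simp add: mult_ac)
  also have "\<dots> = (\<Sum>b\<in>{x}. d b * poly p b)"
    by (rule sum.mono_neutral_right) (use assms in \<open>auto simp: p_def poly_prod\<close>)
  finally have "d x * poly p x = 0" by simp
  moreover have "poly p x \<noteq> 0"
    using assms(1,2,4) by (auto simp: p_def poly_prod)
  ultimately show ?thesis by simp
qed

text \<open>The quotient monomial \<open>d\<close> has \<ell>-weight 1. Taking the logarithmic
  derivative makes all power sums of its parameters, weighted by the exponents, vanish, so all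
  exponents are zero by \<open>power_sums_independent\<close>.\<close>

lemma ell_weight_inj:
  assumes root: "\<And>k::nat. k > 0 \<Longrightarrow> exp t ^ k \<noteq> 1"
    and u: "u \<in> monomials N" "v \<in> monomials N"
    and eq: "\<And>i. i \<in> idx N \<Longrightarrow> ell_weight t u Plus i = ell_weight t v Plus i"
  shows "u = v"
proof -
  define d where "d = u - v"
  have d: "d \<in> monomials N" and ud: "u = d + v"
    using monomials_add[of u N "- v"] u by (simp_all add: d_def monomials_uminus)
  have zero: "Poly_Mapping.lookup d (i, b) = 0" if i: "i \<in> idx N" for i b
  proof (rule ccontr)
    assume "Poly_Mapping.lookup d (i, b) \<noteq> 0"
    define B where "B = {b. (i, b) \<in> Poly_Mapping.keys d}"
    have b: "b \<in> B" using \<open>Poly_Mapping.lookup d (i, b) \<noteq> 0\<close> by (simp add: B_def in_keys_iff)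
    have B: "finite B" "0 \<notin> B" "\<And>b. b \<in> B \<Longrightarrow> b \<noteq> 0"
      using d by (auto simp: B_def keys_slice_finite monomials_def)
    have psi0: "psi t Plus (b * exp t) $ 0 \<noteq> 0" if "b \<in> B" for b
      using B(3)[OF that] by (intro psi_nth_0) simp
    have v0: "ell_weight t v Plus i $ 0 \<noteq> 0"
    proof -
      have "psi t Plus (b * exp t) powi m $ 0 \<noteq> 0" if "(i, b) \<in> Poly_Mapping.keys v" for b m
        using that u(2) by (intro powi_nth_0 psi_nth_0) (auto simp: monomials_def)
      then show ?thesis
        unfolding ell_weight_def using logd_prod by (metis (no_types, lifting) mem_Collect_eq)
    qed
    have "ell_weight t d Plus i * ell_weight t v Plus i = 1 * ell_weight t v Plus i"
      using eq[OF i] ell_weight_add[OF d u(2)] ud by simp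
    then have "ell_weight t d Plus i = 1"
      using v0 by (metis fps_zero_nth mult_cancel_right)
    then have "0 = logd (\<Prod>b\<in>B. psi t Plus (b * exp t) powi Poly_Mapping.lookup d (i, b))"
      by (simp add: ell_weight_def B_def logd_one)
    also have "\<dots> = (\<Sum>b\<in>B. of_int (Poly_Mapping.lookup d (i, b)) * logd (psi t Plus (b * exp t)))"
      using logd_prod[of B "\<lambda>b. psi t Plus (b * exp t) powi Poly_Mapping.lookup d (i, b)"] psi0
      by (simp add: logd_powi powi_nth_0)
    finally have sum: "(\<Sum>b\<in>B. of_int (Poly_Mapping.lookup d (i, b)) * logd (psi t Plus (b * exp t))) $ m = 0" for m
      by simp
    have of_int_nth: "(of_int z * f) $ m = of_int z * (f $ m)" for z and f :: "complex fps" and m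
      by (metis fps_mult_left_const_nth fps_of_int)
    have "(\<Sum>b\<in>B. of_int (Poly_Mapping.lookup d (i, b)) * b ^ Suc m) = 0" for m
    proof -
      have "exp t ^ Suc m - 1 / exp t ^ Suc m \<noteq> 0"
        using root[of "Suc m + Suc m"] by (simp add: power_add field_simps)
      moreover have "(\<Sum>b\<in>B. of_int (Poly_Mapping.lookup d (i, b)) * b ^ Suc m) * (exp t ^ Suc m - 1 / exp t ^ Suc m) = 0"
        using sum[of m] unfolding fps_sum_nth of_int_nth logd_psi sum_distrib_right by (simp only: mult.assoc)
      ultimately show ?thesis by simp
    qed
    then have "complex_of_int (Poly_Mapping.lookup d (i, b)) = 0"
      by (rule power_sums_independent[OF B(1,2) _ b, of "\<lambda>b. of_int (Poly_Mapping.lookup d (i, b))"])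
    then show False using \<open>Poly_Mapping.lookup d (i, b) \<noteq> 0\<close> by simp
  qed
  have "d = 0"
  proof (rule poly_mapping_eqI)
    fix x :: "int \<times> complex"
    show "Poly_Mapping.lookup d x = Poly_Mapping.lookup 0 x"
    proof (cases "x \<in> Poly_Mapping.keys d")
      case True
      then show ?thesis using zero[of "fst x" "snd x"] d by (auto simp: monomials_def)
    next
      case False
      then show ?thesis by (simp add: in_keys_iff)
    qed
  qed
  then show ?thesis by (simp add: ud)
qed

text \<open>For diagonal operators generalized eigenspaces are eigenspaces, hence spanned by basis
  vectors, and \<open>ell_weight_inj\<close> identifies the labels that occur. Formulated through
  \<open>\<phi>\<^sub>i\<close> alone, this covers the given and the folded module.\<close>

lemma q_char_diagonal:
  assumes root: "\<And>k::nat. k > 0 \<Longrightarrow> exp t ^ k \<noteq> 1"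
    and V: "vspace M = {v. Poly_Mapping.keys v \<subseteq> S}"
    and phi: "\<And>\<epsilon> i m. i \<in> idx N \<Longrightarrow> phi t M \<epsilon> i (sg \<epsilon> * int m) = diag (\<lambda>T. F \<epsilon> i T $ m)"
    and F: "\<And>\<epsilon> i T. i \<in> idx N \<Longrightarrow> T \<in> S \<Longrightarrow> F \<epsilon> i T = ell_weight t (mo T) \<epsilon> i"
    and mo: "\<And>T. T \<in> S \<Longrightarrow> mo T \<in> monomials N"
    and fin: "\<And>u. finite {T \<in> S. mo T = u}"
  shows "q_char t N M u = card {T \<in> S. mo T = u}" "fin_dim_ell_weight_spaces t N M"
proof -
  have sp: "ell_weight_space t N M u = {v. Poly_Mapping.keys v \<subseteq> {T \<in> S. mo T = u}}" if u: "u \<in> monomials N" for u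
  proof -
    have nil: "(\<exists>p. ((\<lambda>w. phi t M \<epsilon> i (sg \<epsilon> * int m) w - cscale c w) ^^ p) v = 0) \<longleftrightarrow>
       (\<forall>T\<in>Poly_Mapping.keys v. F \<epsilon> i T $ m = c)" if "i \<in> idx N" for \<epsilon> i m c v
    proof -
      have *: "(\<lambda>w. phi t M \<epsilon> i (sg \<epsilon> * int m) w - cscale c w) = diag (\<lambda>T. F \<epsilon> i T $ m - c)"
        by (rule ext) (simp add: phi[OF that] diag_minus_cscale)
      have "diag (\<lambda>T. (F \<epsilon> i T $ m - c) ^ p) v = 0 \<longleftrightarrow>
          (\<forall>T\<in>Poly_Mapping.keys v. (F \<epsilon> i T $ m - c) ^ p = 0)" for p
      proof -
        have "diag (\<lambda>T. (F \<epsilon> i T $ m - c) ^ p) v = 0 \<longleftrightarrow>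
            (\<forall>T. (F \<epsilon> i T $ m - c) ^ p * Poly_Mapping.lookup v T = 0)"
          by (metis (no_types, lifting) lookup_diag lookup_zero poly_mapping_eqI)
        then show ?thesis by (auto simp: in_keys_iff simp del: lookup_not_eq_zero_eq_in_keys)
      qed
      then show ?thesis
        unfolding * diag_funpow by (auto intro: exI[of _ 1])
    qed
    have "v \<in> ell_weight_space t N M u \<longleftrightarrow> Poly_Mapping.keys v \<subseteq> {T \<in> S. mo T = u}" for v
    proof -
      have "v \<in> ell_weight_space t N M u \<longleftrightarrow> Poly_Mapping.keys v \<subseteq> S \<and>
         (\<forall>T\<in>Poly_Mapping.keys v. \<forall>i\<in>idx N. \<forall>\<epsilon>. F \<epsilon> i T = ell_weight t u \<epsilon> i)"
        by (auto simp: ell_weight_space_def V nil fps_eq_iff)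
      also have "\<dots> \<longleftrightarrow> Poly_Mapping.keys v \<subseteq> {T \<in> S. mo T = u}"
        using F ell_weight_inj[OF root mo u] by (auto simp: subset_iff)
      finally show ?thesis .
    qed
    then show ?thesis by blast
  qed
  show "q_char t N M u = card {T \<in> S. mo T = u}"
  proof (cases "u \<in> monomials N")
    case True
    then show ?thesis by (simp add: q_char_def sp dim_keys_subspace fin)
  next
    case False
    then have "{T \<in> S. mo T = u} = {}" using mo by blast
    then show ?thesis using False by (simp only: q_char_def if_False card.empty)
  qed
  show "fin_dim_ell_weight_spaces t N M"
    unfolding fin_dim_ell_weight_spaces_def
  proof
    fix u assume "u \<in> monomials N"
    then show "\<exists>B. finite B \<and> ell_weight_space t N M u \<subseteq> vec.span B"
      using fin[of u] by (intro exI[of _ "(\<lambda>T. Poly_Mapping.single T 1) ` {T \<in> S. mo T = u}"])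
        (simp add: sp keys_subspace_eq_span)
  qed
qed

context folding
begin

section \<open>The monomials of the tableaux\<close>

text \<open>The product of boxes \<open>m_T\<close>, written additively and with indices reduced
  modulo \<open>N\<close>; the parameters of the positive and the negative variable of a box are
  \<open>y k c\<close> and \<open>q * y k c\<close>.\<close>

definition mono :: "int list \<Rightarrow> monomial" where
  "mono T = (\<Sum>k<l. Poly_Mapping.single ((T ! k) mod int N, y k (T ! k)) 1
     - Poly_Mapping.single ((T ! k - 1) mod int N, q * y k (T ! k)) 1)"

lemma idx_mod: "i mod int N \<in> idx N"
  by (simp add: idx_def)

lemma single_monomials: "i \<in> idx N \<Longrightarrow> b \<noteq> 0 \<Longrightarrow> Poly_Mapping.single (i, b) c \<in> monomials N"
  by (simp add: monomials_def)

lemma box_monomials: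
  "Poly_Mapping.single (c mod int N, y k c) 1 - Poly_Mapping.single ((c - 1) mod int N, q * y k c) 1 \<in> monomials N"
  unfolding diff_conv_add_uminus
  by (intro monomials_add single_monomials) (simp_all add: monomials_uminus single_monomials idx_mod)

lemma mono_monomials: "mono T \<in> monomials N"
  unfolding mono_def by (intro monomials_sum box_monomials)

lemma psi_q_inverse: "c \<noteq> 0 \<Longrightarrow> inverse (psi t \<epsilon> (c * q)) = ser \<epsilon> (1 / q) c (c / q)"
proof -
  assume "c \<noteq> 0"
  then have "psi t \<epsilon> (c * q) * ser \<epsilon> (1 / q) c (c / q) = 1"
    using ser_swap[of q "c * q" c \<epsilon>] by (simp add: psi_ser)
  then show ?thesis by (rule fps_inverse_unique)
qed

lemma ell_weight_mono:
  assumes "i \<in> idx N"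
  shows "ell_weight t (mono T) \<epsilon> i = Phi \<epsilon> i T"
proof -
  have "ell_weight t (Poly_Mapping.single (c mod int N, y k c) 1
      - Poly_Mapping.single ((c - 1) mod int N, q * y k c) 1) \<epsilon> i = bx i k c (ser \<epsilon>) 1" for k c
  proof -
    have "ell_weight t (Poly_Mapping.single (c mod int N, y k c) 1
        - Poly_Mapping.single ((c - 1) mod int N, q * y k c) 1) \<epsilon> i =
      ell_weight t (Poly_Mapping.single (c mod int N, y k c) 1) \<epsilon> i *
      ell_weight t (Poly_Mapping.single ((c - 1) mod int N, q * y k c) (- 1)) \<epsilon> i"
      unfolding diff_conv_add_uminus single_uminus[symmetric]
      by (rule ell_weight_add[where N = N]) (simp_all add: single_monomials idx_mod)
    also have "\<dots> = (if eqN c i then psi t \<epsilon> (y k c * q) else 1) *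
        (if eqN c (i + 1) then inverse (psi t \<epsilon> (q * y k c * q)) else 1)"
      using assms by (simp add: ell_weight_single idx_eq(1) eqN_shift)
    also have "\<dots> = bx i k c (ser \<epsilon>) 1"
      using eqN_distinct(1)[of c i] psi_q_inverse[of "q * y k c" \<epsilon>]
      by (auto simp: bx_def psi_ser mult.commute)
    finally show ?thesis .
  qed
  then show ?thesis
    unfolding mono_def Phi_def using ell_weight_sum[of "{..<l}" _ N] box_monomials by simp
qed

lemma lookup_mono:
  "Poly_Mapping.lookup (mono T) x = (\<Sum>k<l. of_bool (((T ! k) mod int N, y k (T ! k)) = x)
     - of_bool (((T ! k - 1) mod int N, q * y k (T ! k)) = x))"
  by (simp add: mono_def Poly_Mapping.lookup_sum lookup_minus lookup_single when_def of_bool_def eq_commute[of x])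

lemma y_eq: "A * q powi s = A * q powi s' \<longleftrightarrow> s = s'"
  using A by (simp add: q_powi_inj)

text \<open>The largest and the smallest of the exponents \<open>T ! k - 2 k\<close> cannot cancel, so they are determined
  up to finitely many possibilities by the monomial.\<close>

lemma finite_mono_fibre:
  assumes "l \<ge> 1"
  shows "finite {T. length T = l \<and> mono T = u}"
proof -
  define s where "s T k = T ! k - 2 * int k" for T :: "int list" and k
  have y: "y k (T ! k) = A * q powi s T k" "q * y k (T ! k) = A * q powi (s T k + 1)" for T k
    by (simp_all add: y_def s_def power_int_add mult_ac)
  define Z where "Z = {z. A * q powi z \<in> snd ` Poly_Mapping.keys u}"
  have finZ: "finite Z"
    unfolding Z_def by (rule finite_vimageI[unfolded vimage_def]) (use A in \<open>simp_all add: inj_def q_powi_inj\<close>)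
  have bounds: "Min Z \<le> s T k \<and> s T k \<le> Max Z" if T: "mono T = u" and k: "k < l" for T k
  proof
    have ne: "s T ` {..<l} \<noteq> {}" "finite (s T ` {..<l})" using assms by (auto simp: lessThan_empty_iff)
    obtain a where a: "a < l" "s T a = Min (s T ` {..<l})"
      using Min_in[OF ne(2,1)] by (metis imageE lessThan_iff)
    obtain b where b: "b < l" "s T b = Max (s T ` {..<l})"
      using Max_in[OF ne(2,1)] by (metis imageE lessThan_iff)
    have le: "s T a \<le> s T k" "s T k \<le> s T b" if "k < l" for k
      unfolding a b using ne(2) that by simp_all
    \<comment> \<open>Negative exponents of the monomial sit at parameters with index
      \<open>s T k + 1\<close>, which is above the minimum \<open>s T a\<close>. So the positive
      contribution at \<open>a\<close> survives; symmetrically the negative one at the maximum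
      \<open>b\<close> survives.\<close>
    have ne1: "q * y k (T ! k) \<noteq> y a (T ! a)" if "k \<in> {..<l}" for k
      unfolding y(2)[of k T] y(1)[of a T] y_eq using le(1)[of k] that by simp
    have ne2: "y k (T ! k) \<noteq> q * y b (T ! b)" if "k \<in> {..<l}" for k
      unfolding y(1)[of k T] y(2)[of b T] y_eq using le(2)[of k] that by simp
    have "Poly_Mapping.lookup u ((T ! a) mod int N, y a (T ! a)) > 0"
    proof -
      have "(\<Sum>k<l. of_bool (((T ! k) mod int N, y k (T ! k)) = ((T ! a) mod int N, y a (T ! a)))
         - of_bool (((T ! k - 1) mod int N, q * y k (T ! k)) = ((T ! a) mod int N, y a (T ! a))) :: int) =
        (\<Sum>k<l. of_bool (((T ! k) mod int N, y k (T ! k)) = ((T ! a) mod int N, y a (T ! a))))"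
      proof (rule sum.cong)
        fix k assume "k \<in> {..<l}"
        then show "of_bool (((T ! k) mod int N, y k (T ! k)) = ((T ! a) mod int N, y a (T ! a)))
         - of_bool (((T ! k - 1) mod int N, q * y k (T ! k)) = ((T ! a) mod int N, y a (T ! a))) =
          (of_bool (((T ! k) mod int N, y k (T ! k)) = ((T ! a) mod int N, y a (T ! a))) :: int)"
          using ne1 by simp
      qed simp
      also have "\<dots> > 0"
        by (rule sum_pos2[of _ a]) (use a in simp_all)
      finally show ?thesis by (simp add: T[symmetric] lookup_mono)
    qed
    then have "((T ! a) mod int N, y a (T ! a)) \<in> Poly_Mapping.keys u"
      by (simp add: in_keys_iff)
    then have "y a (T ! a) \<in> snd ` Poly_Mapping.keys u"
      by (rule image_eqI[rotated]) simp
    then have "s T a \<in> Z"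
      by (simp only: Z_def mem_Collect_eq y(1)[of a T])
    then have "Min Z \<le> s T a" using finZ by simp
    then show "Min Z \<le> s T k" using le(1)[OF k] by simp
    have "Poly_Mapping.lookup u ((T ! b - 1) mod int N, q * y b (T ! b)) < 0"
    proof -
      have "(\<Sum>k<l. of_bool (((T ! k) mod int N, y k (T ! k)) = ((T ! b - 1) mod int N, q * y b (T ! b)))
         - of_bool (((T ! k - 1) mod int N, q * y k (T ! k)) = ((T ! b - 1) mod int N, q * y b (T ! b))) :: int) =
        - (\<Sum>k<l. of_bool (((T ! k - 1) mod int N, q * y k (T ! k)) = ((T ! b - 1) mod int N, q * y b (T ! b))))"
        unfolding sum_negf[symmetric]
      proof (rule sum.cong)
        fix k assume "k \<in> {..<l}"
        then show "of_bool (((T ! k) mod int N, y k (T ! k)) = ((T ! b - 1) mod int N, q * y b (T ! b)))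
         - of_bool (((T ! k - 1) mod int N, q * y k (T ! k)) = ((T ! b - 1) mod int N, q * y b (T ! b))) =
          - (of_bool (((T ! k - 1) mod int N, q * y k (T ! k)) = ((T ! b - 1) mod int N, q * y b (T ! b))) :: int)"
          using ne2 by simp
      qed simp
      moreover have "(\<Sum>k<l. of_bool (((T ! k - 1) mod int N, q * y k (T ! k)) = ((T ! b - 1) mod int N, q * y b (T ! b))) :: int) > 0"
        by (rule sum_pos2[of _ b]) (use b in simp_all)
      ultimately show ?thesis by (simp add: T[symmetric] lookup_mono)
    qed
    then have "((T ! b - 1) mod int N, q * y b (T ! b)) \<in> Poly_Mapping.keys u"
      by (simp add: in_keys_iff)
    then have "q * y b (T ! b) \<in> snd ` Poly_Mapping.keys u"
      by (rule image_eqI[rotated]) simp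
    then have "s T b + 1 \<in> Z"
      by (simp only: Z_def mem_Collect_eq y(2)[of b T])
    then have "s T b + 1 \<le> Max Z" using finZ by simp
    then show "s T k \<le> Max Z" using le(2)[OF k] by simp
  qed
  have "{T. length T = l \<and> mono T = u} \<subseteq> {T. set T \<subseteq> {Min Z..Max Z + 2 * int l} \<and> length T = l}"
  proof (intro subsetI CollectI conjI)
    fix T x assume T: "T \<in> {T. length T = l \<and> mono T = u}" and "x \<in> set T"
    then obtain k where k: "k < l" "x = T ! k" by (auto simp: in_set_conv_nth)
    then show "x \<in> {Min Z..Max Z + 2 * int l}"
      using bounds[of T k] T by (simp add: s_def)
  qed simp
  then show ?thesis
    by (rule finite_subset) (rule finite_lists_length_eq, simp)
qed

lemma q_char_folded:
  assumes "l \<ge> 1"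
  shows "q_char t N folded_module u = card {T \<in> tableaux l. mono T = u}"
    and "fin_dim_ell_weight_spaces t N folded_module"
proof -
  have fin: "finite {T \<in> tableaux l. mono T = u}" for u
    by (rule finite_subset[OF _ finite_mono_fibre[OF assms, of u]]) (auto simp: tableaux_def)
  have V: "vspace folded_module = {v. Poly_Mapping.keys v \<subseteq> tableaux l}"
    by (simp add: folded_module_def)
  have phi: "phi t folded_module \<epsilon> i (sg \<epsilon> * int m) = diag (\<lambda>T. Phi \<epsilon> i T $ m)" if "i \<in> idx N" for \<epsilon> i m
    unfolding phi_folded[OF that] by (cases \<epsilon>) (simp_all add: co_def)
  note * = q_char_diagonal[OF root V phi ell_weight_mono[symmetric] mono_monomials fin]
  show "q_char t N folded_module u = card {T \<in> tableaux l. mono T = u}"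
    "fin_dim_ell_weight_spaces t N folded_module"
    by (rule *; assumption)+
qed

end

section \<open>The extremal fundamental loop weight module\<close>

lemma fund_phi_nth_0:
  assumes a: "a \<noteq> 0"
  shows "fund_phi t l a \<epsilon> i T $ 0 = exp (t * of_rat (fund_weight T (Poly_Mapping.single i (of_int (sg \<epsilon>)))))"
proof -
  have "psi t \<epsilon> c $ 0 = (if \<epsilon> = Plus then exp t else inverse (exp t))" if "c \<noteq> 0" for c
    using that by (simp add: psi_ser ser_nth_0 field_simps)
  then show ?thesis
    using a by (cases \<epsilon>) (auto simp: fund_phi_def fund_weight_def exp_minus of_rat_minus simp del: psi.simps)
qed

lemma phi_fund:
  assumes "a \<noteq> 0" "exp t - 1 / exp t \<noteq> 0"
  shows "phi t (fund_module t l a) \<epsilon> i (sg \<epsilon> * int m) = diag (\<lambda>T. fund_phi t l a \<epsilon> i T $ m)"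
proof -
  have "phi t (fund_module t l a) \<epsilon> i (sg \<epsilon> * int m) =
      diag (\<lambda>T. if sg \<epsilon> * (sg \<epsilon> * int m) < 0 then 0 else fund_phi t l a \<epsilon> i T $ nat \<bar>sg \<epsilon> * int m\<bar>)"
  proof (rule phi_diag)
    show "kgen (fund_module t l a) (Poly_Mapping.single i (of_int (sg \<epsilon>))) = diag (\<lambda>T. fund_phi t l a \<epsilon> i T $ 0)"
      by (simp add: fund_module_def diag_def fund_phi_nth_0[OF assms(1)])
    show "hgen (fund_module t l a) i (sg \<epsilon> * int k) =
      diag (\<lambda>T. of_int (sg \<epsilon>) / (exp t - 1 / exp t) * fps_log (fund_phi t l a \<epsilon> i T) $ k)" if "k > 0" for k
      using that by (cases \<epsilon>) (simp_all add: fund_module_def fund_h_def diag_def)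
  qed (use assms(2) in \<open>simp_all add: fund_phi_nth_0[OF assms(1)]\<close>)
  then show ?thesis by (cases \<epsilon>) simp_all
qed

lemma position_nth:
  assumes "T \<in> tableaux l" "k < l"
  shows "position (T ! k) T = Suc k"
  unfolding position_def
proof (rule the_equality)
  show "Suc k \<in> {1..length T} \<and> T ! (Suc k - 1) = T ! k"
    using assms by (simp add: tableaux_def)
  fix p assume "p \<in> {1..length T} \<and> T ! (p - 1) = T ! k"
  moreover have "distinct T"
    using assms(1) strict_sorted_iff by (auto simp: tableaux_def)
  ultimately have "p - 1 = k"
    using assms by (auto simp: tableaux_def nth_eq_iff_index_eq)
  then show "p = Suc k" using \<open>p \<in> _ \<and> _\<close> by auto
qed

text \<open>At \<open>N = 0\<close> only the entries \<open>i\<close> and \<open>i + 1\<close>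
  contribute to the product. If both occur they stand at consecutive positions and their eigenvalues
  are inverse to each other, which is the default value 1 of \<open>fund_phi\<close>.\<close>

lemma fund_phi_Phi:
  assumes F: "folding t (a * exp t powi (int l - 2)) 0 l" and T: "T \<in> tableaux l"
  shows "fund_phi t l a \<epsilon> i T = folding.Phi t (a * exp t powi (int l - 2)) 0 l \<epsilon> i T"
proof -
  interpret folding t "a * exp t powi (int l - 2)" 0 l by (rule F)
  have eqN: "eqN i j \<longleftrightarrow> i = j" for i j
    by (simp add: eqN_def)
  have lt: "\<And>a b. a < b \<Longrightarrow> b < l \<Longrightarrow> T ! a < T ! b" and len: "length T = l"
    using T by (auto simp: tableaux_def sorted_wrt_iff_nth_less)
  have inj: "T ! k = T ! k' \<Longrightarrow> k < l \<Longrightarrow> k' < l \<Longrightarrow> k = k'" for k k'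
    using lt[of k k'] lt[of k' k] by (metis less_irrefl linorder_neqE_nat)
  have yk: "q * y k c = a * exp t powi (c + int l + 1 - 2 * int (Suc k))" for k c
  proof -
    have "q * (q powi x * q powi z) = q powi (1 + x + z)" for x z
      by (simp add: power_int_add)
    then have "q * (q powi (int l - 2) * q powi (c - 2 * int k)) = q powi (1 + (int l - 2) + (c - 2 * int k))" .
    also have "1 + (int l - 2) + (c - 2 * int k) = c + int l + 1 - 2 * int (Suc k)" by simp
    finally show ?thesis by (simp add: y_def mult_ac)
  qed
  define g where "g k = bx i k (T ! k) (ser \<epsilon>) 1" for k
  have g1: "g k = 1" if "T ! k \<noteq> i" "T ! k \<noteq> i + 1" for k
    using that by (simp add: g_def bx_def eqN)
  have Phi: "Phi \<epsilon> i T = prod g {..<l}" by (simp add: Phi_def g_def)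
  have Phi_sub: "Phi \<epsilon> i T = prod g K" if "K \<subseteq> {..<l}" "\<And>k. k < l \<Longrightarrow> T ! k \<in> {i, i + 1} \<Longrightarrow> k \<in> K" for K
    unfolding Phi by (rule prod.mono_neutral_right) (use that g1 in auto)
  have gi: "g k = psi t \<epsilon> (q * y k i)" if "T ! k = i" for k
    using that by (simp add: g_def bx_def eqN psi_ser)
  have gi1: "g k = ser \<epsilon> (1 / q) (q * y k (i + 1)) (y k (i + 1))" if "T ! k = i + 1" for k
    using that by (simp add: g_def bx_def eqN)
  have in_set: "x \<in> set T \<longleftrightarrow> (\<exists>k<l. T ! k = x)" for x
    using len by (auto simp: in_set_conv_nth)
  show ?thesis
  proof (cases "i \<in> set T"; cases "i + 1 \<in> set T")
    assume "i \<in> set T" "i + 1 \<in> set T"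
    then obtain k k' where k: "k < l" "T ! k = i" "k' < l" "T ! k' = i + 1" by (auto simp: in_set)
    have "k < k'" using lt[of k' k] k by (metis linorder_neqE_nat less_asym' zless_add1_eq)
    have "k' = Suc k"
    proof (rule ccontr)
      assume "k' \<noteq> Suc k"
      then show False using lt[of k "Suc k"] lt[of "Suc k" k'] \<open>k < k'\<close> k by linarith
    qed
    have "Phi \<epsilon> i T = prod g {k, k'}"
      by (rule Phi_sub) (use k inj in auto)
    also have "\<dots> = psi t \<epsilon> (q * y k i) * ser \<epsilon> (1 / q) (q * y k' (i + 1)) (y k' (i + 1))"
      using \<open>k < k'\<close> k by (simp add: gi gi1)
    also have "y k' (i + 1) = y k i / q"
    proof -
      have "i + 1 - 2 * int k' = i - 1 - 2 * int k" using \<open>k' = Suc k\<close> by simp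
      then show ?thesis unfolding y_shift(1)[symmetric] by (simp only: y_def)
    qed
    also have "psi t \<epsilon> (q * y k i) * ser \<epsilon> (1 / q) (q * (y k i / q)) (y k i / q) = 1"
      using ser_swap[of q "q * y k i" "y k i" \<epsilon>] by (simp add: psi_ser)
    finally show ?thesis
      using \<open>i \<in> set T\<close> \<open>i + 1 \<in> set T\<close> by (simp add: fund_phi_def)
  next
    assume i: "i \<in> set T" "i + 1 \<notin> set T"
    then obtain k where k: "k < l" "T ! k = i" by (auto simp: in_set)
    have "Phi \<epsilon> i T = prod g {k}"
      by (rule Phi_sub) (use k inj i in_set in auto)
    then show ?thesis
      using i k position_nth[OF T, of k] by (simp add: fund_phi_def gi yk)
  next
    assume i: "i \<notin> set T" "i + 1 \<in> set T"
    then obtain k where k: "k < l" "T ! k = i + 1" by (auto simp: in_set)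
    have "Phi \<epsilon> i T = prod g {k}"
      by (rule Phi_sub) (use k inj i in_set in auto)
    also have "\<dots> = inverse (psi t \<epsilon> (q * y k (i + 1) * q))"
      using k psi_q_inverse[of "q * y k (i + 1)" \<epsilon>] by (simp add: gi1)
    also have "q * y k (i + 1) * q = a * exp t powi (i + int l + 3 - 2 * int (Suc k))"
    proof -
      have "q * y k (i + 1) * q = q * y k (i + 1 + 1)" by (simp only: y_shift(2) mult_ac)
      also have "\<dots> = a * exp t powi (i + 1 + 1 + int l + 1 - 2 * int (Suc k))" by (rule yk)
      also have "i + 1 + 1 + int l + 1 - 2 * int (Suc k) = i + int l + 3 - 2 * int (Suc k)" by simp
      finally show ?thesis .
    qed
    finally show ?thesis
      using i k position_nth[OF T, of k] by (simp add: fund_phi_def)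
  next
    assume i: "i \<notin> set T" "i + 1 \<notin> set T"
    have "Phi \<epsilon> i T = prod g {}"
      by (rule Phi_sub) (use i in_set in auto)
    then show ?thesis using i by (simp add: fund_phi_def)
  qed
qed

text \<open>The given module is compared with the monomials at \<open>N = 0\<close> through the
  eigenvalues of \<open>\<phi>\<^sub>i\<close>, using \<open>fund_phi_Phi\<close>.\<close>

lemma q_char_fund:
  assumes F: "folding t (a * exp t powi (int l - 2)) 0 l" and l: "l \<ge> 1" and a: "a \<noteq> 0"
  shows "q_char t 0 (fund_module t l a) u =
    card {T \<in> tableaux l. folding.mono t (a * exp t powi (int l - 2)) 0 l T = u}"
proof -
  interpret folding t "a * exp t powi (int l - 2)" 0 l by (rule F)
  have fin: "finite {T \<in> tableaux l. mono T = u}" for u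
    by (rule finite_subset[OF _ finite_mono_fibre[OF l, of u]]) (auto simp: tableaux_def)
  show ?thesis
  proof (rule q_char_diagonal(1)[OF root])
    show "vspace (fund_module t l a) = {v. Poly_Mapping.keys v \<subseteq> tableaux l}"
      by (simp add: fund_module_def)
    show "phi t (fund_module t l a) \<epsilon> i (sg \<epsilon> * int m) = diag (\<lambda>T. fund_phi t l a \<epsilon> i T $ m)" for \<epsilon> i m
      by (rule phi_fund[OF a q_sq])
    show "fund_phi t l a \<epsilon> i T = ell_weight t (mono T) \<epsilon> i" if "i \<in> idx 0" "T \<in> tableaux l" for \<epsilon> i T
      using that by (simp only: fund_phi_Phi[OF F] ell_weight_mono)
  qed (use fin mono_monomials in auto)
qed

section \<open>Folding\<close>

lemma fold_monomial_superset:
  assumes "finite S" "Poly_Mapping.keys u \<subseteq> S"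
  shows "fold_monomial n u =
     (\<Sum>(i, b)\<in>S. Poly_Mapping.single (i mod (int n + 1), b) (Poly_Mapping.lookup u (i, b)))"
  unfolding fold_monomial_def
  by (rule sum.mono_neutral_left) (use assms in \<open>auto simp: in_keys_iff\<close>)

lemma fold_monomial_add: "fold_monomial n (u + v) = fold_monomial n u + fold_monomial n v"
proof -
  let ?S = "Poly_Mapping.keys u \<union> Poly_Mapping.keys v"
  have "fold_monomial n w =
     (\<Sum>(i, b)\<in>?S. Poly_Mapping.single (i mod (int n + 1), b) (Poly_Mapping.lookup w (i, b)))"
    if "w \<in> {u, v, u + v}" for w
    by (rule fold_monomial_superset) (use that Poly_Mapping.keys_add[of u v] in auto)
  then show ?thesis
    by (simp add: lookup_add single_add sum.distrib[symmetric] case_prod_unfold)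
qed

lemma fold_monomial_single:
  "fold_monomial n (Poly_Mapping.single (i, b) c) = Poly_Mapping.single (i mod (int n + 1), b) c"
  using fold_monomial_superset[of "{(i, b)}" "Poly_Mapping.single (i, b) c" n] by simp

lemma fold_monomial_sum: "fold_monomial n (sum f K) = (\<Sum>k\<in>K. fold_monomial n (f k))"
proof -
  have "fold_monomial n 0 = 0" by (simp add: fold_monomial_def)
  then show ?thesis
    by (induction K rule: infinite_finite_induct) (simp_all add: fold_monomial_add)
qed

lemma fold_mono:
  assumes "folding t A 0 l" "folding t A (n + 1) l"
  shows "fold_monomial n (folding.mono t A 0 l T) = folding.mono t A (n + 1) l T"
  unfolding folding.mono_def[OF assms(1)] folding.mono_def[OF assms(2)] fold_monomial_sum
    diff_conv_add_uminus single_uminus[symmetric] fold_monomial_add fold_monomial_single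
  by (simp add: add.commute)

text \<open>The labels over \<open>u\<close> are grouped by their unfolded monomial. Since each
  folded fibre is finite, only finitely many unfolded monomials lie over \<open>u\<close>, which
  makes the folded sum well defined.\<close>

lemma fold_char_card:
  assumes \<chi>: "\<And>u. \<chi> u = card {T \<in> S. m T = u}"
    and fin: "\<And>u. finite {T \<in> S. fold_monomial n (m T) = u}"
  shows "fold_defined n \<chi>" "fold_char n \<chi> u = card {T \<in> S. fold_monomial n (m T) = u}"
proof -
  have fibre: "finite {T \<in> S. m T = u'}" for u'
    by (rule finite_subset[OF _ fin[of "fold_monomial n u'"]]) auto
  have eq: "{u'. \<chi> u' \<noteq> 0 \<and> fold_monomial n u' = u} = m ` {T \<in> S. fold_monomial n (m T) = u}" for u
    using fibre by (auto simp: \<chi> card_eq_0_iff)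
  then show "fold_defined n \<chi>"
    using fin by (simp add: fold_defined_def)
  let ?F = "{T \<in> S. fold_monomial n (m T) = u}"
  have "fold_char n \<chi> u = (\<Sum>u'\<in>m ` ?F. \<chi> u')"
    by (simp only: fold_char_def eq)
  also have "\<dots> = (\<Sum>u'\<in>m ` ?F. sum (\<lambda>_. 1) {T \<in> ?F. m T = u'})"
  proof (rule sum.cong)
    fix u' assume "u' \<in> m ` ?F"
    then have "{T \<in> ?F. m T = u'} = {T \<in> S. m T = u'}" by auto
    then show "\<chi> u' = sum (\<lambda>_. 1) {T \<in> ?F. m T = u'}" by (simp add: \<chi>)
  qed simp
  also have "\<dots> = sum (\<lambda>_. 1) ?F"
    by (rule sum.group) (use fin in auto)
  finally show "fold_char n \<chi> u = card ?F" by simp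
qed

theorem theorem5p3:
  fixes t a :: complex and l n :: nat
  assumes "\<And>k::nat. k > 0 \<Longrightarrow> exp t ^ k \<noteq> 1"
    and "l \<ge> 1" and "a \<noteq> 0" and "n \<ge> 2"
    and "(even n \<and> l \<le> n + 1) \<or> (odd n \<and> l \<le> (n + 1) div 2)"
  shows "fold_defined n (q_char t 0 (fund_module t l a)) \<and>
    (\<exists>M :: int list loop_module.
       loop_representation t (n + 1) M \<and> integrable t (n + 1) M \<and>
       fin_dim_ell_weight_spaces t (n + 1) M \<and>
       q_char t (n + 1) M = fold_char n (q_char t 0 (fund_module t l a)))"
proof -
  let ?A = "a * exp t powi (int l - 2)"
  have F0: "folding t ?A 0 l"
    by unfold_locales (use assms in auto)
  have F: "folding t ?A (n + 1) l"
  proof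
    fix d :: int assume d: "int (n + 1) dvd 2 * d" "\<bar>d\<bar> < int l"
    show "d = 0"
      using assms(5)
    proof
      assume n: "even n \<and> l \<le> n + 1"
      \<comment> \<open>For even \<open>n\<close> the modulus is odd, so it divides \<open>d\<close>
        itself and the bound \<open>n + 1\<close> suffices. For odd \<open>n\<close> only half of
        the modulus is known to divide \<open>d\<close>, which is the reason for the smaller bound
        on \<open>l\<close>.\<close>
      then have "coprime (int (n + 1)) 2" by simp
      then have "int (n + 1) dvd d" using d(1) by (simp add: coprime_dvd_mult_right_iff)
      then show "d = 0" using d(2) n zdvd_imp_le[of "int (n + 1)" "\<bar>d\<bar>"] by fastforce
    next
      assume n: "odd n \<and> l \<le> (n + 1) div 2"
      then obtain m where m: "n + 1 = 2 * m" by (metis even_Suc Suc_eq_plus1 evenE)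
      then have "int (n + 1) = 2 * int m" by linarith
      then have "int m dvd d" using d(1) by simp
      then show "d = 0" using d(2) n m zdvd_imp_le[of "int m" "\<bar>d\<bar>"] by fastforce
    qed
  qed (use assms in auto)
  interpret folding t ?A "n + 1" l by (rule F)
  let ?m = "folding.mono t ?A 0 l"
  have fold: "fold_monomial n (?m T) = mono T" for T
    by (rule fold_mono[OF F0 F])
  have fin: "finite {T \<in> tableaux l. fold_monomial n (?m T) = u}" for u
    unfolding fold
    by (rule finite_subset[OF _ finite_mono_fibre[OF assms(2), of u]]) (auto simp: tableaux_def)
  note * = fold_char_card[OF q_char_fund[OF F0 assms(2,3)] fin]
  have "q_char t (n + 1) folded_module = fold_char n (q_char t 0 (fund_module t l a))"
    by (rule ext) (simp only: q_char_folded(1)[OF assms(2)] *(2) fold)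
  then show ?thesis
    using *(1) representation integrable_folded q_char_folded(2)[OF assms(2)] by blast
qed

end
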